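(* Let $T_{k,j}$ ($k\ge1$, $1\le j\le n_k$) be real $d\times d$ matrices satisfying the standing assumption $0<\alpha_-\le\alpha_+<1$, and let $E^\omega$ be the non-autonomous affine set with random translations $\omega=\{\omega_{\mathbf u}:\mathbf u\in\Sigma^*\}$, where the $\omega_{\mathbf u}$ are independent identically distributed random vectors taking values in a bounded region $\mathcal{D}\subset\mathbb{R}^d$ with a common law $P_{\mathbf u}$ that is absolutely continuous with respect to $d$-dimensional Lebesgue measure, and $\mathbf{P}=\prod_{\mathbf u\in\Sigma^*}P_{\mathbf u}$ (see context). Let $s_A=\inf\{s\ge0:\mathcal{M}^s(\Sigma^\infty)=0\}$. Then for $\mathbf{P}$-almost all $\omega$: (1) $\dim_{\rm H}E^\omega=s_A$ if $s_A\le d$; (2) $\mathcal{L}^d(E^\omega)>0$ if $s_A>d$.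
   Context: Let $\{n_k\}_{k\ge1}$ be integers with $n_k\ge2$. Put $\Sigma^k=\{u_1\cdots u_k:1\le u_j\le n_j\}$, $\Sigma^0=\{\emptyset\}$, $\Sigma^*=\bigcup_{k\ge0}\Sigma^k$, and $\Sigma^\infty=\{u_1u_2\cdots:1\le u_k\le n_k\}$. For $\mathbf u\in\Sigma^*$, $\mathcal{C}_{\mathbf u}\subset\Sigma^\infty$ is the cylinder of infinite words beginning with $\mathbf u$, and $|\mathbf u|$ is the length of $\mathbf u$; for an infinite word $\mathbf u$, $\mathbf u|k=u_1\cdots u_k$. For $\mathbf u=u_1\cdots u_k$ write $T_{\mathbf u}=T_{1,u_1}\cdots T_{k,u_k}$. Non-autonomous affine set with random translations: let $J\subset\mathbb{R}^d$ be compact with non-empty interior. For $\mathbf u=u_1\cdots u_k\in\Sigma^*$ let $J_{\mathbf u}=\Psi_{u_1}\circ\cdots\circ\Psi_{u_k}(J)$, where $\Psi_{u_j}(x)=T_{j,u_j}x+\omega_{u_1\cdots u_j}$ with $\omega_{u_1\cdots u_j}$ from the random family $\omega$. It is assumed that the collection $\{J_{\mathbf u}\}$ fulfils the non-autonomous structure: $J_\emptyset=J$; $J_{\mathbf u1},\dots,J_{\mathbf un_k}\subset J_{\mathbf u}$ for all $k\ge1$ and $\mathbf u\in\Sigma^{k-1}$; and $\lim_{k\to\infty}\max_{\mathbf u\in\Sigma^k}\operatorname{diam}J_{\mathbf u}=0$. Then $E^\omega=\bigcap_{k\ge1}\bigcup_{\mathbf u\in\Sigma^k}J_{\mathbf u}$;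 equivalently $E^\omega=\{\Pi^\omega(\mathbf u):\mathbf u\in\Sigma^\infty\}$ with $\Pi^\omega(\mathbf u)=\omega_{u_1}+T_{1,u_1}\omega_{u_1u_2}+\cdots+T_{\mathbf u|k}\,\omega_{\mathbf u|k+1}+\cdots$. Singular values of a matrix $T$ are $\alpha_1(T)\ge\dots\ge\alpha_d(T)$. Standing assumption: all $T_{k,i}$ are nonsingular and $0<\alpha_-\le\alpha_+<1$, where $\alpha_+=\sup_{k,i}\alpha_1(T_{k,i})$, $\alpha_-=\inf_{k,i}\alpha_d(T_{k,i})$. Singular value function: for $0<s\le d$, $\phi^s(T)=\alpha_1(T)\cdots\alpha_{m-1}(T)\alpha_m(T)^{s-m+1}$ with $m$ the integer such that $m-1<s\le m$; $\phi^0(T)=1$; for $s>d$, $\phi^s(T)=(\alpha_1(T)\cdots\alpha_d(T))^{s/d}$. For $s\ge0$, $G\subset\Sigma^\infty$ and $k\ge1$, $\mathcal{M}^s_{(k)}(G)=\inf\{\sum_{\mathbf u}\phi^s(T_{\mathbf u}):G\subset\bigcup_{\mathbf u}\mathcal{C}_{\mathbf u},\ |\mathbf u|\ge k\}$ (infimum over covers of $G$ by cylinders of words of length at least $k$), and $\mathcal{M}^s(G)=\lim_{k\to\infty}\mathcal{M}^s_{(k)}(G)$. One has $s_A=\inf\{s:\mathcal{M}^s(\Sigma^\infty)=0\}=\sup\{s:\mathcal{M}^s(\Sigma^\infty)=\infty\}$. $\mathcal{L}^d$ is $d$-dimensional Lebesgue measure and $\dim_{\rm H}$ is Hausdorff dimension.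 *)

theory Defs
  imports "HOL-Probability.Probability" "HOL-Computational_Algebra.Computational_Algebra"
begin

section \<open>Singular values and the singular value function\<close>

definition charpoly :: "real^'d^'d \<Rightarrow> real poly" where
  "charpoly A = det (\<chi> i j. (if i = j then [:0, 1:] else 0) - [:A $ i $ j:])"

text \<open>The square roots of the eigenvalues of \<open>T\<^sup>t T\<close>, with multiplicity, in decreasing order.\<close>

definition singular_values :: "real^'d^'d \<Rightarrow> real list" where
  "singular_values T =
     rev (sorted_list_of_multiset (image_mset sqrt (proots (charpoly (transpose T ** T)))))"

text \<open>Numbered from 1: \<open>singular_value i T\<close> is \<open>\<alpha>\<^sub>i(T)\<close> for \<open>1 \<le> i \<le> d\<close>.\<close>

definition singular_value :: "nat \<Rightarrow> real^'d^'d \<Rightarrow> real" where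
  "singular_value i T = singular_values T ! (i - 1)"

text \<open>Only used for \<open>s \<ge> 0\<close>.  For \<open>0 < s \<le> d\<close> the integer \<open>m\<close> with \<open>m - 1 < s \<le> m\<close> is the
  ceiling of \<open>s\<close>.\<close>

definition svf :: "real \<Rightarrow> real^'d^'d \<Rightarrow> real" where
  "svf s T =
     (if s = 0 then 1
      else if s \<le> real CARD('d) then
        (let m = nat \<lceil>s\<rceil>
         in (\<Prod>i\<in>{1..<m}. singular_value i T) * singular_value m T powr (s - real m + 1))
      else (\<Prod>i\<in>{1..CARD('d)}. singular_value i T) powr (s / real CARD('d)))"


section \<open>Words and cylinders\<close>

text \<open>The \<open>j\<close>-th letter (\<open>j \<ge> 1\<close>) of a word \<open>u\<close>, finite or infinite, is \<open>u ! (j - 1)\<close> respectively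
  \<open>u (j - 1)\<close>, whereas the alphabet sizes \<open>n k\<close> and the matrices \<open>T k i\<close> are indexed from
  \<open>k = 1\<close> and \<open>i = 1\<close>; the value \<open>n 0\<close> and all other matrices are irrelevant.\<close>

definition words_of_length :: "(nat \<Rightarrow> nat) \<Rightarrow> nat \<Rightarrow> nat list set" where
  "words_of_length n k = {u. length u = k \<and> (\<forall>j<k. u ! j \<in> {1..n (Suc j)})}"

definition words :: "(nat \<Rightarrow> nat) \<Rightarrow> nat list set" where
  "words n = (\<Union>k. words_of_length n k)"

definition infinite_words :: "(nat \<Rightarrow> nat) \<Rightarrow> (nat \<Rightarrow> nat) set" where
  "infinite_words n = {x. \<forall>j. x j \<in> {1..n (Suc j)}}"

definition cylinder :: "(nat \<Rightarrow> nat) \<Rightarrow> nat list \<Rightarrow> (nat \<Rightarrow> nat) set" where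
  "cylinder n u = {x \<in> infinite_words n. map x [0..<length u] = u}"

definition word_matrix :: "(nat \<Rightarrow> nat \<Rightarrow> real^'d^'d) \<Rightarrow> nat list \<Rightarrow> real^'d^'d" where
  "word_matrix T u = foldr (**) (map (\<lambda>j. T (Suc j) (u ! j)) [0..<length u]) (mat 1)"


section \<open>Standing assumption on the matrices\<close>

text \<open>Extended reals, so that an unbounded family has supremum \<open>\<infinity>\<close>.\<close>

definition alpha_plus :: "(nat \<Rightarrow> nat) \<Rightarrow> (nat \<Rightarrow> nat \<Rightarrow> real^'d^'d) \<Rightarrow> ereal" where
  "alpha_plus n T = (SUP (k, i)\<in>{(k, i). 1 \<le> k \<and> 1 \<le> i \<and> i \<le> n k}. ereal (singular_value 1 (T k i)))"

definition alpha_minus :: "(nat \<Rightarrow> nat) \<Rightarrow> (nat \<Rightarrow> nat \<Rightarrow> real^'d^'d) \<Rightarrow> ereal" where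
  "alpha_minus n T =
     (INF (k, i)\<in>{(k, i). 1 \<le> k \<and> 1 \<le> i \<and> i \<le> n k}. ereal (singular_value CARD('d) (T k i)))"

definition standing_assumption :: "(nat \<Rightarrow> nat) \<Rightarrow> (nat \<Rightarrow> nat \<Rightarrow> real^'d^'d) \<Rightarrow> bool" where
  "standing_assumption n T \<longleftrightarrow>
     (\<forall>k\<ge>1. \<forall>i\<in>{1..n k}. invertible (T k i)) \<and>
     0 < alpha_minus n T \<and> alpha_minus n T \<le> alpha_plus n T \<and> alpha_plus n T < 1"


section \<open>The net measures on the symbolic space and the critical value\<close>

text \<open>As there are only countably many words, a cover by cylinders is given by a set of words.\<close>

definition net_premeasure ::
  "(nat \<Rightarrow> nat) \<Rightarrow> (nat \<Rightarrow> nat \<Rightarrow> real^'d^'d) \<Rightarrow> real \<Rightarrow> nat \<Rightarrow> (nat \<Rightarrow> nat) set \<Rightarrow> ennreal" where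
  "net_premeasure n T s k G =
     (INF A\<in>{A. A \<subseteq> {u \<in> words n. k \<le> length u} \<and> G \<subseteq> (\<Union>u\<in>A. cylinder n u)}.
        \<Sum>\<^sub>\<infinity>u\<in>A. ennreal (svf s (word_matrix T u)))"

definition net_measure ::
  "(nat \<Rightarrow> nat) \<Rightarrow> (nat \<Rightarrow> nat \<Rightarrow> real^'d^'d) \<Rightarrow> real \<Rightarrow> (nat \<Rightarrow> nat) set \<Rightarrow> ennreal" where
  "net_measure n T s G = lim (\<lambda>k. net_premeasure n T s k G)"

text \<open>Extended real valued: if the \<open>n k\<close> grow so fast that no \<open>s\<close> qualifies, the value is \<open>\<infinity>\<close>.\<close>

definition s_A :: "(nat \<Rightarrow> nat) \<Rightarrow> (nat \<Rightarrow> nat \<Rightarrow> real^'d^'d) \<Rightarrow> ereal" where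
  "s_A n T = Inf (ereal ` {s. 0 \<le> s \<and> net_measure n T s (infinite_words n) = 0})"


section \<open>Hausdorff measure and dimension\<close>

text \<open>The case distinction implements the conventions \<open>0\<^sup>0 = 1\<close> for nonempty sets of diameter \<open>0\<close>
  and value \<open>0\<close> for the empty set (in HOL, \<open>0 powr 0 = 0\<close>).\<close>

definition diam_power :: "real \<Rightarrow> 'a::metric_space set \<Rightarrow> real" where
  "diam_power s U = (if U = {} then 0 else if s = 0 then 1 else diameter U powr s)"

text \<open>Boundedness is required separately because \<open>diameter\<close> is unspecified on unbounded sets.\<close>

definition hausdorff_premeasure :: "real \<Rightarrow> real \<Rightarrow> 'a::metric_space set \<Rightarrow> ennreal" where
  "hausdorff_premeasure s \<delta> A =
     (INF U\<in>{U :: nat \<Rightarrow> 'a set. (\<forall>i. bounded (U i) \<and> diameter (U i) \<le> \<delta>) \<and> A \<subseteq> (\<Union>i. U i)}.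
        \<Sum>i. ennreal (diam_power s (U i)))"

definition hausdorff_measure :: "real \<Rightarrow> 'a::metric_space set \<Rightarrow> ennreal" where
  "hausdorff_measure s A = (SUP \<delta>\<in>{0<..}. hausdorff_premeasure s \<delta> A)"

definition hausdorff_dim :: "'a::metric_space set \<Rightarrow> ereal" where
  "hausdorff_dim A = Inf (ereal ` {s. 0 \<le> s \<and> hausdorff_measure s A = 0})"


section \<open>Non-autonomous affine sets\<close>

text \<open>\<open>Psi T \<omega> u j\<close> is the map \<open>\<Psi>\<^bsub>u\<^sub>j\<^esub>\<close> belonging to the \<open>j\<close>-th letter of \<open>u\<close>,
  for \<open>1 \<le> j \<le> length u\<close>; it depends on the first \<open>j\<close> letters through its translation.\<close>

definition Psi ::
  "(nat \<Rightarrow> nat \<Rightarrow> real^'d^'d) \<Rightarrow> (nat list \<Rightarrow> real^'d) \<Rightarrow> nat list \<Rightarrow> nat \<Rightarrow> real^'d \<Rightarrow> real^'d" where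
  "Psi T \<omega> u j x = T j (u ! (j - 1)) *v x + \<omega> (take j u)"

definition basic_set ::
  "(nat \<Rightarrow> nat \<Rightarrow> real^'d^'d) \<Rightarrow> (real^'d) set \<Rightarrow> (nat list \<Rightarrow> real^'d) \<Rightarrow> nat list \<Rightarrow> (real^'d) set" where
  "basic_set T J \<omega> u = foldr (\<circ>) (map (Psi T \<omega> u) [1..<Suc (length u)]) id ` J"

definition nonautonomous_structure ::
  "(nat \<Rightarrow> nat) \<Rightarrow> (nat \<Rightarrow> nat \<Rightarrow> real^'d^'d) \<Rightarrow> (real^'d) set \<Rightarrow> (nat list \<Rightarrow> real^'d) \<Rightarrow> bool" where
  "nonautonomous_structure n T J \<omega> \<longleftrightarrow>
     basic_set T J \<omega> [] = J \<and>
     (\<forall>k\<ge>1. \<forall>u\<in>words_of_length n (k - 1). \<forall>i\<in>{1..n k}.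
        basic_set T J \<omega> (u @ [i]) \<subseteq> basic_set T J \<omega> u) \<and>
     (\<lambda>k. Max ((\<lambda>u. diameter (basic_set T J \<omega> u)) ` words_of_length n k)) \<longlonglongrightarrow> 0"

definition affine_set ::
  "(nat \<Rightarrow> nat) \<Rightarrow> (nat \<Rightarrow> nat \<Rightarrow> real^'d^'d) \<Rightarrow> (real^'d) set \<Rightarrow> (nat list \<Rightarrow> real^'d) \<Rightarrow> (real^'d) set" where
  "affine_set n T J \<omega> = (\<Inter>k\<in>{1..}. \<Union>u\<in>words_of_length n k. basic_set T J \<omega> u)"

text \<open>The law of independent translations \<open>\<omega>\<^sub>u\<close> (\<open>u\<close> a finite word) with common law \<open>\<mu>\<close>.\<close>

definition translation_law ::
  "(nat \<Rightarrow> nat) \<Rightarrow> (real^'d) measure \<Rightarrow> (nat list \<Rightarrow> real^'d) measure" where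
  "translation_law n \<mu> = (\<Pi>\<^sub>M u\<in>words n. \<mu>)"

end

theory Submission
  imports Defs
begin

text \<open>Upper bound: the cells \<open>J\<^sub>u\<close> of a symbolic cover lie in ellipsoids with semi-axes proportional to the
  singular values of \<open>T\<^sub>u\<close>; cutting them into pieces of diameter about \<open>\<alpha>\<^sub>m(T\<^sub>u)\<close> costs \<open>\<phi>\<^sup>s(T\<^sub>u)\<close>.

  Lower bound: for \<open>s < s\<^sub>A\<close> max-flow min-cut gives masses on the words of length \<open>k\<close> with
  \<open>w(C\<^sub>u) \<le> \<phi>\<^sup>s(T\<^sub>u)\<close>.  If \<open>u\<close> and \<open>v\<close> have the longest common prefix \<open>x\<close>, then
  \<open>\<Pi> u - \<Pi> v = T\<^sub>x(\<omega>\<^sub>y + Y)\<close> with \<open>\<omega>\<^sub>y\<close> independent of \<open>Y\<close>, where \<open>y\<close> is the prefix of \<open>u\<close> that is one letter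
  longer than \<open>x\<close>, so \<open>\<Pi> u\<close> and \<open>\<Pi> v\<close> are \<open>r\<close>-close with probability \<open>O(r\<^sup>\<sigma> / \<phi>\<^sup>\<sigma>(T\<^sub>x))\<close>, and the expected
  energy of the projected masses is bounded.  This needs a bounded density, whereas the law of the translations
  is only absolutely continuous.  Hence only words all of whose translations lie in a set of probability \<open>p\<close>
  close to 1 on which the density is bounded are kept, with masses multiplied by \<open>p\<^sup>-\<^sup>k\<close>; as
  \<open>p > \<alpha>\<^sub>+\<^sup>s\<^sup>-\<^sup>\<sigma>\<close>, the energy stays bounded, and the total mass has variance tending to 0 as \<open>p \<rightarrow> 1\<close>.  All
  estimates are made at the finite levels \<open>k\<close>; Fatou's lemma for events gives, almost surely, infinitely many
  good levels, which by compactness suffice.\<close>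

unbundle no fps_syntax

section \<open>Spectral theorem and characteristic polynomial\<close>

text \<open>The exponents are chained as t < \<sigma> < s < \<open>s_A\<close>, and each gap pays
  for one loss. The gap s - \<sigma> gives a factor a^(s - \<sigma>) per letter of the common
  prefix, which absorbs the factor 1/p per letter of the percolation; the gap \<sigma> - t makes the
  sum over the dyadic scales converge. For positive Lebesgue measure \<sigma> = d is admissible
  since s > d, and one scale per level replaces the energy: a pair bound of order r^d at r
  comparable to a^k is an L2 bound for the mass smoothed at that scale. Level k is tied to the
  scales r >= a^k. Below a^k the atoms of the level-k mass may dominate; from a^k on, even a word
  paired with itself obeys the pair estimate. All random quantities are thus finite sums of
  indicators, so measurability is elementary and no random limit measure has to be constructed. The
  probabilistic part concerns the finite sums \<open>proj\<close> with an arbitrary fixed base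
  point. The geometry enters afterwards, for single \<omega> with
  \<open>nonautonomous_structure\<close>, where a base point in \<open>J\<close> puts these sums
  into the level sets.\<close>

text \<open>A maximiser v of the Rayleigh quotient on the unit sphere of V is an eigenvector: moving
  v in the direction of the residual u = f v - c v raises the quotient to first order by 2 t |u|^2,
  which the maximum forbids unless u = 0.\<close>

lemma selfadjoint_eigenvector:
  fixes f :: "'a::euclidean_space \<Rightarrow> 'a"
  assumes f: "linear f" and sa: "\<And>x y. f x \<bullet> y = x \<bullet> f y"
    and V: "subspace V" "V \<noteq> {0}" and inv: "\<And>x. x \<in> V \<Longrightarrow> f x \<in> V"
  obtains v c where "v \<in> V" "norm v = 1" "f v = c *\<^sub>R v"
proof -
  let ?S = "V \<inter> sphere 0 1"
  have cpt: "compact ?S"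
    using closed_subspace[OF V(1)] by (simp add: compact_Int_closed Int_commute closed_Int_compact)
  obtain w where w: "w \<in> V" "w \<noteq> 0"
    using V subspace_0 by blast
  have "(1 / norm w) *\<^sub>R w \<in> ?S"
    using w V by (simp add: subspace_scale)
  then have ne: "?S \<noteq> {}" by blast
  have "continuous_on ?S (\<lambda>x. x \<bullet> f x)"
    by (intro continuous_intros linear_continuous_on f linear_conv_bounded_linear[THEN iffD1])
  from continuous_attains_sup[OF cpt ne this]
  obtain v where v: "v \<in> ?S" and max: "\<And>x. x \<in> ?S \<Longrightarrow> x \<bullet> f x \<le> v \<bullet> f v"
    by blast
  define c where "c = v \<bullet> f v"
  have quad: "x \<bullet> f x \<le> c * (x \<bullet> x)" if "x \<in> V" for x
  proof (cases "x = 0")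
    case False
    have "(1 / norm x) *\<^sub>R x \<in> ?S"
      using False that V by (simp add: subspace_scale)
    from max[OF this] show ?thesis
      using False
      by (simp add: c_def linear_cmul[OF f] dot_square_norm field_simps power2_eq_square)
  qed (simp add: linear_0[OF f])
  define u where "u = f v - c *\<^sub>R v"
  have vV: "v \<in> V" "v \<bullet> v = 1" "norm v = 1"
    using v by (auto simp: dot_square_norm)
  have uV: "u \<in> V"
    unfolding u_def using vV V inv by (simp add: subspace_diff subspace_scale)
  define K where "K = c * (u \<bullet> u) - u \<bullet> f u"
  \<comment> \<open>This is \<open>quad\<close> at v + t u; the constant terms and the mixed terms
    with the factor c cancel.\<close>
  have "2 * t * (u \<bullet> u) \<le> t\<^sup>2 * K" for t
  proof -
    have "v + t *\<^sub>R u \<in> V" using vV uV V by (simp add: subspace_add subspace_scale)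
    from quad[OF this] have "(v + t *\<^sub>R u) \<bullet> (f v + t *\<^sub>R f u) \<le> c * ((v + t *\<^sub>R u) \<bullet> (v + t *\<^sub>R u))"
      by (simp add: linear_add[OF f] linear_cmul[OF f])
    moreover have "v \<bullet> f u = f v \<bullet> u" using sa by simp
    moreover have "f v \<bullet> u = u \<bullet> u + c * (u \<bullet> v)"
      by (simp add: u_def inner_diff inner_add algebra_simps inner_commute)
    ultimately show ?thesis
      by (simp add: K_def inner_add inner_commute c_def[symmetric] vV power2_eq_square algebra_simps)
  qed note * = this
  have "u \<bullet> u \<le> 0"
  proof (rule ccontr)
    assume "\<not> u \<bullet> u \<le> 0"
    then have pos: "u \<bullet> u > 0" by linarith
    \<comment> \<open>So small that t K is at most |u|^2, which contradicts the lower bound 2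
      |u|^2.\<close>
    define t where "t = (u \<bullet> u) / (\<bar>K\<bar> + 1)"
    have t: "t > 0" using pos by (simp add: t_def divide_pos_pos add_nonneg_pos)
    have "t * (2 * (u \<bullet> u)) \<le> t * (t * K)"
      using *[of t] by (simp only: power2_eq_square mult_ac)
    then have "2 * (u \<bullet> u) \<le> t * K"
      using t by (simp only: mult_le_cancel_left_pos)
    also have "t * K \<le> t * (\<bar>K\<bar> + 1)"
      using t by (intro mult_left_mono) auto
    also have "\<dots> = u \<bullet> u"
      by (simp add: t_def add_nonneg_eq_0_iff)
    finally show False using pos by linarith
  qed
  then have "u = 0" by (metis inner_eq_zero_iff inner_ge_zero order_antisym)
  then show ?thesis using that[of v c] vV by (simp add: u_def)
qed

text \<open>An orthonormal set of eigenvectors of maximal size is a basis: by self-adjointness its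
  orthogonal complement is invariant, and an eigenvector found there would enlarge the set.
  Maximality replaces an induction over invariant subspaces.\<close>

lemma selfadjoint_eigenbasis:
  fixes f :: "'a::euclidean_space \<Rightarrow> 'a"
  assumes f: "linear f" and sa: "\<And>x y. f x \<bullet> y = x \<bullet> f y"
  obtains B where "pairwise orthogonal B" "\<And>b. b \<in> B \<Longrightarrow> norm b = 1"
    "\<And>b. b \<in> B \<Longrightarrow> \<exists>c. f b = c *\<^sub>R b" "card B = DIM('a)"
proof -
  let ?P = "\<lambda>B. pairwise orthogonal B \<and> (\<forall>b\<in>B. norm b = 1) \<and> (\<forall>b\<in>B. \<exists>c. f b = c *\<^sub>R b)"
  have bound: "finite B \<and> card B \<le> DIM('a)" if "?P B" for B
  proof -
    have "0 \<notin> B" using that by auto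
    then have "independent B" using that pairwise_orthogonal_independent by blast
    then show ?thesis using independent_bound by blast
  qed
  have "?P {}" by simp
  moreover have "\<forall>B. ?P B \<longrightarrow> card B < Suc DIM('a)" using bound by (simp add: less_Suc_eq_le)
  ultimately have "\<exists>B. ?P B \<and> (\<forall>C. ?P C \<longrightarrow> card C \<le> card B)"
    by (rule Lattices_Big.ex_has_greatest_nat)
  then obtain B where B: "?P B" and max: "\<And>C. ?P C \<Longrightarrow> card C \<le> card B"
    by blast
  define V where "V = {x. \<forall>b\<in>B. orthogonal b x}"
  have V: "subspace V"
    unfolding V_def by (rule subspace_orthogonal_to_vectors)
  have inv: "f x \<in> V" if "x \<in> V" for x
  proof -
    have "orthogonal b (f x)" if b: "b \<in> B" for b
    proof -
      obtain c where "f b = c *\<^sub>R b" using B b by blast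
      then show ?thesis
        using \<open>x \<in> V\<close> b sa[of b x] by (simp add: V_def orthogonal_def)
    qed
    then show ?thesis by (simp add: V_def)
  qed
  have "V = {0}"
  proof (rule ccontr)
    assume "V \<noteq> {0}"
    from selfadjoint_eigenvector[OF f sa V this inv]
    obtain v c where v: "v \<in> V" "norm v = 1" "f v = c *\<^sub>R v" by blast
    have "v \<notin> B"
      using v by (auto simp: V_def orthogonal_def dot_square_norm)
    moreover have "?P (insert v B)"
      using B v by (auto simp: V_def pairwise_insert orthogonal_commute)
    ultimately show False
      using max[of "insert v B"] bound[OF B] by simp
  qed
  have "card B = DIM('a)"
  proof (rule ccontr)
    assume "card B \<noteq> DIM('a)"
    then have "card B < DIM('a)" using bound[OF B] by simp
    moreover have "dim B \<le> card B" using bound[OF B] by (simp add: dim_le_card')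
    ultimately have "dim B < DIM('a)" by simp
    then obtain x where x: "x \<noteq> 0" "\<And>y. y \<in> span B \<Longrightarrow> orthogonal x y"
      by (rule orthogonal_to_subspace_exists) blast
    then have "x \<in> V" by (auto simp: V_def span_base orthogonal_commute)
    then show False using \<open>V = {0}\<close> x by simp
  qed
  with B show ?thesis using that[of B] by blast
qed

text \<open>\<open>charpoly\<close> is a determinant over the polynomial ring, so the change to the
  eigenbasis is made there: the rows of \<open>Q\<close> are the vectors b i as constant
  polynomials, \<open>Q ** (X ** transpose Q)\<close> is diagonal, and
  \<open>Q ** transpose Q\<close> is the identity.\<close>

lemma charpoly_diagonalizable:
  fixes S :: "real^'d^'d" and b :: "'d \<Rightarrow> real^'d"
  assumes b: "\<And>i j. b i \<bullet> b j = (if i = j then 1 else 0)"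
    and ev: "\<And>i. S *v b i = c i *\<^sub>R b i"
  shows "charpoly S = (\<Prod>i\<in>UNIV. [:- c i, 1:])"
proof -
  define P :: "real^'d^'d" where "P = (\<chi> i j. b i $ j)"
  have PPt: "P ** transpose P = mat 1"
    by (simp add: P_def matrix_matrix_mult_def transpose_def mat_def vec_eq_iff
        b[unfolded inner_vec_def inner_real_def])
  have SP: "(\<Sum>l\<in>UNIV. S $ k $ l * b i $ l) = c i * b i $ k" for i k
    using ev[of i] by (simp add: matrix_vector_mult_def vec_eq_iff)
  define Q :: "real poly^'d^'d" where "Q = (\<chi> i j. [:P $ i $ j:])"
  define X :: "real poly^'d^'d" where
    "X = (\<chi> i j. (if i = j then [:0, 1:] else 0) - [:S $ i $ j:])"
  have sumC: "(\<Sum>k\<in>A. [:g k:]) = [:\<Sum>k\<in>A. g k:]" for A and g :: "'d \<Rightarrow> real"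
    by (induction A rule: infinite_finite_induct) auto
  have QQt: "Q ** transpose Q = mat 1"
    using PPt by (simp add: Q_def matrix_matrix_mult_def transpose_def mat_def vec_eq_iff sumC one_pCons)
  have 1: "X ** transpose Q = (\<chi> k i. [:- c i, 1:] * [:b i $ k:])"
  proof -
    have "(\<Sum>l\<in>UNIV. ((if k = l then [:0, 1:] else 0) - [:S $ k $ l:]) * [:b i $ l:]) =
       [:- c i, 1:] * [:b i $ k:]" for k i
    proof -
      have "(\<Sum>l\<in>UNIV. ((if k = l then [:0, 1:] else 0) - [:S $ k $ l:]) * [:b i $ l:]) =
         (\<Sum>l\<in>UNIV. (if k = l then [:0, 1:] * [:b i $ l:] else 0)) - (\<Sum>l\<in>UNIV. [:S $ k $ l * b i $ l:])"
        by (subst sum_subtractf[symmetric], rule sum.cong) (auto simp: algebra_simps)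
      also have "\<dots> = [:0, 1:] * [:b i $ k:] - [:c i * b i $ k:]"
        by (simp add: sumC SP)
      finally show ?thesis by simp
    qed
    then show ?thesis
      by (simp add: X_def Q_def P_def matrix_matrix_mult_def transpose_def vec_eq_iff)
  qed
  have 2: "Q ** (X ** transpose Q) = (\<chi> i j. if i = j then [:- c i, 1:] else 0)"
  proof -
    have "(\<Sum>k\<in>UNIV. [:b i $ k:] * ([:- c j, 1:] * [:b j $ k:])) = (if i = j then [:- c i, 1:] else 0)" for i j
    proof -
      have "(\<Sum>k\<in>UNIV. [:b i $ k:] * ([:- c j, 1:] * [:b j $ k:])) = [:- c j, 1:] * (\<Sum>k\<in>UNIV. [:b i $ k * b j $ k:])"
        by (subst sum_distrib_left, rule sum.cong) (auto simp: algebra_simps)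
      also have "\<dots> = [:- c j, 1:] * [:b i \<bullet> b j:]"
        by (simp add: sumC inner_vec_def)
      finally show ?thesis by (simp add: b)
    qed
    then show ?thesis
      unfolding 1 by (simp only: Q_def P_def matrix_matrix_mult_def vec_eq_iff vec_lambda_beta) simp
  qed
  have "det (Q ** (X ** transpose Q)) = (\<Prod>i\<in>UNIV. [:- c i, 1:])"
    unfolding 2 by (subst det_diagonal) auto
  moreover have "det (Q ** (X ** transpose Q)) = det X * det (Q ** transpose Q)"
    by (simp add: det_mul)
  ultimately show ?thesis
    by (simp add: QQt charpoly_def X_def)
qed

section \<open>Singular values\<close>

lemma orthonormal_expansion:
  fixes b :: "'d::finite \<Rightarrow> real^'d"
  assumes b: "\<And>i j. b i \<bullet> b j = (if i = j then 1 else 0)"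
  shows "(\<Sum>i\<in>UNIV. (b i \<bullet> x) *\<^sub>R b i) = x"
proof -
  have inj: "inj b"
    by (rule injI) (metis b zero_neq_one)
  have orth: "pairwise orthogonal (range b)"
    by (auto simp: pairwise_def orthogonal_def b)
  have "0 \<notin> range b"
    using b by (metis image_iff inner_zero_left zero_neq_one)
  then have "independent (range b)"
    using orth pairwise_orthogonal_independent by blast
  moreover have "card (range b) = dim (UNIV :: (real^'d) set)"
    using inj by (simp add: card_image)
  ultimately have "UNIV \<subseteq> span (range b)"
    by (intro card_ge_dim_independent) auto
  then have "(\<Sum>i\<in>range b. (x \<bullet> i) *\<^sub>R i) = x"
    using orth by (intro orthonormal_basis_expand) (auto simp: norm_eq_1 b)
  then show ?thesis
    using inj by (simp add: sum.reindex inner_commute)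
qed

lemma orthonormal_inner_expansion:
  fixes b :: "'d::finite \<Rightarrow> real^'d"
  assumes b: "\<And>i j. b i \<bullet> b j = (if i = j then 1 else 0)"
  shows "x \<bullet> y = (\<Sum>i\<in>UNIV. (b i \<bullet> x) * (b i \<bullet> y))"
proof -
  have "x \<bullet> y = (\<Sum>i\<in>UNIV. (b i \<bullet> x) *\<^sub>R b i) \<bullet> y"
    by (simp add: orthonormal_expansion[OF b])
  then show ?thesis by (simp add: inner_sum_left)
qed

text \<open>The vectors \<open>b\<close> are eigenvectors of T^t T. The index type \<open>'d\<close>
  carries no order, so \<open>g\<close> records the position of each in the decreasing list, and
  sums or products over \<open>'d\<close> can be reindexed by {1..d}. Of the decomposition only the
  formula for |T x| is kept; left singular vectors are never formed.\<close>

lemma singular_value_decomposition: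
  fixes T :: "real^'d^'d"
  obtains b :: "'d \<Rightarrow> real^'d" and g :: "'d \<Rightarrow> nat"
  where "\<And>i j. b i \<bullet> b j = (if i = j then 1 else 0)"
    and "bij_betw g UNIV {1..CARD('d)}"
    and "\<And>x. (norm (T *v x))\<^sup>2 = (\<Sum>i\<in>UNIV. (singular_value (g i) T * (b i \<bullet> x))\<^sup>2)"
    and "\<And>k. k \<in> {1..CARD('d)} \<Longrightarrow> 0 \<le> singular_value k T"
    and "\<And>j k. 1 \<le> j \<Longrightarrow> j \<le> k \<Longrightarrow> k \<le> CARD('d) \<Longrightarrow> singular_value k T \<le> singular_value j T"
proof -
  let ?S = "transpose T ** T"
  have adj: "x \<bullet> (?S *v y) = (T *v x) \<bullet> (T *v y)" for x y
    by (metis dot_lmul_matrix matrix_vector_mul_assoc transpose_matrix_vector inner_commute)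
  have "(?S *v x) \<bullet> y = x \<bullet> (?S *v y)" for x y
    using adj[of x y] adj[of y x] by (simp add: inner_commute)
  from selfadjoint_eigenbasis[OF matrix_vector_mul_linear this]
  obtain B where B: "pairwise orthogonal B" "\<And>b. b \<in> B \<Longrightarrow> norm b = 1"
    "\<And>b. b \<in> B \<Longrightarrow> \<exists>c. ?S *v b = c *\<^sub>R b" "card B = DIM(real^'d)"
    by blast
  have "finite B" using B(4) by (metis card.infinite DIM_positive less_irrefl)
  then obtain b :: "'d \<Rightarrow> real^'d" where bB: "bij_betw b UNIV B"
    using finite_same_card_bij[of "UNIV :: 'd set" B] B(4) by auto
  have bmem: "b i \<in> B" for i using bB by (auto simp: bij_betw_def)
  have b: "b i \<bullet> b j = (if i = j then 1 else 0)" for i j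
  proof (cases "i = j")
    case False
    then have "b i \<noteq> b j" using bB by (auto simp: bij_betw_def inj_def)
    then show ?thesis using False B(1) bmem by (auto simp: pairwise_def orthogonal_def)
  qed (simp add: B(2) bmem dot_square_norm)
  have "\<exists>c. \<forall>i. ?S *v b i = c i *\<^sub>R b i"
    by (rule choice) (use B(3)[OF bmem] in blast)
  then obtain c where c: "\<And>i. ?S *v b i = c i *\<^sub>R b i"
    by blast
  have cT: "c i = (norm (T *v b i))\<^sup>2" for i
  proof -
    have "c i = b i \<bullet> (?S *v b i)" by (simp add: c b)
    then show ?thesis by (simp only: adj dot_square_norm)
  qed
  obtain xs :: "'d list" where xs: "set xs = UNIV" "distinct xs"
    using finite_distinct_list[of "UNIV :: 'd set"] by auto
  have "proots (charpoly ?S) = (\<Sum>i\<in>UNIV. {#c i#})"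
    unfolding charpoly_diagonalizable[OF b c] by (subst proots_prod) auto
  also have "\<dots> = image_mset c (mset_set UNIV)"
    by (simp add: sum_unfold_sum_mset image_mset.compositionality comp_def)
  also have "mset_set UNIV = mset xs"
    using xs by (metis mset_set_set)
  finally have pr: "proots (charpoly ?S) = image_mset c (mset xs)" .
  define f where "f = (\<lambda>i. sqrt (c i))"
  \<comment> \<open>Sorting the indices by their singular value, and not the values themselves,
    keeps track of which vector belongs to which entry when values repeat.\<close>
  define ys where "ys = rev (sort_key f xs)"
  have "sort (map f xs) = map f (sort_key f xs)"
    by (rule properties_for_sort) auto
  then have sv: "singular_values T = map f ys"
    unfolding singular_values_def pr ys_def
    by (simp add: f_def image_mset.compositionality comp_def rev_map flip: mset_map)
  have ys: "distinct ys" "set ys = UNIV" "length ys = CARD('d)"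
    using xs by (auto simp: ys_def) (metis distinct_card)
  have sorted: "sorted_wrt (\<ge>) (map f ys)"
    unfolding ys_def rev_map[symmetric] sorted_wrt_rev by simp
  have "bij_betw (\<lambda>k. ys ! k) {..<CARD('d)} UNIV"
    using bij_betw_nth[of ys "{..<CARD('d)}" UNIV] ys by simp
  moreover have "bij_betw (\<lambda>k. k - 1) {1..CARD('d)} {..<CARD('d)}"
    by (rule bij_betwI[where g = Suc]) auto
  ultimately have h: "bij_betw (\<lambda>k. ys ! (k - 1)) {1..CARD('d)} UNIV"
    using bij_betw_trans by (fastforce simp: comp_def)
  define g where "g = inv_into {1..CARD('d)} (\<lambda>k. ys ! (k - 1))"
  have g: "bij_betw g UNIV {1..CARD('d)}"
    unfolding g_def by (rule bij_betw_inv_into[OF h])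
  have gy: "ys ! (g i - 1) = i" for i
    unfolding g_def using bij_betw_inv_into_right[OF h, of i] by simp
  have gm: "g i \<in> {1..CARD('d)}" for i using g by (auto simp: bij_betw_def)
  have svg: "singular_value (g i) T = f i" for i
  proof -
    have "g i - 1 < length ys" using gm[of i] ys(3) by auto
    then show ?thesis using gy[of i] by (simp add: singular_value_def sv)
  qed
  show ?thesis
  proof (rule that[OF b g])
    fix x
    have "(norm (T *v x))\<^sup>2 = x \<bullet> (?S *v x)" by (simp add: adj dot_square_norm)
    also have "?S *v x = ?S *v (\<Sum>i\<in>UNIV. (b i \<bullet> x) *\<^sub>R b i)"
      by (simp add: orthonormal_expansion[OF b])
    also have "\<dots> = (\<Sum>i\<in>UNIV. (b i \<bullet> x) *\<^sub>R (c i *\<^sub>R b i))"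
      by (simp add: linear_sum[OF matrix_vector_mul_linear] linear_cmul[OF matrix_vector_mul_linear] c
          del: scaleR_scaleR)
    also have "x \<bullet> \<dots> = (\<Sum>i\<in>UNIV. (sqrt (c i) * (b i \<bullet> x))\<^sup>2)"
      by (simp add: inner_sum_right power_mult_distrib cT power2_eq_square inner_commute mult_ac)
    finally show "(norm (T *v x))\<^sup>2 = (\<Sum>i\<in>UNIV. (singular_value (g i) T * (b i \<bullet> x))\<^sup>2)"
      by (simp add: svg f_def)
  next
    fix k assume "k \<in> {1..CARD('d)}"
    then show "0 \<le> singular_value k T"
      using ys(3) by (auto simp: singular_value_def sv f_def cT)
  next
    fix j k assume "1 \<le> j" "j \<le> k" "k \<le> CARD('d)"
    then show "singular_value k T \<le> singular_value j T"
      using sorted ys(3) by (cases "j = k") (auto simp: singular_value_def sv sorted_wrt_iff_nth_less)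
  qed
qed

lemma singular_value_antimono:
  fixes T :: "real^'d^'d"
  shows "1 \<le> j \<Longrightarrow> j \<le> k \<Longrightarrow> k \<le> CARD('d) \<Longrightarrow> singular_value k T \<le> singular_value j T"
  by (rule singular_value_decomposition[of T]) blast

text \<open>Bounds on |T x| for unit vectors x, from below or above, become bounds on every singular
  value through the singular vector that attains it.\<close>

lemma singular_value_norm_eq:
  fixes T :: "real^'d^'d"
  assumes "k \<in> {1..CARD('d)}"
  obtains x where "norm x = 1" "norm (T *v x) = singular_value k T"
proof (rule singular_value_decomposition[of T])
  fix b :: "'d \<Rightarrow> real^'d" and g :: "'d \<Rightarrow> nat"
  assume b: "\<And>i j. b i \<bullet> b j = (if i = j then 1 else 0)"
    and g: "bij_betw g UNIV {1..CARD('d)}"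
    and T: "\<And>x. (norm (T *v x))\<^sup>2 = (\<Sum>i\<in>UNIV. (singular_value (g i) T * (b i \<bullet> x))\<^sup>2)"
    and nn: "\<And>k. k \<in> {1..CARD('d)} \<Longrightarrow> 0 \<le> singular_value k T"
  obtain j where j: "g j = k" using g assms by (metis bij_betw_imp_surj_on image_iff)
  have "(norm (T *v b j))\<^sup>2 = (singular_value k T)\<^sup>2"
    unfolding T b by (simp add: if_distrib[of "\<lambda>y. (_ * y)\<^sup>2"] j cong: if_cong)
  then have "norm (T *v b j) = singular_value k T"
    using nn assms by (simp add: power2_eq_iff_nonneg)
  moreover have "norm (b j) = 1" by (simp add: norm_eq_1 b)
  ultimately show thesis using that by blast
qed

lemma singular_value_nonneg:
  fixes T :: "real^'d^'d"
  assumes "k \<in> {1..CARD('d)}"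
  shows "0 \<le> singular_value k T"
  using singular_value_norm_eq[OF assms] by (metis norm_ge_zero)

lemma singular_value_pos:
  fixes T :: "real^'d^'d"
  assumes "invertible T" "k \<in> {1..CARD('d)}"
  shows "0 < singular_value k T"
proof -
  obtain x where x: "norm x = 1" "norm (T *v x) = singular_value k T"
    using singular_value_norm_eq assms by blast
  have "T *v x \<noteq> 0"
    using assms(1) x(1) by (metis invertible_left_inverse matrix_left_invertible_ker norm_zero zero_neq_one)
  then show ?thesis using x by (metis zero_less_norm_iff)
qed

lemma norm_matrix_le_singular_value:
  fixes T :: "real^'d^'d"
  shows "norm (T *v x) \<le> singular_value 1 T * norm x"
proof (rule singular_value_decomposition[of T])
  fix b :: "'d \<Rightarrow> real^'d" and g :: "'d \<Rightarrow> nat"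
  assume b: "\<And>i j. b i \<bullet> b j = (if i = j then 1 else 0)"
    and g: "bij_betw g UNIV {1..CARD('d)}"
    and T: "\<And>x. (norm (T *v x))\<^sup>2 = (\<Sum>i\<in>UNIV. (singular_value (g i) T * (b i \<bullet> x))\<^sup>2)"
    and nn: "\<And>k. k \<in> {1..CARD('d)} \<Longrightarrow> 0 \<le> singular_value k T"
    and mono: "\<And>j k. 1 \<le> j \<Longrightarrow> j \<le> k \<Longrightarrow> k \<le> CARD('d) \<Longrightarrow> singular_value k T \<le> singular_value j T"
  have gm: "g i \<in> {1..CARD('d)}" for i using g by (auto simp: bij_betw_def)
  have "(norm (T *v x))\<^sup>2 \<le> (\<Sum>i\<in>UNIV. (singular_value 1 T)\<^sup>2 * (b i \<bullet> x)\<^sup>2)"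
    unfolding T power_mult_distrib using gm nn mono
    by (intro sum_mono mult_right_mono power_mono) auto
  also have "\<dots> = (singular_value 1 T)\<^sup>2 * (x \<bullet> x)"
    unfolding orthonormal_inner_expansion[OF b, of x x]
    by (simp add: sum_distrib_left power2_eq_square)
  also have "\<dots> = (singular_value 1 T * norm x)\<^sup>2"
    by (simp add: dot_square_norm power_mult_distrib)
  finally show ?thesis
    by (rule power2_le_imp_le) (simp add: singular_value_nonneg)
qed

text \<open>The exponent of the \<open>i\<close>-th singular value in \<open>\<phi>\<^sup>s\<close>.\<close>

definition svexp :: "real \<Rightarrow> nat \<Rightarrow> real" where
  "svexp s i = max 0 (min 1 (s - real i + 1))"

lemma svexp_bounds: "0 \<le> svexp s i" "svexp s i \<le> 1"
  by (auto simp: svexp_def)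

lemma svexp_mono: "r \<le> s \<Longrightarrow> svexp r i \<le> svexp s i"
  by (auto simp: svexp_def)

text \<open>\<open>svexp s i\<close> is the length of the part of [0, s] inside [i - 1, i], and
  these parts fill [0, min s N].\<close>

lemma sum_svexp: "0 \<le> s \<Longrightarrow> (\<Sum>i\<in>{1..N}. svexp s i) = min s (real N)"
proof (induction N)
  case (Suc N)
  then have "(\<Sum>i\<in>{1..Suc N}. svexp s i) = min s (real N) + max 0 (min 1 (s - real N))"
    by (simp add: svexp_def)
  also have "\<dots> = min s (real (Suc N))" by (auto simp: min_def max_def)
  finally show ?case .
qed simp

text \<open>With one exponent in [0, 1] per singular value, different \<open>s\<close> can be
  compared factor by factor, without the ceiling. Positivity of the singular values matters: a
  factor with exponent 0 has to be 1, whereas \<open>0 powr 0 = 0\<close>.\<close>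

lemma svf_eq_prod:
  fixes T :: "real^'d^'d"
  assumes T: "invertible T" and s: "0 \<le> s" "s \<le> real CARD('d)"
  shows "svf s T = (\<Prod>i\<in>{1..CARD('d)}. singular_value i T powr svexp s i)"
proof (cases "s = 0")
  case True
  have "svexp 0 i = 0" if "i \<in> {1..CARD('d)}" for i using that by (auto simp: svexp_def)
  moreover have "singular_value i T \<noteq> 0" if "i \<in> {1..CARD('d)}" for i
    using singular_value_pos[OF T that] by simp
  ultimately have "(\<Prod>i\<in>{1..CARD('d)}. singular_value i T powr svexp s i) = (\<Prod>i\<in>{1..CARD('d)}. 1)"
    using True by (intro prod.cong) auto
  then show ?thesis using True by (simp add: svf_def)
next
  case False
  define m where "m = nat \<lceil>s\<rceil>"
  have m: "1 \<le> m" "m \<le> CARD('d)" "real m - 1 < s" "s \<le> real m"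
    using False s unfolding m_def by linarith+
  have 1: "singular_value i T powr svexp s i = singular_value i T" if "i \<in> {1..<m}" for i
  proof -
    have "svexp s i = 1" using that m by (auto simp: svexp_def)
    then show ?thesis using singular_value_pos[OF T, of i] that m by auto
  qed
  have 2: "singular_value i T powr svexp s i = 1" if "i \<in> {m<..CARD('d)}" for i
  proof -
    have "svexp s i = 0" using that m by (auto simp: svexp_def)
    then show ?thesis using singular_value_pos[OF T, of i] that m by auto
  qed
  have 3: "svexp s m = s - real m + 1" using m by (auto simp: svexp_def)
  have "{1..CARD('d)} = {1..<m} \<union> ({m} \<union> {m<..CARD('d)})" using m by auto
  then have "(\<Prod>i\<in>{1..CARD('d)}. singular_value i T powr svexp s i) =
    (\<Prod>i\<in>{1..<m}. singular_value i T powr svexp s i) * (singular_value m T powr svexp s m *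
      (\<Prod>i\<in>{m<..CARD('d)}. singular_value i T powr svexp s i))"
    by (simp only:) (subst prod.union_disjoint; auto)
  also have "\<dots> = (\<Prod>i\<in>{1..<m}. singular_value i T) * (singular_value m T powr (s - real m + 1) * 1)"
    using 1 2 3 by simp
  finally have "(\<Prod>i\<in>{1..CARD('d)}. singular_value i T powr svexp s i) =
    (\<Prod>i\<in>{1..<m}. singular_value i T) * singular_value m T powr (s - real m + 1)" by simp
  then show ?thesis using False s by (simp add: svf_def m_def Let_def)
qed

lemma svf_pos:
  fixes T :: "real^'d^'d"
  assumes "invertible T" "0 \<le> s"
  shows "0 < svf s T"
proof -
  have nz: "singular_value i T \<noteq> 0" if "i \<in> {1..CARD('d)}" for i
    using singular_value_pos[OF assms(1) that] by simp
  show ?thesis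
  proof (cases "s \<le> real CARD('d)")
    case True
    show ?thesis
      unfolding svf_eq_prod[OF assms True] using nz by (intro prod_pos) simp
  next
    case False
    have "(\<Prod>i\<in>{1..CARD('d)}. singular_value i T) \<noteq> 0"
      using nz by (subst prod_zero_iff) blast+
    then show ?thesis
      using False assms(2) by (simp add: svf_def)
  qed
qed

text \<open>Beyond d, \<open>svf\<close> is a power of the product of all singular values. The
  factor gained over exponent d is that product to the power (s - d) / d, and the product is at most
  the d-th power of the largest singular value.\<close>

lemma svf_above_dim:
  fixes T :: "real^'d^'d"
  assumes T: "invertible T" and s: "real CARD('d) \<le> s"
  shows "svf s T \<le> svf (real CARD('d)) T * singular_value 1 T powr (s - real CARD('d))"
proof -
  let ?d = "real CARD('d)" and ?P = "\<Prod>i\<in>{1..CARD('d)}. singular_value i T"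
  have sv: "0 < singular_value i T" if "i \<in> {1..CARD('d)}" for i
    using singular_value_pos[OF T that] .
  have P: "?P > 0" using sv by (auto intro!: prod_pos)
  have "svf ?d T = (\<Prod>i\<in>{1..CARD('d)}. singular_value i T powr svexp ?d i)"
    by (rule svf_eq_prod[OF T]) auto
  also have "\<dots> = ?P"
  proof (rule prod.cong)
    fix i assume i: "i \<in> {1..CARD('d)}"
    then have "svexp ?d i = 1" by (auto simp: svexp_def)
    then show "singular_value i T powr svexp ?d i = singular_value i T" using sv[OF i] by simp
  qed simp
  finally have d: "svf ?d T = ?P" .
  have "svf s T = ?P powr (s / ?d)"
  proof (cases "s = ?d")
    case True then show ?thesis using d P by simp
  next
    case False then show ?thesis using s by (simp add: svf_def)
  qed
  also have "s / ?d = 1 + (s - ?d) / ?d" by (simp add: field_simps)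
  also have "?P powr \<dots> = ?P * ?P powr ((s - ?d) / ?d)"
    using P by (simp only: powr_add powr_one)
  also have "?P powr ((s - ?d) / ?d) \<le> ((singular_value 1 T) ^ CARD('d)) powr ((s - ?d) / ?d)"
  proof (rule powr_mono2)
    have "?P \<le> (\<Prod>i\<in>{1..CARD('d)}. singular_value 1 T)"
      using sv singular_value_antimono[of 1 _ T] by (intro prod_mono) (auto simp: less_imp_le)
    then show "?P \<le> (singular_value 1 T) ^ CARD('d)" by simp
  qed (use P s in auto)
  also have "\<dots> = singular_value 1 T powr (s - ?d)"
    using sv[of 1] by (simp add: powr_realpow[symmetric] powr_powr Suc_leI)
  finally show ?thesis using P by (simp add: d)
qed

text \<open>Raising r to s adds exponents of total amount s - r, each on a singular value not above
  the first; beyond d, \<open>svf_above_dim\<close> continues. For word matrices the gained factor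
  decays geometrically in the length of the word, which makes the series over the levels
  converge.\<close>

lemma svf_le_svf_mult:
  fixes T :: "real^'d^'d"
  assumes T: "invertible T" and r: "0 \<le> r" "r \<le> s" "r \<le> real CARD('d)"
  shows "svf s T \<le> svf r T * singular_value 1 T powr (s - r)"
proof -
  let ?d = "real CARD('d)"
  have sv: "0 < singular_value i T" if "i \<in> {1..CARD('d)}" for i
    using singular_value_pos[OF T that] .
  have sv1: "0 < singular_value 1 T" using sv[of 1] by (simp add: Suc_leI)
  have le: "svf t T \<le> svf r T * singular_value 1 T powr (t - r)" if "r \<le> t" "t \<le> ?d" for t
  proof -
    have "svf t T = (\<Prod>i\<in>{1..CARD('d)}. singular_value i T powr svexp t i)"
      using r that by (intro svf_eq_prod T) auto
    also have "\<dots> \<le> (\<Prod>i\<in>{1..CARD('d)}. singular_value i T powr svexp r i *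
        singular_value 1 T powr (svexp t i - svexp r i))"
    proof (rule prod_mono, safe)
      fix i assume i: "i \<in> {1..CARD('d)}"
      have "singular_value i T powr svexp t i =
        singular_value i T powr svexp r i * singular_value i T powr (svexp t i - svexp r i)"
        by (simp add: powr_add[symmetric])
      also have "singular_value i T powr (svexp t i - svexp r i) \<le>
          singular_value 1 T powr (svexp t i - svexp r i)"
        using i sv[OF i] that svexp_mono[of r t i] by (intro powr_mono2 singular_value_antimono) auto
      finally show "singular_value i T powr svexp t i \<le> singular_value i T powr svexp r i *
        singular_value 1 T powr (svexp t i - svexp r i)"
        by (simp add: mult_left_mono)
    qed simp
    also have "\<dots> = svf r T * singular_value 1 T powr (\<Sum>i\<in>{1..CARD('d)}. svexp t i - svexp r i)"
      using sv1 r by (simp add: prod.distrib svf_eq_prod[OF T] powr_sum)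
    also have "(\<Sum>i\<in>{1..CARD('d)}. svexp t i - svexp r i) = t - r"
      unfolding sum_subtractf using r that sum_svexp[of t "CARD('d)"] sum_svexp[of r "CARD('d)"] by simp
    finally show ?thesis .
  qed
  show ?thesis
  proof (cases "s \<le> ?d")
    case True then show ?thesis using le r by blast
  next
    case False
    then have "svf s T \<le> svf ?d T * singular_value 1 T powr (s - ?d)"
      by (intro svf_above_dim T) auto
    also have "\<dots> \<le> (svf r T * singular_value 1 T powr (?d - r)) * singular_value 1 T powr (s - ?d)"
      using le[of ?d] r by (intro mult_right_mono) auto
    also have "\<dots> = svf r T * singular_value 1 T powr (s - r)"
      by (simp add: mult.assoc powr_add[symmetric])
    finally show ?thesis .
  qed
qed

text \<open>min 1 x <= x^e for 0 <= e <= 1, applied to each factor with e =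
  \<open>svexp s i\<close>; the exponents add up to s. Up to constants the left side bounds the
  volume of a ball of radius r pulled back by T and cut to a ball of fixed size.\<close>

lemma prod_min_le_svf:
  fixes T :: "real^'d^'d"
  assumes T: "invertible T" and s: "0 \<le> s" "s \<le> real CARD('d)" and r: "0 < r"
  shows "(\<Prod>i\<in>{1..CARD('d)}. min 1 (r / singular_value i T)) \<le> r powr s / svf s T"
proof -
  have sv: "0 < singular_value i T" if "i \<in> {1..CARD('d)}" for i
    using singular_value_pos[OF T that] .
  have min: "min 1 x \<le> x powr e" if "0 < x" "0 \<le> e" "e \<le> 1" for x e :: real
  proof (cases "x \<le> 1")
    case True
    then show ?thesis using that powr_mono'[of e 1 x] by simp
  next
    case False
    then show ?thesis using that by (simp add: ge_one_powr_ge_zero)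
  qed
  have "(\<Prod>i\<in>{1..CARD('d)}. min 1 (r / singular_value i T)) \<le>
    (\<Prod>i\<in>{1..CARD('d)}. r powr svexp s i / singular_value i T powr svexp s i)"
  proof (rule prod_mono, safe)
    fix i assume i: "i \<in> {1..CARD('d)}"
    show "0 \<le> min 1 (r / singular_value i T)" using sv[OF i] r by simp
    show "min 1 (r / singular_value i T) \<le> r powr svexp s i / singular_value i T powr svexp s i"
      using min[of "r / singular_value i T" "svexp s i"] sv[OF i] r svexp_bounds[of s i]
      by (simp add: powr_divide less_imp_le)
  qed
  also have "\<dots> = r powr (\<Sum>i\<in>{1..CARD('d)}. svexp s i) / svf s T"
    using r by (simp add: prod_dividef svf_eq_prod[OF T s] powr_sum)
  also have "(\<Sum>i\<in>{1..CARD('d)}. svexp s i) = s"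
    using s by (subst sum_svexp) auto
  finally show ?thesis .
qed

section \<open>Ellipsoids: volume and coverings\<close>

text \<open>A product grid along the basis b. Only the widths of the pieces in the directions b i
  are recorded: with singular vectors for b they determine the size of the image under T, and the
  widths may differ from direction to direction.\<close>

lemma orthonormal_box_pieces:
  fixes b :: "'d::finite \<Rightarrow> real^'d"
  assumes w: "\<And>i. 0 < w i" and L: "\<And>i. 0 \<le> L i"
  obtains F where "finite F" "real (card F) \<le> (\<Prod>i\<in>UNIV. L i / w i + 1)"
    "{x. \<forall>i. lo i \<le> b i \<bullet> x \<and> b i \<bullet> x \<le> lo i + L i} \<subseteq> \<Union>F"
    "\<And>P x y i. P \<in> F \<Longrightarrow> x \<in> P \<Longrightarrow> y \<in> P \<Longrightarrow> \<bar>b i \<bullet> x - b i \<bullet> y\<bar> \<le> w i"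
proof
  define N where "N = (\<lambda>i. nat \<lfloor>L i / w i\<rfloor> + 1)"
  define piece where "piece = (\<lambda>\<kappa> :: 'd \<Rightarrow> nat. {x. \<forall>i. real (\<kappa> i) \<le> (b i \<bullet> x - lo i) / w i \<and>
    (b i \<bullet> x - lo i) / w i \<le> real (\<kappa> i) + 1})"
  let ?K = "PiE UNIV (\<lambda>i. {..<N i})"
  let ?F = "piece ` ?K"
  have K: "finite ?K" by (intro finite_PiE) auto
  then show "finite ?F" by simp
  have "card ?F \<le> card ?K" using K by (rule card_image_le)
  also have "\<dots> = (\<Prod>i\<in>UNIV. N i)" by (simp add: card_PiE)
  finally have "real (card ?F) \<le> (\<Prod>i\<in>UNIV. real (N i))"
    by (simp flip: of_nat_prod)
  also have "\<dots> \<le> (\<Prod>i\<in>UNIV. L i / w i + 1)"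
    using L w by (intro prod_mono) (auto simp: N_def less_imp_le)
  finally show "real (card ?F) \<le> (\<Prod>i\<in>UNIV. L i / w i + 1)" .
  show "{x. \<forall>i. lo i \<le> b i \<bullet> x \<and> b i \<bullet> x \<le> lo i + L i} \<subseteq> \<Union>?F"
  proof
    fix x assume "x \<in> {x. \<forall>i. lo i \<le> b i \<bullet> x \<and> b i \<bullet> x \<le> lo i + L i}"
    then have x: "lo i \<le> b i \<bullet> x" "b i \<bullet> x \<le> lo i + L i" for i by auto
    define \<kappa> where "\<kappa> = (\<lambda>i. nat \<lfloor>(b i \<bullet> x - lo i) / w i\<rfloor>)"
    have nn: "0 \<le> (b i \<bullet> x - lo i) / w i" for i
      using x[of i] w[of i] by (simp add: less_imp_le)
    have "(b i \<bullet> x - lo i) / w i \<le> L i / w i" for i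
      using x[of i] w[of i] by (intro divide_right_mono) (auto simp: less_imp_le)
    then have "\<kappa> i < N i" for i
      unfolding \<kappa>_def N_def by (metis floor_mono less_add_one nat_mono le_imp_less_Suc Suc_eq_plus1)
    then have "\<kappa> \<in> ?K" by auto
    moreover have "x \<in> piece \<kappa>"
      using nn by (auto simp: piece_def \<kappa>_def)
    ultimately show "x \<in> \<Union>?F" by blast
  qed
  fix P x y i assume "P \<in> ?F" "x \<in> P" "y \<in> P"
  then obtain \<kappa> where "real (\<kappa> i) \<le> (b i \<bullet> x - lo i) / w i" "(b i \<bullet> x - lo i) / w i \<le> real (\<kappa> i) + 1"
    "real (\<kappa> i) \<le> (b i \<bullet> y - lo i) / w i" "(b i \<bullet> y - lo i) / w i \<le> real (\<kappa> i) + 1"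
    by (auto simp: piece_def)
  then have "\<bar>(b i \<bullet> x - lo i) / w i - (b i \<bullet> y - lo i) / w i\<bar> \<le> 1" by linarith
  also have "(b i \<bullet> x - lo i) / w i - (b i \<bullet> y - lo i) / w i = (b i \<bullet> x - b i \<bullet> y) / w i"
    by (simp add: diff_divide_distrib[symmetric])
  finally show "\<bar>b i \<bullet> x - b i \<bullet> y\<bar> \<le> w i"
    using w[of i] by simp
qed

lemma cball_orthonormal_pieces:
  fixes b :: "'d::finite \<Rightarrow> real^'d"
  assumes b: "\<And>i. norm (b i) = 1" and w: "\<And>i. 0 < w i" and R: "0 \<le> R"
  obtains F where "finite F" "real (card F) \<le> (\<Prod>i\<in>UNIV. 2 * R / w i + 1)" "cball 0 R \<subseteq> \<Union>F"
    "\<And>P x y i. P \<in> F \<Longrightarrow> x \<in> P \<Longrightarrow> y \<in> P \<Longrightarrow> \<bar>b i \<bullet> x - b i \<bullet> y\<bar> \<le> w i"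
proof -
  have "- R \<le> b i \<bullet> x \<and> b i \<bullet> x \<le> - R + 2 * R" if "x \<in> cball 0 R" for x i
    using Cauchy_Schwarz_ineq2[of "b i" x] that b[of i] by (simp add: abs_le_iff)
  then have sub: "cball 0 R \<subseteq> {x. \<forall>i. - R \<le> b i \<bullet> x \<and> b i \<bullet> x \<le> - R + 2 * R}" by blast
  obtain F where F: "finite F" "real (card F) \<le> (\<Prod>i\<in>UNIV. 2 * R / w i + 1)"
    "{x. \<forall>i. - R \<le> b i \<bullet> x \<and> b i \<bullet> x \<le> - R + 2 * R} \<subseteq> \<Union>F"
    "\<And>P x y i. P \<in> F \<Longrightarrow> x \<in> P \<Longrightarrow> y \<in> P \<Longrightarrow> \<bar>b i \<bullet> x - b i \<bullet> y\<bar> \<le> w i"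
    by (rule orthonormal_box_pieces[of w "\<lambda>_. 2 * R" "\<lambda>_. - R" b, OF w]) (use R in auto)
  show thesis by (rule that[OF F(1,2) subset_trans[OF sub F(3)] F(4)])
qed

lemma emeasure_cball_le:
  fixes x :: "'a::euclidean_space"
  assumes "0 \<le> r"
  shows "emeasure lborel (cball x r) \<le> ennreal ((2 * r) ^ DIM('a))"
proof -
  have "cball x r \<subseteq> cbox (x - r *\<^sub>R One) (x + r *\<^sub>R One)"
  proof
    fix y assume y: "y \<in> cball x r"
    have "\<bar>(x - y) \<bullet> i\<bar> \<le> r" if "i \<in> Basis" for i
      using Basis_le_norm[OF that, of "x - y"] y by (simp add: dist_norm)
    then show "y \<in> cbox (x - r *\<^sub>R One) (x + r *\<^sub>R One)"
      by (force simp: mem_box inner_simps abs_le_iff algebra_simps)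
  qed
  then have "emeasure lborel (cball x r) \<le> emeasure lborel (cbox (x - r *\<^sub>R One) (x + r *\<^sub>R One))"
    by (intro emeasure_mono) auto
  also have "\<dots> = ennreal ((2 * r) ^ DIM('a))"
    using assms by (subst emeasure_lborel_cbox) (auto simp: inner_simps)
  finally show ?thesis .
qed

text \<open>The box is cut into cubes whose side is its shortest edge, and each of them is put into a ball.
  This is lossy by a constant factor, but avoids the rotation invariance of Lebesgue measure, which the
  library has only for well-ordered index types.\<close>

lemma emeasure_orthonormal_box_le:
  fixes b :: "'d::finite \<Rightarrow> real^'d"
  assumes b: "\<And>i j. b i \<bullet> b j = (if i = j then 1 else 0)" and L: "\<And>i. 0 < L i"
    and A: "A \<subseteq> {x. \<forall>i. lo i \<le> b i \<bullet> x \<and> b i \<bullet> x \<le> lo i + L i}"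
  shows "emeasure lborel A \<le> ennreal ((4 * real CARD('d)) ^ CARD('d) * (\<Prod>i\<in>UNIV. L i))"
proof -
  define w where "w = Min (range L)"
  have w: "0 < w" using L by (simp add: w_def)
  have wL: "w \<le> L i" for i by (simp add: w_def)
  let ?d = "real CARD('d)"
  have d1: "1 \<le> ?d" by (simp add: Suc_leI)
  obtain F where F: "finite F" "real (card F) \<le> (\<Prod>i\<in>UNIV. L i / w + 1)"
    "{x. \<forall>i. lo i \<le> b i \<bullet> x \<and> b i \<bullet> x \<le> lo i + L i} \<subseteq> \<Union>F"
    "\<And>P x y i. P \<in> F \<Longrightarrow> x \<in> P \<Longrightarrow> y \<in> P \<Longrightarrow> \<bar>b i \<bullet> x - b i \<bullet> y\<bar> \<le> w"
    by (rule orthonormal_box_pieces[of "\<lambda>_. w" L lo b, OF w less_imp_le[OF L]]) blast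
  \<comment> \<open>Points of a piece differ by at most w in each of d orthonormal coordinates,
    hence by at most d * w in norm, so any point of the piece serves as centre.\<close>
  define C where "C = (\<lambda>P. cball (SOME x. x \<in> P) (?d * w) :: (real^'d) set)"
  have "P \<subseteq> C P" if P: "P \<in> F" for P
  proof
    fix y assume y: "y \<in> P"
    define x where "x = (SOME x. x \<in> P)"
    have x: "x \<in> P" unfolding x_def using y by (rule someI)
    have "(norm (x - y))\<^sup>2 = (\<Sum>i\<in>UNIV. (b i \<bullet> x - b i \<bullet> y)\<^sup>2)"
      using orthonormal_inner_expansion[OF b, of "x - y" "x - y"]
      by (simp add: dot_square_norm inner_diff_right power2_eq_square)
    also have "\<dots> \<le> (\<Sum>i\<in>(UNIV :: 'd set). w\<^sup>2)"
      using F(4)[OF P x y] w by (intro sum_mono) (simp add: abs_le_square_iff[symmetric])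
    also have "\<dots> = ?d * w\<^sup>2" by simp
    also have "\<dots> \<le> ?d\<^sup>2 * w\<^sup>2"
      using d1 by (intro mult_right_mono self_le_power) auto
    also have "\<dots> = (?d * w)\<^sup>2" by (simp only: power_mult_distrib)
    finally have "norm (x - y) \<le> ?d * w"
      using w by (simp add: power_mono_iff)
    then show "y \<in> C P" by (simp add: C_def x_def dist_norm)
  qed
  then have "\<Union>F \<subseteq> (\<Union>P\<in>F. C P)" by (rule UN_mono[of F F id C, simplified]) simp_all
  then have "A \<subseteq> (\<Union>P\<in>F. C P)" using A F(3) by (meson subset_trans)
  moreover have Cs: "C P \<in> sets lborel" for P by (simp add: C_def)
  ultimately have "emeasure lborel A \<le> emeasure lborel (\<Union>P\<in>F. C P)"
    by (intro emeasure_mono sets.finite_UN[OF F(1) Cs])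
  also have "\<dots> \<le> (\<Sum>P\<in>F. emeasure lborel (C P))"
    by (rule emeasure_subadditive_finite[OF F(1)]) (use Cs in blast)
  also have "\<dots> \<le> (\<Sum>P\<in>F. ennreal ((2 * (?d * w)) ^ CARD('d)))"
    using emeasure_cball_le[where 'a = "real^'d", of "?d * w"] w by (intro sum_mono) (simp add: C_def)
  also have "\<dots> = ennreal (real (card F) * (2 * (?d * w)) ^ CARD('d))"
    using w by (simp add: ennreal_mult ennreal_of_nat_eq_real_of_nat)
  also have "\<dots> \<le> ennreal ((4 * ?d) ^ CARD('d) * (\<Prod>i\<in>UNIV. L i))"
  proof (rule ennreal_leI)
    \<comment> \<open>As w is the shortest edge, rounding up costs at most a factor 2 per direction.
      With the side 2 d w of the cube around each ball this yields the constant (4 d)^d.\<close>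
    have "real (card F) \<le> (\<Prod>i\<in>UNIV. 2 * L i / w)"
    proof (rule order_trans[OF F(2)], rule prod_mono, safe)
      fix i
      show "0 \<le> L i / w + 1" using w wL[of i] by simp
      show "L i / w + 1 \<le> 2 * L i / w" using w wL[of i] by (simp add: field_simps)
    qed
    then have "real (card F) * (2 * (?d * w)) ^ CARD('d) \<le> (\<Prod>i\<in>UNIV. 2 * L i / w) * (2 * (?d * w)) ^ CARD('d)"
      using w by (intro mult_right_mono) auto
    also have "\<dots> = (\<Prod>i\<in>UNIV. (2 * L i / w) * (2 * (?d * w)))"
      by (subst prod.distrib) (simp only: prod_constant)
    also have "\<dots> = (\<Prod>i\<in>UNIV. (4 * ?d) * L i)"
      using w by (intro prod.cong refl) simp
    also have "\<dots> = (4 * ?d) ^ CARD('d) * (\<Prod>i\<in>UNIV. L i)"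
      by (subst prod.distrib) (simp only: prod_constant)
    finally show "real (card F) * (2 * (?d * w)) ^ CARD('d) \<le> (4 * ?d) ^ CARD('d) * (\<Prod>i\<in>UNIV. L i)" .
  qed
  finally show ?thesis .
qed

text \<open>With T y = z the condition says that x + y lies in an ellipsoid with semi-axes r /
  \<alpha>_i. Its intersection with the ball of radius R fits into a box along the singular vectors
  with edges 2 R min 1 (r / \<alpha>_i), and \<open>prod_min_le_svf\<close> bounds the volume. This
  is the transversality estimate behind the energy bound.\<close>

lemma emeasure_matrix_preimage_cball:
  fixes T :: "real^'d^'d"
  assumes T: "invertible T" and s: "0 \<le> s" "s \<le> real CARD('d)" and r: "0 < r" and R: "1 \<le> R"
  shows "emeasure lborel {x. norm x \<le> R \<and> norm (T *v x + z) \<le> r}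
    \<le> ennreal ((8 * R * real CARD('d)) ^ CARD('d) * (r powr s / svf s T))"
proof (rule singular_value_decomposition[of T])
  fix b :: "'d \<Rightarrow> real^'d" and g :: "'d \<Rightarrow> nat"
  assume b: "\<And>i j. b i \<bullet> b j = (if i = j then 1 else 0)"
    and g: "bij_betw g UNIV {1..CARD('d)}"
    and nT: "\<And>x. (norm (T *v x))\<^sup>2 = (\<Sum>i\<in>UNIV. (singular_value (g i) T * (b i \<bullet> x))\<^sup>2)"
  have gm: "g i \<in> {1..CARD('d)}" for i using g by (auto simp: bij_betw_def)
  have sv: "0 < singular_value (g i) T" for i
    using singular_value_pos[OF T gm] .
  obtain y where y: "T *v y = z"
    using T by (metis invertible_right_inverse matrix_vector_mul_assoc matrix_vector_mul_lid)
  define a where "a = (\<lambda>i. r / singular_value (g i) T)"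
  have a: "a i > 0" for i using sv[of i] r by (simp add: a_def)
  \<comment> \<open>The box has in direction i the intersection of [- R, R] with the interval of
    radius a i around - b i \<bullet> y; as 1 <= R, its length is at most 2 R min 1 (a i).\<close>
  define lo where "lo = (\<lambda>i. max (- R) (- a i - b i \<bullet> y))"
  define L where "L = (\<lambda>i. 2 * R * min 1 (a i))"
  have nb: "norm (b i) = 1" for i by (simp add: norm_eq_1 b)
  have sub: "{x. norm x \<le> R \<and> norm (T *v x + z) \<le> r} \<subseteq> {x. \<forall>i. lo i \<le> b i \<bullet> x \<and> b i \<bullet> x \<le> lo i + L i}"
  proof (intro subsetI CollectI allI)
    fix x i assume "x \<in> {x. norm x \<le> R \<and> norm (T *v x + z) \<le> r}"
    then have x: "norm x \<le> R" "norm (T *v x + z) \<le> r" by auto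
    have 1: "\<bar>b i \<bullet> x\<bar> \<le> R"
      using Cauchy_Schwarz_ineq2[of "b i" x] x nb by simp
    have 2: "\<bar>b i \<bullet> x + b i \<bullet> y\<bar> \<le> a i"
    proof -
      have "(singular_value (g i) T * (b i \<bullet> (x + y)))\<^sup>2 \<le> (norm (T *v (x + y)))\<^sup>2"
        unfolding nT by (rule member_le_sum) auto
      also have "\<dots> \<le> r\<^sup>2"
        using x by (intro power_mono) (auto simp: matrix_vector_right_distrib y)
      finally have "\<bar>singular_value (g i) T * (b i \<bullet> (x + y))\<bar> \<le> r"
        using r by (metis abs_le_square_iff abs_of_pos)
      then have "\<bar>b i \<bullet> (x + y)\<bar> * singular_value (g i) T \<le> r"
        using sv[of i] by (simp add: abs_mult mult.commute)
      then have "\<bar>b i \<bullet> (x + y)\<bar> \<le> a i"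
        using sv[of i] unfolding a_def by (subst pos_le_divide_eq)
      then show ?thesis by (simp add: inner_add_right)
    qed
    have "min R (a i - b i \<bullet> y) - lo i \<le> L i"
    proof -
      have "min R (a i - b i \<bullet> y) - lo i \<le> 2 * R" "min R (a i - b i \<bullet> y) - lo i \<le> 2 * a i"
        by (auto simp: lo_def)
      moreover have "2 * a i \<le> 2 * R * a i" using a[of i] R by simp
      ultimately show ?thesis by (simp add: L_def min_def)
    qed
    with 1 2 show "lo i \<le> b i \<bullet> x \<and> b i \<bullet> x \<le> lo i + L i"
      by (auto simp: lo_def)
  qed
  have "emeasure lborel {x. norm x \<le> R \<and> norm (T *v x + z) \<le> r}
      \<le> ennreal ((4 * real CARD('d)) ^ CARD('d) * (\<Prod>i\<in>UNIV. L i))"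
    using R a by (intro emeasure_orthonormal_box_le[OF b _ sub]) (simp add: L_def)
  also have "\<dots> \<le> ennreal ((8 * R * real CARD('d)) ^ CARD('d) * (r powr s / svf s T))"
  proof (rule ennreal_leI)
    have "(\<Prod>i\<in>UNIV. L i) = (2 * R) ^ CARD('d) * (\<Prod>i\<in>UNIV. min 1 (r / singular_value (g i) T))"
      unfolding L_def a_def by (subst prod.distrib) (simp only: prod_constant)
    then have "(4 * real CARD('d)) ^ CARD('d) * (\<Prod>i\<in>UNIV. L i) =
       ((4 * real CARD('d)) * (2 * R)) ^ CARD('d) * (\<Prod>i\<in>UNIV. min 1 (r / singular_value (g i) T))"
      by (simp only: power_mult_distrib mult.assoc)
    also have "(4 * real CARD('d)) * (2 * R) = 8 * R * real CARD('d)" by simp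
    also have "(\<Prod>i\<in>(UNIV :: 'd set). min 1 (r / singular_value (g i) T)) =
        (\<Prod>i\<in>{1..CARD('d)}. min 1 (r / singular_value i T))"
      using g by (rule prod.reindex_bij_betw)
    also have "(8 * R * real CARD('d)) ^ CARD('d) * \<dots> \<le> (8 * R * real CARD('d)) ^ CARD('d) * (r powr s / svf s T)"
      using R by (intro mult_left_mono prod_min_le_svf T s r) auto
    finally show "(4 * real CARD('d)) ^ CARD('d) * (\<Prod>i\<in>UNIV. L i) \<le>
      (8 * R * real CARD('d)) ^ CARD('d) * (r powr s / svf s T)" .
  qed
  finally show ?thesis .
qed

text \<open>Let m be the ceiling of s. About \<alpha>_1 ... \<alpha>_(m-1) / \<alpha>_m^(m-1) pieces
  of diameter about \<alpha>_m cover the ellipsoid, and multiplying by \<alpha>_m^s gives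
  \<open>svf s T\<close>. The cutting is done in the domain, where the pieces are boxes along the
  singular vectors.\<close>

lemma matrix_image_cball_cover:
  fixes T :: "real^'d^'d"
  assumes T: "invertible T" and s: "0 < s" "s \<le> real CARD('d)" and R: "1 \<le> R"
  obtains F where "finite F" "(*v) T ` cball 0 R \<subseteq> \<Union>F"
    "\<And>P. P \<in> F \<Longrightarrow> bounded P \<and> diameter P \<le> 2 * R * real CARD('d) * singular_value (nat \<lceil>s\<rceil>) T"
    "real (card F) * singular_value (nat \<lceil>s\<rceil>) T powr s \<le> (2 * R + 1) ^ CARD('d) * svf s T"
proof (rule singular_value_decomposition[of T])
  fix b :: "'d \<Rightarrow> real^'d" and g :: "'d \<Rightarrow> nat"
  assume b: "\<And>i j. b i \<bullet> b j = (if i = j then 1 else 0)"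
    and g: "bij_betw g UNIV {1..CARD('d)}"
    and nT: "\<And>x. (norm (T *v x))\<^sup>2 = (\<Sum>i\<in>UNIV. (singular_value (g i) T * (b i \<bullet> x))\<^sup>2)"
  have gm: "g i \<in> {1..CARD('d)}" for i using g by (auto simp: bij_betw_def)
  define m where "m = nat \<lceil>s\<rceil>"
  have m: "1 \<le> m" "m \<le> CARD('d)"
    using s unfolding m_def by linarith+
  define \<alpha> where "\<alpha> = (\<lambda>i. singular_value i T)"
  have \<alpha>: "0 < \<alpha> i" if "i \<in> {1..CARD('d)}" for i
    unfolding \<alpha>_def using singular_value_pos[OF T that] .
  have mono: "\<alpha> k \<le> \<alpha> j" if "1 \<le> j" "j \<le> k" "k \<le> CARD('d)" for j k
    unfolding \<alpha>_def using singular_value_antimono that by blast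
  have \<alpha>m: "0 < \<alpha> m" using \<alpha> m by simp
  \<comment> \<open>Directions with index below m are cut so that the image has width \<alpha>_m; in
    the others the ball stays whole, since its image has width at most 2 R \<alpha>_m
    already.\<close>
  define w where "w = (\<lambda>i. if g i < m then \<alpha> m / \<alpha> (g i) else 2 * R)"
  have w: "0 < w i" for i using \<alpha>[OF gm[of i]] \<alpha>m R by (simp add: w_def)
  have \<alpha>w: "\<alpha> (g i) * w i \<le> 2 * R * \<alpha> m" for i
  proof (cases "g i < m")
    case True
    have "1 * \<alpha> m \<le> 2 * R * \<alpha> m" using R \<alpha>m by (intro mult_right_mono) auto
    then show ?thesis using True \<alpha>[OF gm[of i]] by (simp add: w_def)
  next
    case False
    then show ?thesis using mono[of m "g i"] gm[of i] m R by (simp add: w_def)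
  qed
  have nb: "norm (b i) = 1" for i by (simp add: norm_eq_1 b)
  obtain F where F: "finite F" "real (card F) \<le> (\<Prod>i\<in>UNIV. 2 * R / w i + 1)" "cball 0 R \<subseteq> \<Union>F"
    "\<And>P x y i. P \<in> F \<Longrightarrow> x \<in> P \<Longrightarrow> y \<in> P \<Longrightarrow> \<bar>b i \<bullet> x - b i \<bullet> y\<bar> \<le> w i"
    using cball_orthonormal_pieces[of b w R] nb w R by auto
  show thesis
  proof (rule that[of "(`) ((*v) T) ` F"])
    show "finite ((`) ((*v) T) ` F)" using F by simp
    show "(*v) T ` cball 0 R \<subseteq> \<Union> ((`) ((*v) T) ` F)" using F(3) by blast
    fix Q assume "Q \<in> (`) ((*v) T) ` F"
    then obtain P where P: "P \<in> F" and Q: "Q = (*v) T ` P" by blast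
    have "dist x y \<le> 2 * R * real CARD('d) * \<alpha> m" if xy: "x \<in> Q" "y \<in> Q" for x y
    proof -
      obtain x' y' where x': "x' \<in> P" "x = T *v x'" and y': "y' \<in> P" "y = T *v y'"
        using xy Q by blast
      have "(dist x y)\<^sup>2 = (norm (T *v (x' - y')))\<^sup>2"
        by (simp add: x' y' dist_norm matrix_vector_mult_diff_distrib)
      also have "\<dots> \<le> (\<Sum>i\<in>(UNIV :: 'd set). (2 * R * \<alpha> m)\<^sup>2)"
        unfolding nT
      proof (rule sum_mono)
        fix i
        have "\<bar>\<alpha> (g i) * (b i \<bullet> (x' - y'))\<bar> \<le> \<alpha> (g i) * w i"
          using F(4)[OF P x'(1) y'(1), of i] \<alpha>[OF gm[of i]] by (simp add: abs_mult inner_diff_right)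
        also have "\<dots> \<le> 2 * R * \<alpha> m" by (rule \<alpha>w)
        finally show "(singular_value (g i) T * (b i \<bullet> (x' - y')))\<^sup>2 \<le> (2 * R * \<alpha> m)\<^sup>2"
          using R \<alpha>m by (simp add: \<alpha>_def abs_le_square_iff[symmetric])
      qed
      also have "\<dots> = real CARD('d) * (2 * R * \<alpha> m)\<^sup>2" by simp
      also have "\<dots> \<le> (real CARD('d))\<^sup>2 * (2 * R * \<alpha> m)\<^sup>2"
        by (intro mult_right_mono self_le_power) (auto simp: Suc_leI)
      also have "\<dots> = (2 * R * real CARD('d) * \<alpha> m)\<^sup>2" by (simp add: power_mult_distrib)
      finally show ?thesis using R \<alpha>m by (simp add: power_mono_iff)
    qed note d = this
    have "bounded Q"
      unfolding bounded_two_points using d by blast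
    moreover have "diameter Q \<le> 2 * R * real CARD('d) * \<alpha> m"
      using R \<alpha>m d by (intro diameter_le) (auto simp: dist_norm)
    ultimately show "bounded Q \<and> diameter Q \<le> 2 * R * real CARD('d) * singular_value (nat \<lceil>s\<rceil>) T"
      by (simp add: \<alpha>_def m_def)
  next
    have "real (card ((`) ((*v) T) ` F)) \<le> real (card F)" using F(1) by (simp add: card_image_le)
    also have "\<dots> \<le> (\<Prod>i\<in>UNIV. (2 * R + 1) * (if g i < m then \<alpha> (g i) / \<alpha> m else 1))"
    proof (rule order_trans[OF F(2)], rule prod_mono, safe)
      fix i
      show "0 \<le> 2 * R / w i + 1" using R w[of i] by (simp add: less_imp_le add_nonneg_nonneg)
      show "2 * R / w i + 1 \<le> (2 * R + 1) * (if g i < m then \<alpha> (g i) / \<alpha> m else 1)"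
      proof (cases "g i < m")
        case True
        have "1 \<le> \<alpha> (g i) / \<alpha> m" using mono[of "g i" m] True gm[of i] m \<alpha>m by simp
        then show ?thesis
          using True \<alpha>m \<alpha>[OF gm[of i]] by (simp add: w_def distrib_right add_divide_distrib)
      qed (use R in \<open>simp add: w_def\<close>)
    qed
    also have "\<dots> = (2 * R + 1) ^ CARD('d) * (\<Prod>i\<in>{1..CARD('d)}. if i < m then \<alpha> i / \<alpha> m else 1)"
      using prod.reindex_bij_betw[OF g, of "\<lambda>i. if i < m then \<alpha> i / \<alpha> m else 1"]
      by (simp add: prod.distrib)
    also have "(\<Prod>i\<in>{1..CARD('d)}. if i < m then \<alpha> i / \<alpha> m else 1) = (\<Prod>i\<in>{1..<m}. \<alpha> i / \<alpha> m)"
      using m by (intro prod.mono_neutral_cong_right) auto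
    also have "\<dots> = (\<Prod>i\<in>{1..<m}. \<alpha> i) / \<alpha> m ^ (m - 1)"
      by (simp add: prod_dividef)
    finally have "real (card ((`) ((*v) T) ` F)) * \<alpha> m powr s \<le>
       (2 * R + 1) ^ CARD('d) * ((\<Prod>i\<in>{1..<m}. \<alpha> i) / \<alpha> m ^ (m - 1)) * \<alpha> m powr s"
      by (intro mult_right_mono) auto
    also have "\<dots> = (2 * R + 1) ^ CARD('d) * ((\<Prod>i\<in>{1..<m}. \<alpha> i) * \<alpha> m powr (s - real m + 1))"
    proof -
      have "\<alpha> m powr s = \<alpha> m ^ (m - 1) * \<alpha> m powr (s - real m + 1)"
        using m \<alpha>m by (simp add: powr_realpow[symmetric] powr_add[symmetric] of_nat_diff)
      then show ?thesis using \<alpha>m by simp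
    qed
    also have "(\<Prod>i\<in>{1..<m}. \<alpha> i) * \<alpha> m powr (s - real m + 1) = svf s T"
      using s by (simp add: svf_def Let_def m_def \<alpha>_def)
    finally show "real (card ((`) ((*v) T) ` F)) * singular_value (nat \<lceil>s\<rceil>) T powr s
        \<le> (2 * R + 1) ^ CARD('d) * svf s T"
      by (simp add: \<alpha>_def m_def powr_add)
  qed
qed

section \<open>Words, cells and the symbolic mass distribution\<close>

lemma words_of_length_0 [simp]: "words_of_length n 0 = {[]}"
  by (auto simp: words_of_length_def)

lemma length_words_of_length: "u \<in> words_of_length n k \<Longrightarrow> length u = k"
  by (simp add: words_of_length_def)

lemma snoc_in_words_of_length_iff:
  "u @ [i] \<in> words_of_length n (Suc k) \<longleftrightarrow> u \<in> words_of_length n k \<and> i \<in> {1..n (Suc k)}"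
  by (auto simp: words_of_length_def nth_append less_Suc_eq)

lemma take_in_words_of_length: "u \<in> words_of_length n k \<Longrightarrow> j \<le> k \<Longrightarrow> take j u \<in> words_of_length n j"
  by (auto simp: words_of_length_def)

lemma finite_words_of_length [simp]: "finite (words_of_length n k)"
proof (induction k)
  case (Suc k)
  have "words_of_length n (Suc k) \<subseteq> (\<lambda>(u, i). u @ [i]) ` (words_of_length n k \<times> {1..n (Suc k)})"
  proof
    fix u assume u: "u \<in> words_of_length n (Suc k)"
    then have "u \<noteq> []" by (auto simp: words_of_length_def)
    then obtain v i where "u = v @ [i]" by (metis rev_exhaust)
    then show "u \<in> (\<lambda>(u, i). u @ [i]) ` (words_of_length n k \<times> {1..n (Suc k)})"
      using u by (auto simp: snoc_in_words_of_length_iff)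
  qed
  then show ?case by (rule finite_subset) (use Suc in auto)
qed simp

lemma words_of_length_in_words: "u \<in> words_of_length n k \<Longrightarrow> u \<in> words n"
  by (auto simp: words_def)

lemma countable_words: "countable (words n)"
  unfolding words_def by (intro countable_UN) (auto intro: countable_finite)

lemma prefix_in_words_of_length: "x \<in> infinite_words n \<Longrightarrow> map x [0..<k] \<in> words_of_length n k"
  by (auto simp: words_of_length_def infinite_words_def)

lemma infinite_words_nonempty:
  assumes "\<And>k. 1 \<le> k \<Longrightarrow> 1 \<le> n k"
  shows "infinite_words n \<noteq> {}"
proof -
  have "(\<lambda>_. 1) \<in> infinite_words n" using assms by (auto simp: infinite_words_def)
  then show ?thesis by blast
qed

lemma word_matrix_Nil [simp]: "word_matrix T [] = mat 1"
  by (simp add: word_matrix_def)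

lemma word_matrix_snoc: "word_matrix T (u @ [i]) = word_matrix T u ** T (Suc (length u)) i"
proof -
  have *: "foldr (**) As B = foldr (**) As (mat 1) ** B" for As and B :: "real^'d^'d"
    by (induction As) (simp_all add: matrix_mul_assoc matrix_mul_lid)
  have "word_matrix T (u @ [i]) =
      foldr (**) (map (\<lambda>j. T (Suc j) ((u @ [i]) ! j)) [0..<length u]) (T (Suc (length u)) i)"
    by (simp add: word_matrix_def matrix_mul_rid)
  also have "map (\<lambda>j. T (Suc j) ((u @ [i]) ! j)) [0..<length u] = map (\<lambda>j. T (Suc j) (u ! j)) [0..<length u]"
    by (simp add: nth_append)
  finally show ?thesis
    by (simp add: word_matrix_def *[of _ "T _ _"])
qed

lemma invertible_word_matrix:
  assumes "\<And>k i. 1 \<le> k \<Longrightarrow> i \<in> {1..n k} \<Longrightarrow> invertible (T k i)"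
  shows "u \<in> words_of_length n k \<Longrightarrow> invertible (word_matrix T u)"
proof (induction u arbitrary: k rule: rev_induct)
  case Nil
  then show ?case by (auto simp: invertible_def intro!: exI[of _ "mat 1"] matrix_mul_lid)
next
  case (snoc i u)
  then obtain l where k: "k = Suc l" by (cases k) (auto simp: words_of_length_def)
  with snoc have "u \<in> words_of_length n l" "i \<in> {1..n (Suc l)}"
    by (auto simp: snoc_in_words_of_length_iff)
  with snoc.IH assms show ?case
    by (simp add: word_matrix_snoc invertible_mult length_words_of_length)
qed

lemma norm_word_matrix_le:
  assumes "\<And>k i. 1 \<le> k \<Longrightarrow> i \<in> {1..n k} \<Longrightarrow> singular_value 1 (T k i) \<le> a" and a: "0 \<le> a"
  shows "u \<in> words_of_length n k \<Longrightarrow> norm (word_matrix T u *v x) \<le> a ^ k * norm x"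
proof (induction u arbitrary: k x rule: rev_induct)
  case Nil
  then show ?case by (auto dest: length_words_of_length)
next
  case (snoc i u)
  then obtain l where k: "k = Suc l" by (cases k) (auto simp: words_of_length_def)
  with snoc have u: "u \<in> words_of_length n l" "i \<in> {1..n (Suc l)}"
    by (auto simp: snoc_in_words_of_length_iff)
  have "norm (word_matrix T (u @ [i]) *v x) = norm (word_matrix T u *v (T (Suc l) i *v x))"
    using u by (simp add: word_matrix_snoc matrix_vector_mul_assoc length_words_of_length)
  also have "\<dots> \<le> a ^ l * norm (T (Suc l) i *v x)"
    using snoc.IH u by blast
  also have "\<dots> \<le> a ^ l * (a * norm x)"
  proof (rule mult_left_mono)
    have "norm (T (Suc l) i *v x) \<le> singular_value 1 (T (Suc l) i) * norm x"
      by (rule norm_matrix_le_singular_value)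
    also have "\<dots> \<le> a * norm x"
      using assms(1)[of "Suc l" i] u by (intro mult_right_mono) auto
    finally show "norm (T (Suc l) i *v x) \<le> a * norm x" .
  qed (use a in simp)
  finally show ?case by (simp add: k mult_ac)
qed

lemma singular_value_word_matrix_le:
  fixes T :: "nat \<Rightarrow> nat \<Rightarrow> real^'d^'d"
  assumes "\<And>k i. 1 \<le> k \<Longrightarrow> i \<in> {1..n k} \<Longrightarrow> singular_value 1 (T k i) \<le> a" and a: "0 \<le> a"
    and u: "u \<in> words_of_length n k" and i: "i \<in> {1..CARD('d)}"
  shows "singular_value i (word_matrix T u) \<le> a ^ k"
proof -
  obtain x where "norm x = 1" "norm (word_matrix T u *v x) = singular_value i (word_matrix T u)"
    using singular_value_norm_eq[OF i] by blast
  with norm_word_matrix_le[of n T a, OF assms(1) a u, of x] show ?thesis by simp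
qed

lemma standing_assumptionD:
  fixes T :: "nat \<Rightarrow> nat \<Rightarrow> real^'d^'d"
  assumes "standing_assumption n T"
  shows "1 \<le> k \<Longrightarrow> i \<in> {1..n k} \<Longrightarrow> invertible (T k i)"
    and "\<exists>a. 0 < a \<and> a < 1 \<and> (\<forall>k i. 1 \<le> k \<longrightarrow> i \<in> {1..n k} \<longrightarrow> singular_value 1 (T k i) \<le> a)"
proof -
  show "1 \<le> k \<Longrightarrow> i \<in> {1..n k} \<Longrightarrow> invertible (T k i)"
    using assms by (auto simp: standing_assumption_def)
  have "0 < alpha_plus n T" "alpha_plus n T < 1"
    using assms by (auto simp: standing_assumption_def)
  then obtain a where a: "alpha_plus n T = ereal a" "0 < a" "a < 1"
    by (cases "alpha_plus n T") auto
  have "singular_value 1 (T k i) \<le> a" if "1 \<le> k" "i \<in> {1..n k}" for k i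
  proof -
    have "ereal (singular_value 1 (T k i)) \<le> alpha_plus n T"
      unfolding alpha_plus_def using that by (intro SUP_upper2[of "(k, i)"]) auto
    then show ?thesis using a by simp
  qed
  with a show "\<exists>a. 0 < a \<and> a < 1 \<and> (\<forall>k i. 1 \<le> k \<longrightarrow> i \<in> {1..n k} \<longrightarrow> singular_value 1 (T k i) \<le> a)"
    by blast
qed

text \<open>The image of x under the composed maps of u: a partial sum of the projection of infinite
  words, closed by a base point. With x fixed it is a finite-level substitute for that projection,
  and it depends on \<omega> only through the nonempty prefixes of u.\<close>

definition proj ::
  "(nat \<Rightarrow> nat \<Rightarrow> real^'d^'d) \<Rightarrow> real^'d \<Rightarrow> (nat list \<Rightarrow> real^'d) \<Rightarrow> nat list \<Rightarrow> real^'d" where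
  "proj T x \<omega> u =
     (\<Sum>j<length u. word_matrix T (take j u) *v \<omega> (take (Suc j) u)) + word_matrix T u *v x"

lemma basic_set_eq: "basic_set T J \<omega> u = (\<lambda>x. proj T x \<omega> u) ` J"
proof -
  have *: "foldr (\<circ>) fs g = foldr (\<circ>) fs id \<circ> g" for fs and g :: "real^'d \<Rightarrow> real^'d"
    by (induction fs) auto
  have "foldr (\<circ>) (map (Psi T \<omega> u) [1..<Suc k]) id x =
    (\<Sum>j<k. word_matrix T (take j u) *v \<omega> (take (Suc j) u)) + word_matrix T (take k u) *v x"
    if "k \<le> length u" for k x
    using that
  proof (induction k arbitrary: x)
    case (Suc k)
    have "foldr (\<circ>) (map (Psi T \<omega> u) [1..<Suc (Suc k)]) id x =
      foldr (\<circ>) (map (Psi T \<omega> u) [1..<Suc k]) id (Psi T \<omega> u (Suc k) x)"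
      using *[of "map (Psi T \<omega> u) [1..<Suc k]" "Psi T \<omega> u (Suc k)"] by simp
    also have "\<dots> = (\<Sum>j<k. word_matrix T (take j u) *v \<omega> (take (Suc j) u)) +
      word_matrix T (take k u) *v (Psi T \<omega> u (Suc k) x)"
      using Suc by (intro Suc.IH) simp
    also have "word_matrix T (take k u) *v (Psi T \<omega> u (Suc k) x) =
      word_matrix T (take k u) *v \<omega> (take (Suc k) u) + word_matrix T (take (Suc k) u) *v x"
    proof -
      have "word_matrix T (take (Suc k) u) = word_matrix T (take k u) ** T (Suc k) (u ! k)"
        using Suc.prems word_matrix_snoc[of T "take k u" "u ! k"] by (simp add: take_Suc_conv_app_nth)
      then show ?thesis
        by (simp add: Psi_def matrix_vector_right_distrib matrix_vector_mul_assoc)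
    qed
    finally show ?case by (simp add: add.assoc)
  qed simp
  from this[of "length u"] show ?thesis
    by (simp add: basic_set_def proj_def)
qed

lemma proj_diff: "proj T x \<omega> u - proj T y \<omega> u = word_matrix T u *v (x - y)"
  by (simp add: proj_def matrix_vector_mult_diff_distrib)

text \<open>The terms of \<open>proj\<close> carry prefixes of pairwise different lengths. So the
  translation at y occurs once among those of u, multiplied by the matrix of the common prefix, and
  not at all among those of v, whose prefix of the same length differs. The difference is affine in
  this single translation.\<close>

lemma proj_diff_fun_upd:
  assumes uv: "length u = k" "length v = k" "m < k"
    and eq: "take m u = take m v" and neq: "take (Suc m) u \<noteq> take (Suc m) v"
  defines "y \<equiv> take (Suc m) u"
  shows "proj T x (fun_upd \<omega> y t) u - proj T x (fun_upd \<omega> y t) v =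
    word_matrix T (take m u) *v t + (proj T x (fun_upd \<omega> y 0) u - proj T x (fun_upd \<omega> y 0) v)"
proof -
  let ?s = "\<lambda>t j. word_matrix T (take j u) *v (fun_upd \<omega> y t) (take (Suc j) u)"
  have "proj T x (fun_upd \<omega> y t) v = proj T x (fun_upd \<omega> y 0) v"
  proof -
    have "take (Suc j) v \<noteq> y" if "j < k" for j
    proof
      assume *: "take (Suc j) v = y"
      then have "length (take (Suc j) v) = length y" by simp
      then have "j = m" using that uv by (simp add: y_def)
      then show False using * neq by (simp add: y_def)
    qed
    then show ?thesis using uv by (simp add: proj_def)
  qed
  moreover have "proj T x (fun_upd \<omega> y t) u = word_matrix T (take m u) *v t + proj T x (fun_upd \<omega> y 0) u"
  proof -
    have "?s t j = (if j = m then word_matrix T (take m u) *v t else 0) + ?s 0 j" if "j < k" for j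
    proof (cases "j = m")
      case False
      then have "length (take (Suc j) u) \<noteq> length y" using that uv by (simp add: y_def)
      then have "take (Suc j) u \<noteq> y" by blast
      then show ?thesis using False by simp
    qed (simp add: y_def)
    then have "(\<Sum>j<k. ?s t j) = (\<Sum>j<k. (if j = m then word_matrix T (take m u) *v t else 0) + ?s 0 j)"
      by (intro sum.cong) auto
    also have "\<dots> = word_matrix T (take m u) *v t + (\<Sum>j<k. ?s 0 j)"
      using uv by (simp add: sum.distrib)
    finally show ?thesis using uv by (simp add: proj_def)
  qed
  ultimately show ?thesis by simp
qed

section \<open>Masses on the leaves of the finite word tree, and flows with given node
  capacities\<close>

definition extensions :: "(nat \<Rightarrow> nat) \<Rightarrow> nat \<Rightarrow> nat list \<Rightarrow> nat list set" where
  "extensions n k x = {u \<in> words_of_length n k. take (length x) u = x}"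

lemma finite_extensions [simp]: "finite (extensions n k x)"
  by (simp add: extensions_def)

lemma extensions_self: "x \<in> words_of_length n k \<Longrightarrow> extensions n k x = {x}"
  by (auto simp: extensions_def words_of_length_def)

lemma extensions_Nil: "extensions n k [] = words_of_length n k"
  by (simp add: extensions_def)

lemma sum_extensions_words:
  fixes w :: "nat list \<Rightarrow> real"
  assumes "m \<le> k"
  shows "(\<Sum>x\<in>words_of_length n m. \<Sum>u\<in>extensions n k x. w u) = (\<Sum>u\<in>words_of_length n k. w u)"
proof -
  have "extensions n k x = {u \<in> words_of_length n k. take m u = x}" if "x \<in> words_of_length n m" for x
    using that by (auto simp: extensions_def length_words_of_length)
  moreover have "take m ` words_of_length n k \<subseteq> words_of_length n m"
    using assms by (auto intro: take_in_words_of_length)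
  ultimately show ?thesis
    using sum.group[of "words_of_length n k" "words_of_length n m" "take m" w] by simp
qed

lemma sum_UNION_le:
  fixes f :: "'a \<Rightarrow> real"
  assumes "finite I" "\<And>i. i \<in> I \<Longrightarrow> finite (A i)" "\<And>i x. i \<in> I \<Longrightarrow> x \<in> A i \<Longrightarrow> 0 \<le> f x"
  shows "(\<Sum>x\<in>(\<Union>i\<in>I. A i). f x) \<le> (\<Sum>i\<in>I. \<Sum>x\<in>A i. f x)"
  using assms
proof (induction I rule: finite_induct)
  case (insert i I)
  have "(\<Sum>x\<in>(\<Union>i\<in>insert i I. A i). f x) \<le> (\<Sum>x\<in>A i. f x) + (\<Sum>x\<in>(\<Union>i\<in>I. A i). f x)"
    using insert.hyps insert.prems by (subst sum_Un[of "A i" "\<Union>i\<in>I. A i", simplified UN_insert[symmetric]])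
      (auto intro!: sum_nonneg)
  then show ?case using insert by fastforce
qed simp

lemma cylinder_snoc:
  assumes x: "x \<in> words_of_length n m"
  shows "cylinder n x \<subseteq> (\<Union>i\<in>{1..n (Suc m)}. cylinder n (x @ [i]))"
proof
  fix z assume z: "z \<in> cylinder n x"
  have "length x = m" using x by (rule length_words_of_length)
  with z have "z \<in> cylinder n (x @ [z m])" "z m \<in> {1..n (Suc m)}"
    by (auto simp: cylinder_def infinite_words_def)
  then show "z \<in> (\<Union>i\<in>{1..n (Suc m)}. cylinder n (x @ [i]))" by blast
qed

text \<open>Max-flow min-cut for a finite tree with node capacities \<open>\<phi>\<close>: the flow is built from the leaves
  upwards and scaled down whenever it exceeds the capacity of a node, which then replaces the cut below it.\<close>

lemma tree_flow:
  fixes \<phi> :: "nat list \<Rightarrow> real"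
  assumes \<phi>: "\<And>u. u \<in> words n \<Longrightarrow> 0 \<le> \<phi> u" and "m \<le> k"
  shows "x \<in> words_of_length n m \<Longrightarrow> \<exists>w A. (\<forall>u. 0 \<le> w u) \<and>
    (\<forall>j. m \<le> j \<longrightarrow> j \<le> k \<longrightarrow> (\<forall>y\<in>words_of_length n j. take m y = x \<longrightarrow> (\<Sum>u\<in>extensions n k y. w u) \<le> \<phi> y)) \<and>
    finite A \<and> A \<subseteq> words n \<and> cylinder n x \<subseteq> (\<Union>v\<in>A. cylinder n v) \<and>
    (\<Sum>v\<in>A. \<phi> v) \<le> (\<Sum>u\<in>extensions n k x. w u)"
  using \<open>m \<le> k\<close>
proof (induction m arbitrary: x rule: inc_induct)
  case base
  have "0 \<le> \<phi> x" using base \<phi> words_of_length_in_words by blast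
  moreover have "(\<Sum>u\<in>extensions n k y. \<phi> x) \<le> \<phi> y"
    if "k \<le> j" "j \<le> k" "y \<in> words_of_length n j" "take k y = x" for j y
  proof -
    have "y = x" "j = k" using that by (auto simp: words_of_length_def)
    then show ?thesis using that by (simp add: extensions_self)
  qed
  ultimately show ?case
    using base words_of_length_in_words[OF base]
    by (intro exI[of _ "\<lambda>_. \<phi> x"] exI[of _ "{x}"]) (auto simp: extensions_self)
next
  case (step m)
  let ?I = "{1..n (Suc m)}"
  have lx: "length x = m" using step.prems by (rule length_words_of_length)
  have "\<forall>i\<in>?I. \<exists>w A. (\<forall>u. 0 \<le> w u) \<and>
    (\<forall>j. Suc m \<le> j \<longrightarrow> j \<le> k \<longrightarrow> (\<forall>y\<in>words_of_length n j. take (Suc m) y = x @ [i] \<longrightarrow> (\<Sum>u\<in>extensions n k y. w u) \<le> \<phi> y)) \<and>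
    finite A \<and> A \<subseteq> words n \<and> cylinder n (x @ [i]) \<subseteq> (\<Union>v\<in>A. cylinder n v) \<and>
    (\<Sum>v\<in>A. \<phi> v) \<le> (\<Sum>u\<in>extensions n k (x @ [i]). w u)"
    using step.prems by (intro ballI step.IH) (simp add: snoc_in_words_of_length_iff)
  from bchoice[OF this] obtain w where "\<forall>i\<in>?I. \<exists>A. (\<forall>u. 0 \<le> w i u) \<and>
    (\<forall>j. Suc m \<le> j \<longrightarrow> j \<le> k \<longrightarrow> (\<forall>y\<in>words_of_length n j. take (Suc m) y = x @ [i] \<longrightarrow> (\<Sum>u\<in>extensions n k y. w i u) \<le> \<phi> y)) \<and>
    finite A \<and> A \<subseteq> words n \<and> cylinder n (x @ [i]) \<subseteq> (\<Union>v\<in>A. cylinder n v) \<and>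
    (\<Sum>v\<in>A. \<phi> v) \<le> (\<Sum>u\<in>extensions n k (x @ [i]). w i u)" ..
  from bchoice[OF this] obtain A where H: "\<forall>i\<in>?I. (\<forall>u. 0 \<le> w i u) \<and>
    (\<forall>j. Suc m \<le> j \<longrightarrow> j \<le> k \<longrightarrow> (\<forall>y\<in>words_of_length n j. take (Suc m) y = x @ [i] \<longrightarrow> (\<Sum>u\<in>extensions n k y. w i u) \<le> \<phi> y)) \<and>
    finite (A i) \<and> A i \<subseteq> words n \<and> cylinder n (x @ [i]) \<subseteq> (\<Union>v\<in>A i. cylinder n v) \<and>
    (\<Sum>v\<in>A i. \<phi> v) \<le> (\<Sum>u\<in>extensions n k (x @ [i]). w i u)" ..
  \<comment> \<open>Glues the flows of the subtrees: the letter with index m tells to which child of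
    x a leaf belongs.\<close>
  define w0 where "w0 = (\<lambda>u. if u ! m \<in> ?I then w (u ! m) u else 0)"
  have w0_nn: "0 \<le> w0 u" for u using H by (simp add: w0_def)
  have w0_le: "(\<Sum>u\<in>extensions n k y. w0 u) \<le> \<phi> y"
    and w0_eq: "(\<Sum>u\<in>extensions n k y. w0 u) = (\<Sum>u\<in>extensions n k y. w (y ! m) u)"
    if y: "Suc m \<le> j" "j \<le> k" "y \<in> words_of_length n j" "take m y = x" for j y
  proof -
    have i: "y ! m \<in> ?I" using y by (simp add: words_of_length_def)
    have ly: "length y = j" using y(3) by (rule length_words_of_length)
    have ty: "take (Suc m) y = x @ [y ! m]" using y ly by (simp add: take_Suc_conv_app_nth)
    have "u ! m = y ! m" if "u \<in> extensions n k y" for u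
    proof -
      have "take j u = y" using that ly by (simp add: extensions_def)
      then show ?thesis using y(1) by (metis nth_take Suc_le_lessD)
    qed
    then show eq: "(\<Sum>u\<in>extensions n k y. w0 u) = (\<Sum>u\<in>extensions n k y. w (y ! m) u)"
      using i by (intro sum.cong) (auto simp: w0_def)
    show "(\<Sum>u\<in>extensions n k y. w0 u) \<le> \<phi> y"
      unfolding eq using H i y ty by blast
  qed
  define S where "S = (\<Sum>u\<in>extensions n k x. w0 u)"
  have S_eq: "S = (\<Sum>i\<in>?I. \<Sum>u\<in>extensions n k (x @ [i]). w i u)"
  proof -
    have "(\<lambda>u. u ! m) ` extensions n k x \<subseteq> ?I"
      using step.hyps by (auto simp: extensions_def words_of_length_def)
    then have "S = (\<Sum>i\<in>?I. \<Sum>u\<in>{u \<in> extensions n k x. u ! m = i}. w0 u)"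
      unfolding S_def by (intro sum.group[symmetric]) auto
    also have "\<dots> = (\<Sum>i\<in>?I. \<Sum>u\<in>extensions n k (x @ [i]). w i u)"
    proof (rule sum.cong)
      fix i assume i: "i \<in> ?I"
      have "{u \<in> extensions n k x. u ! m = i} = extensions n k (x @ [i])"
        using step.hyps lx by (auto simp: extensions_def take_Suc_conv_app_nth length_words_of_length)
      then show "(\<Sum>u\<in>{u \<in> extensions n k x. u ! m = i}. w0 u) = (\<Sum>u\<in>extensions n k (x @ [i]). w i u)"
        using w0_eq[of "Suc m" "x @ [i]"] i step.hyps step.prems lx
        by (simp add: snoc_in_words_of_length_iff nth_append)
    qed simp
    finally show ?thesis .
  qed
  have S0: "0 \<le> S" unfolding S_def using w0_nn by (simp add: sum_nonneg)
  have y_eq: "y = x" if "j = m" "y \<in> words_of_length n j" "take m y = x" for j y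
    using that by (simp add: words_of_length_def)
  show ?case
  proof (cases "S \<le> \<phi> x")
    case True
    show ?thesis
    proof (intro exI[of _ w0] exI[of _ "\<Union>i\<in>?I. A i"] conjI allI impI ballI)
      fix j y assume y: "m \<le> j" "j \<le> k" "y \<in> words_of_length n j" "take m y = x"
      show "(\<Sum>u\<in>extensions n k y. w0 u) \<le> \<phi> y"
      proof (cases "j = m")
        case True
        then show ?thesis using \<open>S \<le> \<phi> x\<close> y_eq[of j y] y by (simp add: S_def)
      next
        case False
        then show ?thesis using w0_le[of j y] y by simp
      qed
    next
      show "finite (\<Union>i\<in>?I. A i)" using H by simp
      show "(\<Union>i\<in>?I. A i) \<subseteq> words n" using H by blast
      show "cylinder n x \<subseteq> (\<Union>v\<in>\<Union>i\<in>?I. A i. cylinder n v)"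
      proof
        fix z assume "z \<in> cylinder n x"
        then obtain i where i: "i \<in> ?I" "z \<in> cylinder n (x @ [i])"
          using cylinder_snoc[OF step.prems] by blast
        then have "z \<in> (\<Union>v\<in>A i. cylinder n v)" using H by blast
        then show "z \<in> (\<Union>v\<in>\<Union>i\<in>?I. A i. cylinder n v)" using i(1) by blast
      qed
      have "(\<Sum>v\<in>(\<Union>i\<in>?I. A i). \<phi> v) \<le> (\<Sum>i\<in>?I. \<Sum>v\<in>A i. \<phi> v)"
        using H \<phi> by (intro sum_UNION_le) (auto simp: subset_iff)
      also have "\<dots> \<le> S" unfolding S_eq using H by (intro sum_mono) blast
      finally show "(\<Sum>v\<in>(\<Union>i\<in>?I. A i). \<phi> v) \<le> (\<Sum>u\<in>extensions n k x. w0 u)" by (simp add: S_def)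
    qed (rule w0_nn)
  next
    case False
    have px: "0 \<le> \<phi> x" using step.prems \<phi> words_of_length_in_words by blast
    \<comment> \<open>Here S > \<open>\<phi> x\<close> >= 0, so the quotient is proper. After
      scaling, x carries exactly its capacity, and {x} is a cut of the same value as the
      flow.\<close>
    define c where "c = \<phi> x / S"
    have c: "0 \<le> c" "c \<le> 1" "c * S = \<phi> x" using False px by (auto simp: c_def)
    show ?thesis
    proof (intro exI[of _ "\<lambda>u. c * w0 u"] exI[of _ "{x}"] conjI allI impI ballI)
      fix j y assume y: "m \<le> j" "j \<le> k" "y \<in> words_of_length n j" "take m y = x"
      show "(\<Sum>u\<in>extensions n k y. c * w0 u) \<le> \<phi> y"
      proof (cases "j = m")
        case True
        then show ?thesis using c y_eq[of j y] y by (simp add: S_def sum_distrib_left[symmetric])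
      next
        case False
        have "(\<Sum>u\<in>extensions n k y. c * w0 u) \<le> (\<Sum>u\<in>extensions n k y. w0 u)"
          using c w0_nn by (intro sum_mono) (simp add: mult_left_le_one_le)
        also have "\<dots> \<le> \<phi> y" using False w0_le[of j y] y by simp
        finally show ?thesis .
      qed
    next
      show "{x} \<subseteq> words n" using step.prems words_of_length_in_words by blast
      show "(\<Sum>v\<in>{x}. \<phi> v) \<le> (\<Sum>u\<in>extensions n k x. c * w0 u)"
        using c by (simp add: S_def sum_distrib_left[symmetric])
    qed (use c w0_nn in auto)
  qed
qed

text \<open>The cut belonging to the flow is a symbolic cover of all infinite words, and its cost
  bounds the flow from below. Either it uses only words of length at least k0, and costs at least
  the premeasure at k0, or it contains one of the finitely many shorter words, whose
  \<open>svf\<close> is positive. This makes c independent of k.\<close>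

lemma frostman_flow:
  fixes T :: "nat \<Rightarrow> nat \<Rightarrow> real^'d^'d"
  assumes inv: "\<And>k i. 1 \<le> k \<Longrightarrow> i \<in> {1..n k} \<Longrightarrow> invertible (T k i)"
    and s: "0 \<le> s" and pos: "net_measure n T s (infinite_words n) \<noteq> 0"
  obtains c where "0 < c" "\<And>k. \<exists>w. (\<forall>u. 0 \<le> w u) \<and>
    (\<forall>j\<le>k. \<forall>y\<in>words_of_length n j. (\<Sum>u\<in>extensions n k y. w u) \<le> svf s (word_matrix T y)) \<and>
    c \<le> (\<Sum>u\<in>words_of_length n k. w u)"
proof -
  define \<phi> where "\<phi> = (\<lambda>u. svf s (word_matrix T u))"
  have \<phi>: "0 < \<phi> u" if "u \<in> words n" for u
    using that invertible_word_matrix[of n T, OF inv] svf_pos[OF _ s] by (auto simp: \<phi>_def words_def)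
  have "\<exists>k. net_premeasure n T s k (infinite_words n) \<noteq> 0"
  proof (rule ccontr)
    assume "\<nexists>k. net_premeasure n T s k (infinite_words n) \<noteq> 0"
    then have "net_measure n T s (infinite_words n) = lim (\<lambda>k. 0)"
      by (simp add: net_measure_def)
    then show False using pos by (simp add: limI)
  qed
  then obtain k0 where k0: "net_premeasure n T s k0 (infinite_words n) \<noteq> 0" ..
  \<comment> \<open>The premeasure may be infinite, hence the minimum with 1.\<close>
  define M where "M = enn2real (min 1 (net_premeasure n T s k0 (infinite_words n)))"
  have M: "0 < M" "ennreal M \<le> net_premeasure n T s k0 (infinite_words n)"
    using k0 by (auto simp: M_def enn2real_positive_iff min_less_iff_disj zero_less_iff_neq_zero ennreal_enn2real_if)
  define Sh where "Sh = (\<Union>j\<le>k0. words_of_length n j)"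
  have Sh: "finite Sh" "[] \<in> Sh" "Sh \<subseteq> words n"
    by (auto simp: Sh_def words_def intro!: bexI[of _ 0])
  define c where "c = min M (Min (\<phi> ` Sh))"
  have "0 < Min (\<phi> ` Sh)" using Sh \<phi> by (subst Min_gr_iff) auto
  then have c: "0 < c" using M by (simp add: c_def)
  show thesis
  proof (rule that[OF c])
    fix k
    have "\<exists>w A. (\<forall>u. 0 \<le> w u) \<and>
      (\<forall>j. 0 \<le> j \<longrightarrow> j \<le> k \<longrightarrow> (\<forall>y\<in>words_of_length n j. take 0 y = [] \<longrightarrow> (\<Sum>u\<in>extensions n k y. w u) \<le> \<phi> y)) \<and>
      finite A \<and> A \<subseteq> words n \<and> cylinder n [] \<subseteq> (\<Union>v\<in>A. cylinder n v) \<and>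
      (\<Sum>v\<in>A. \<phi> v) \<le> (\<Sum>u\<in>extensions n k []. w u)"
      by (rule tree_flow) (auto simp: less_imp_le \<phi>)
    then obtain w A where w: "\<forall>u. 0 \<le> w u"
      "\<forall>j\<le>k. \<forall>y\<in>words_of_length n j. (\<Sum>u\<in>extensions n k y. w u) \<le> \<phi> y"
      and A: "finite A" "A \<subseteq> words n" "cylinder n [] \<subseteq> (\<Union>v\<in>A. cylinder n v)"
      "(\<Sum>v\<in>A. \<phi> v) \<le> (\<Sum>u\<in>words_of_length n k. w u)"
      by (auto simp: extensions_Nil)
    have "c \<le> (\<Sum>v\<in>A. \<phi> v)"
    proof (cases "\<exists>v\<in>A. length v < k0")
      case True
      then obtain v where v: "v \<in> A" "length v < k0" by blast
      then have "v \<in> Sh" using A(2) by (force simp: Sh_def words_def dest: length_words_of_length)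
      then have "c \<le> \<phi> v" using Sh by (auto simp: c_def min_le_iff_disj)
      also have "\<dots> \<le> (\<Sum>v\<in>A. \<phi> v)"
        using A(1,2) v \<phi> by (intro member_le_sum) (auto simp: less_imp_le subset_iff)
      finally show ?thesis .
    next
      case False
      have cyl: "cylinder n [] = infinite_words n" by (auto simp: cylinder_def)
      have "ennreal M \<le> net_premeasure n T s k0 (infinite_words n)" by (rule M)
      also have "\<dots> \<le> (\<Sum>\<^sub>\<infinity>u\<in>A. ennreal (\<phi> u))"
        unfolding net_premeasure_def \<phi>_def
        using False A cyl by (intro INF_lower) (auto simp: not_less subset_iff)
      also have "\<dots> = ennreal (\<Sum>v\<in>A. \<phi> v)"
        using A(1,2) \<phi> by (simp add: sum_ennreal less_imp_le subset_iff)
      finally have "M \<le> (\<Sum>v\<in>A. \<phi> v)"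
        using A(2) \<phi> by (subst (asm) ennreal_le_iff) (auto intro!: sum_nonneg simp: less_imp_le subset_iff)
      then show ?thesis by (simp add: c_def)
    qed
    with w A(4) show "\<exists>w. (\<forall>u. 0 \<le> w u) \<and>
      (\<forall>j\<le>k. \<forall>y\<in>words_of_length n j. (\<Sum>u\<in>extensions n k y. w u) \<le> svf s (word_matrix T y)) \<and>
      c \<le> (\<Sum>u\<in>words_of_length n k. w u)"
      by (intro exI[of _ w]) (simp add: \<phi>_def)
  qed
qed

section \<open>Pairs of words and the product measure\<close>

definition common_prefix_length :: "'a list \<Rightarrow> 'a list \<Rightarrow> nat" where
  "common_prefix_length u v = Max {j. j \<le> length u \<and> take j u = take j v}"

lemma common_prefix_length:
  assumes "length u = k" "length v = k"
  shows "common_prefix_length u v \<le> k"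
    and "j \<le> k \<Longrightarrow> take j u = take j v \<longleftrightarrow> j \<le> common_prefix_length u v"
proof -
  let ?S = "{j. j \<le> length u \<and> take j u = take j v}"
  have S: "finite ?S" "0 \<in> ?S" by auto
  then have "Max ?S \<in> ?S" by (intro Max_in) auto
  then have m: "common_prefix_length u v \<le> k"
    "take (common_prefix_length u v) u = take (common_prefix_length u v) v"
    using assms by (auto simp: common_prefix_length_def)
  then show "common_prefix_length u v \<le> k" by simp
  assume j: "j \<le> k"
  show "take j u = take j v \<longleftrightarrow> j \<le> common_prefix_length u v"
  proof
    assume "take j u = take j v"
    then have "j \<in> ?S" using j assms by simp
    then show "j \<le> common_prefix_length u v"
      unfolding common_prefix_length_def using S(1) by (rule Max_ge[rotated])
  next
    assume "j \<le> common_prefix_length u v"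
    then show "take j u = take j v" using m(2) by (metis min.absorb1 take_take)
  qed
qed

lemma common_prefix_length_less:
  assumes "length u = k" "length v = k" "u \<noteq> v"
  shows "common_prefix_length u v < k"
  using common_prefix_length[OF assms(1,2)] assms by (metis le_neq_implies_less order_refl take_all)

text \<open>The indices of the translations that enter \<open>proj\<close> at u; the empty word is
  left out because no map belongs to it.\<close>

definition prefixes :: "'a list \<Rightarrow> 'a list set" where
  "prefixes u = (\<lambda>j. take j u) ` {1..length u}"

lemma finite_prefixes [simp]: "finite (prefixes u)"
  by (simp add: prefixes_def)

lemma inj_on_take: "inj_on (\<lambda>j. take j u) {..length u}"
  by (rule inj_onI) (metis atMost_iff length_take min.absorb2)

text \<open>Two words share the translations up to their longest common prefix, of length m, and no
  others, so a pair depends on 2 k - m independent translations. This exponent decides how much of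
  the normalisation p^(-2k) survives for the pair.\<close>

lemma card_prefixes_Un:
  assumes uv: "length u = k" "length v = k"
  shows "card (prefixes u \<union> prefixes v) = 2 * k - common_prefix_length u v"
proof -
  let ?m = "common_prefix_length u v"
  have inj: "inj_on (\<lambda>j. take j w) {1..l}" if "l \<le> length w" for w :: "'a list" and l
    by (rule inj_on_subset[OF inj_on_take]) (use that in auto)
  have c: "card (prefixes u) = k" "card (prefixes v) = k"
    using uv inj[of "length u" u] inj[of "length v" v] by (simp_all add: prefixes_def card_image)
  have "prefixes u \<inter> prefixes v = (\<lambda>j. take j u) ` {1..?m}"
  proof (intro set_eqI iffI)
    fix x assume "x \<in> prefixes u \<inter> prefixes v"
    then obtain i j where ij: "i \<in> {1..k}" "x = take i u" "j \<in> {1..k}" "x = take j v"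
      using uv by (auto simp: prefixes_def)
    then have "length (take i u) = length (take j v)" by simp
    then have "i = j" using ij uv by simp
    then have "i \<le> ?m" using ij common_prefix_length(2)[OF uv, of i] by simp
    then show "x \<in> (\<lambda>j. take j u) ` {1..?m}" using ij by auto
  next
    fix x assume "x \<in> (\<lambda>j. take j u) ` {1..?m}"
    then obtain j where j: "j \<in> {1..?m}" "x = take j u" by blast
    then have "j \<le> k" using common_prefix_length(1)[OF uv] by simp
    then show "x \<in> prefixes u \<inter> prefixes v"
      using j uv common_prefix_length(2)[OF uv, of j] unfolding prefixes_def
      by (metis (no_types, lifting) IntI atLeastAtMost_iff image_eqI)
  qed
  then have "card (prefixes u \<inter> prefixes v) = ?m"
    using inj[of ?m u] common_prefix_length(1)[OF uv] uv by (simp add: card_image)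
  then show ?thesis
    using card_Un_Int[of "prefixes u" "prefixes v"] c by simp
qed

lemma prefixes_subset_words: "u \<in> words_of_length n k \<Longrightarrow> prefixes u \<subseteq> words n"
  by (auto simp: prefixes_def length_words_of_length intro!: words_of_length_in_words[OF take_in_words_of_length])

text \<open>Grouping the pairs of leaves by their longest common prefix turns the double sum into a sum over
  the nodes, where one of the two factors is absorbed by the capacity.\<close>

lemma pair_sum_le:
  fixes w h \<phi> :: "nat list \<Rightarrow> real"
  assumes w: "\<And>u. 0 \<le> w u"
    and cap: "\<And>j y. j \<le> k \<Longrightarrow> y \<in> words_of_length n j \<Longrightarrow> (\<Sum>u\<in>extensions n k y. w u) \<le> \<phi> y"
    and h: "\<And>j y. j \<le> k \<Longrightarrow> y \<in> words_of_length n j \<Longrightarrow> 0 \<le> h y"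
    and H: "\<And>j y. j \<le> k \<Longrightarrow> y \<in> words_of_length n j \<Longrightarrow> h y * \<phi> y \<le> H j"
  shows "(\<Sum>u\<in>words_of_length n k. \<Sum>v\<in>words_of_length n k. w u * w v * h (take (common_prefix_length u v) u))
    \<le> (\<Sum>u\<in>words_of_length n k. w u) * (\<Sum>j\<le>k. H j)"
proof -
  let ?W = "words_of_length n k"
  let ?S = "\<lambda>y. \<Sum>u\<in>extensions n k y. w u"
  let ?e = "\<lambda>y u. if u \<in> extensions n k y then 1 else 0 :: real"
  have S: "?S y = (\<Sum>u\<in>?W. w u * ?e y u)" for y
  proof -
    have "?S y = (\<Sum>u\<in>?W \<inter> {u. u \<in> extensions n k y}. w u)"
      by (rule sum.cong) (auto simp: extensions_def)
    also have "\<dots> = (\<Sum>u\<in>?W. w u * ?e y u)"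
      by (subst sum.inter_restrict) (auto intro!: sum.cong)
    finally show ?thesis .
  qed
  \<comment> \<open>The value at the longest common prefix is bounded by the sum over all common
    prefixes. That y is a common prefix is a condition on u times a condition on v, so the double
    sum factorises at each node.\<close>
  have "(\<Sum>u\<in>?W. \<Sum>v\<in>?W. w u * w v * h (take (common_prefix_length u v) u))
    \<le> (\<Sum>u\<in>?W. \<Sum>v\<in>?W. w u * w v * (\<Sum>j\<le>k. \<Sum>y\<in>words_of_length n j. h y * ?e y u * ?e y v))"
  proof (intro sum_mono mult_left_mono)
    fix u v assume uv: "u \<in> ?W" "v \<in> ?W"
    let ?m = "common_prefix_length u v"
    note cpl = common_prefix_length[OF uv[THEN length_words_of_length]]
    have m: "?m \<le> k" "take ?m u = take ?m v" using cpl by auto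
    have x: "take ?m u \<in> words_of_length n ?m" using uv m take_in_words_of_length by blast
    have lx: "length (take ?m u) = ?m" using x by (rule length_words_of_length)
    have "u \<in> extensions n k (take ?m u)" "v \<in> extensions n k (take ?m u)"
      unfolding extensions_def lx using uv m by auto
    then have "h (take ?m u) = h (take ?m u) * ?e (take ?m u) u * ?e (take ?m u) v" by simp
    also have "\<dots> \<le> (\<Sum>y\<in>words_of_length n ?m. h y * ?e y u * ?e y v)"
      using m(1) h by (intro member_le_sum x) auto
    also have "\<dots> \<le> (\<Sum>j\<le>k. \<Sum>y\<in>words_of_length n j. h y * ?e y u * ?e y v)"
      using m(1) h by (intro member_le_sum[of ?m "{..k}" "\<lambda>j. \<Sum>y\<in>words_of_length n j. h y * ?e y u * ?e y v"] sum_nonneg) auto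
    finally show "h (take ?m u) \<le> (\<Sum>j\<le>k. \<Sum>y\<in>words_of_length n j. h y * ?e y u * ?e y v)" .
  qed (use w in simp)
  also have "\<dots> = (\<Sum>u\<in>?W. \<Sum>v\<in>?W. \<Sum>j\<le>k. \<Sum>y\<in>words_of_length n j. h y * (w u * ?e y u) * (w v * ?e y v))"
    by (simp only: sum_distrib_left mult_ac)
  also have "\<dots> = (\<Sum>u\<in>?W. \<Sum>j\<le>k. \<Sum>v\<in>?W. \<Sum>y\<in>words_of_length n j. h y * (w u * ?e y u) * (w v * ?e y v))"
    by (rule sum.cong[OF refl], rule sum.swap)
  also have "\<dots> = (\<Sum>u\<in>?W. \<Sum>j\<le>k. \<Sum>y\<in>words_of_length n j. h y * (w u * ?e y u) * ?S y)"
    by (rule sum.cong[OF refl], rule sum.cong[OF refl], subst sum.swap) (simp only: S sum_distrib_left)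
  also have "\<dots> = (\<Sum>j\<le>k. \<Sum>u\<in>?W. \<Sum>y\<in>words_of_length n j. h y * (w u * ?e y u) * ?S y)"
    by (rule sum.swap)
  also have "\<dots> = (\<Sum>j\<le>k. \<Sum>y\<in>words_of_length n j. h y * ?S y * ?S y)"
    by (rule sum.cong[OF refl], subst sum.swap, rule sum.cong[OF refl])
      (simp only: sum_distrib_left[symmetric] sum_distrib_right[symmetric] S[symmetric])
  also have "\<dots> \<le> (\<Sum>j\<le>k. \<Sum>y\<in>words_of_length n j. H j * ?S y)"
  proof (intro sum_mono mult_right_mono)
    fix j y assume j: "j \<in> {..k}" and y: "y \<in> words_of_length n j"
    have "h y * ?S y \<le> h y * \<phi> y" using j y h cap by (intro mult_left_mono) auto
    also have "\<dots> \<le> H j" using j y H by simp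
    finally show "h y * ?S y \<le> H j" .
    show "0 \<le> ?S y" using w by (simp add: sum_nonneg)
  qed
  also have "\<dots> = (\<Sum>j\<le>k. H j * (\<Sum>u\<in>?W. w u))"
    by (intro sum.cong refl) (simp add: sum_distrib_left[symmetric] sum_extensions_words)
  also have "\<dots> = (\<Sum>u\<in>?W. w u) * (\<Sum>j\<le>k. H j)"
    by (simp only: sum_distrib_right[symmetric] mult.commute)
  finally show ?thesis .
qed

section \<open>Probabilities under the product law of the translations\<close>

lemma measure_PiM_all_in:
  assumes \<mu>: "prob_space \<mu>" and F: "finite F" "F \<subseteq> I" and B: "B \<in> sets \<mu>"
  shows "measure (PiM I (\<lambda>_. \<mu>)) {\<omega> \<in> space (PiM I (\<lambda>_. \<mu>)). \<forall>y\<in>F. \<omega> y \<in> B} = measure \<mu> B ^ card F"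
proof -
  interpret \<mu>: prob_space \<mu> by (rule \<mu>)
  interpret product_prob_space "\<lambda>_. \<mu>" I ..
  have "emeasure (PiM I (\<lambda>_. \<mu>)) {\<omega> \<in> space (PiM I (\<lambda>_. \<mu>)). \<forall>y\<in>F. \<omega> y \<in> B} = (\<Prod>y\<in>F. emeasure \<mu> B)"
    using F B by (intro emeasure_PiM_Collect) auto
  also have "\<dots> = ennreal (measure \<mu> B ^ card F)"
    by (simp add: \<mu>.emeasure_eq_measure ennreal_power)
  finally show ?thesis by (simp add: measure_def)
qed

text \<open>Conditioning on all coordinates except \<open>y\<close>.\<close>

lemma measure_PiM_resample:
  fixes f :: "('i \<Rightarrow> 'b) \<Rightarrow> real"
  assumes \<mu>: "prob_space \<mu>" and F: "finite F" "F \<subseteq> I" "y \<in> I" "y \<notin> F" and B: "B \<in> sets \<mu>"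
    and f: "f \<in> borel_measurable (PiM I (\<lambda>_. \<mu>))"
    and bound: "\<And>\<omega>. \<omega> \<in> space (PiM I (\<lambda>_. \<mu>)) \<Longrightarrow> emeasure \<mu> {t \<in> B. f (fun_upd \<omega> y t) \<le> r} \<le> ennreal \<kappa>"
    and \<kappa>: "0 \<le> \<kappa>"
  shows "measure (PiM I (\<lambda>_. \<mu>)) {\<omega> \<in> space (PiM I (\<lambda>_. \<mu>)). (\<forall>j\<in>insert y F. \<omega> j \<in> B) \<and> f \<omega> \<le> r}
    \<le> measure \<mu> B ^ card F * \<kappa>"
proof -
  let ?P = "PiM I (\<lambda>_. \<mu>)"
  interpret \<mu>: prob_space \<mu> by (rule \<mu>)
  interpret Pr: prob_space ?P by (intro prob_space_PiM) (rule \<mu>)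
  interpret pair: pair_sigma_finite \<mu> ?P ..
  let ?E = "{\<omega> \<in> space ?P. (\<forall>j\<in>insert y F. \<omega> j \<in> B) \<and> f \<omega> \<le> r}"
  let ?G = "{\<omega> \<in> space ?P. \<forall>j\<in>F. \<omega> j \<in> B}"
  have coord: "{\<omega> \<in> space ?P. \<omega> j \<in> B} \<in> sets ?P" if "j \<in> I" for j
    using that B by measurable
  have G: "?G \<in> sets ?P"
    using F coord by (intro sets.sets_Collect_finite_All) auto
  have "{\<omega> \<in> space ?P. \<forall>j\<in>insert y F. \<omega> j \<in> B} \<in> sets ?P"
    using F coord by (intro sets.sets_Collect_finite_All) auto
  moreover have "{\<omega> \<in> space ?P. f \<omega> \<le> r} \<in> sets ?P" using f by measurable
  ultimately have E: "?E \<in> sets ?P"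
    by (rule sets.sets_Collect_conj[rotated])
  let ?h = "\<lambda>(t, \<omega>). fun_upd \<omega> y t"
  have I: "insert y I = I" using F by auto
  \<comment> \<open>Overwriting coordinate y by an independent copy preserves the law. The
    probability can thus be computed by integrating over the new value t first; since y is not in F,
    the conditions on F do not involve t.\<close>
  have D: "distr (\<mu> \<Otimes>\<^sub>M ?P) ?P ?h = ?P"
    using distr_pair_PiM_eq_PiM[of I "\<lambda>_. \<mu>" y] \<mu> by (simp add: I)
  have h: "?h \<in> measurable (\<mu> \<Otimes>\<^sub>M ?P) ?P"
  proof -
    have "(\<lambda>(f, t). fun_upd f y t) \<in> measurable (?P \<Otimes>\<^sub>M \<mu>) ?P"
      using measurable_add_dim[of y I "\<lambda>_. \<mu>"] by (simp add: I)
    from measurable_compose[OF measurable_pair_swap' this] show ?thesis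
      by (simp add: case_prod_unfold)
  qed
  have "emeasure ?P ?E = emeasure (distr (\<mu> \<Otimes>\<^sub>M ?P) ?P ?h) ?E" by (simp only: D)
  also have "\<dots> = emeasure (\<mu> \<Otimes>\<^sub>M ?P) (?h -` ?E \<inter> space (\<mu> \<Otimes>\<^sub>M ?P))"
    by (rule emeasure_distr[OF h E])
  also have "\<dots> = (\<integral>\<^sup>+ \<omega>. emeasure \<mu> ((\<lambda>t. (t, \<omega>)) -` (?h -` ?E \<inter> space (\<mu> \<Otimes>\<^sub>M ?P))) \<partial>?P)"
    by (rule pair.emeasure_pair_measure_alt2) (rule measurable_sets[OF h E])
  also have "\<dots> \<le> (\<integral>\<^sup>+ \<omega>. ennreal \<kappa> * indicator ?G \<omega> \<partial>?P)"
  proof (rule nn_integral_mono)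
    fix \<omega> assume \<omega>: "\<omega> \<in> space ?P"
    let ?X = "(\<lambda>t. (t, \<omega>)) -` (?h -` ?E \<inter> space (\<mu> \<Otimes>\<^sub>M ?P))"
    show "emeasure \<mu> ?X \<le> ennreal \<kappa> * indicator ?G \<omega>"
    proof (cases "\<omega> \<in> ?G")
      case True
      have ft: "(\<lambda>t. f (fun_upd \<omega> y t)) \<in> borel_measurable \<mu>"
        using measurable_compose[OF measurable_Pair2'[OF \<omega>] measurable_compose[OF h f]]
        by simp
      have "{t \<in> B. f (fun_upd \<omega> y t) \<le> r} = B \<inter> {t \<in> space \<mu>. f (fun_upd \<omega> y t) \<le> r}"
        using sets.sets_into_space[OF B] by auto
      moreover have "{t \<in> space \<mu>. f (fun_upd \<omega> y t) \<le> r} \<in> sets \<mu>" using ft by measurable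
      ultimately have "{t \<in> B. f (fun_upd \<omega> y t) \<le> r} \<in> sets \<mu>" using B by simp
      then have "emeasure \<mu> ?X \<le> emeasure \<mu> {t \<in> B. f (fun_upd \<omega> y t) \<le> r}"
        by (rule emeasure_mono[rotated]) auto
      also have "\<dots> \<le> ennreal \<kappa>" by (rule bound[OF \<omega>])
      finally show ?thesis using True by simp
    next
      case False
      then obtain j where j: "j \<in> F" "\<omega> j \<notin> B" using \<omega> by blast
      have jy: "j \<noteq> y" using j F(4) by blast
      have "?X = {}"
      proof (rule equals0I)
        fix t assume "t \<in> ?X"
        then have "fun_upd \<omega> y t j \<in> B" using j(1) by (simp del: fun_upd_apply)
        then show False using j(2) jy by simp
      qed
      then show ?thesis by simp
    qed
  qed
  also have "\<dots> = ennreal \<kappa> * emeasure ?P ?G"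
    using G by (simp add: nn_integral_cmult_indicator)
  also have "\<dots> = ennreal (measure \<mu> B ^ card F * \<kappa>)"
    using measure_PiM_all_in[OF \<mu> F(1,2) B] \<kappa>
    by (simp add: Pr.emeasure_eq_measure ennreal_mult[symmetric] mult.commute)
  finally show ?thesis
    using \<kappa> by (simp add: Pr.emeasure_eq_measure)
qed

lemma borel_measurable_proj:
  fixes T :: "nat \<Rightarrow> nat \<Rightarrow> real^'d^'d"
  assumes \<mu>: "sets \<mu> = sets borel" and u: "u \<in> words_of_length n k"
  shows "(\<lambda>\<omega>. proj T x \<omega> u) \<in> borel_measurable (PiM (words n) (\<lambda>_. \<mu>))"
proof -
  have 1: "(\<lambda>\<omega>. \<omega> (take (Suc j) u)) \<in> borel_measurable (PiM (words n) (\<lambda>_. \<mu>))" if "j < length u" for j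
  proof -
    have "take (Suc j) u \<in> words n"
      using that u by (auto intro!: words_of_length_in_words[of _ n "Suc j"] take_in_words_of_length[of u n k]
        dest: length_words_of_length)
    from measurable_component_singleton[OF this, of "\<lambda>_. \<mu>"] show ?thesis
      using measurable_cong_sets[OF refl \<mu>] by blast
  qed
  have 2: "(*v) A \<in> borel_measurable borel" for A :: "real^'d^'d"
    by (intro borel_measurable_continuous_onI linear_continuous_on linear_conv_bounded_linear[THEN iffD1]) simp
  show ?thesis
    unfolding proj_def
    by (intro borel_measurable_add borel_measurable_sum borel_measurable_const measurable_compose[OF 1 2]) auto
qed

section \<open>Percolation on the words\<close>

text \<open>The correlation integral at scale r of the projected mass. Weighted by r^(-t) and summed
  over dyadic r it is a discrete t-energy.\<close>

definition pair_mass ::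
  "(nat \<Rightarrow> nat) \<Rightarrow> (nat \<Rightarrow> nat \<Rightarrow> real^'d^'d) \<Rightarrow> real^'d \<Rightarrow> nat \<Rightarrow> (nat list \<Rightarrow> real) \<Rightarrow> real \<Rightarrow>
    (nat list \<Rightarrow> real^'d) \<Rightarrow> real" where
  "pair_mass n T x0 k \<nu> r \<omega> = (\<Sum>u\<in>words_of_length n k. \<Sum>v\<in>words_of_length n k.
     \<nu> u * \<nu> v * (if norm (proj T x0 \<omega> u - proj T x0 \<omega> v) \<le> r then 1 else 0))"

text \<open>The interface between probability and geometry: what is known at level k for a single
  \<omega>. Weights r^(-t) on dyadic scales bound a t-energy; a single scale comparable to a^k with
  weight a^(-k d) bounds an L2 norm. Quantifying over the mass hides the set \<open>B\<close> by
  which it was thinned out.\<close>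

definition spread ::
  "(nat \<Rightarrow> nat) \<Rightarrow> (nat \<Rightarrow> nat \<Rightarrow> real^'d^'d) \<Rightarrow> real^'d \<Rightarrow> nat \<Rightarrow> nat set \<Rightarrow> (nat \<Rightarrow> real) \<Rightarrow> (nat \<Rightarrow> real) \<Rightarrow>
    real \<Rightarrow> real \<Rightarrow> (nat list \<Rightarrow> real^'d) \<Rightarrow> bool" where
  "spread n T x0 k S b \<rho> c L \<omega> \<longleftrightarrow> (\<exists>\<nu>. (\<forall>u. 0 \<le> \<nu> u) \<and> c \<le> (\<Sum>u\<in>words_of_length n k. \<nu> u) \<and>
     (\<Sum>j\<in>S. b j * pair_mass n T x0 k \<nu> (\<rho> j) \<omega>) \<le> L)"

text \<open>\<open>small_ball\<close> is the form in which the bounded density on \<open>B\<close>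
  is used, and \<open>B_large\<close> makes the series with ratio a^(s - \<sigma>) / p
  converge.\<close>

locale percolation =
  fixes n :: "nat \<Rightarrow> nat" and T :: "nat \<Rightarrow> nat \<Rightarrow> real^'d^'d" and \<mu> :: "(real^'d) measure"
    and x0 :: "real^'d" and B :: "(real^'d) set" and a K s \<sigma> :: real
  assumes prob_space_\<mu>: "prob_space \<mu>" and sets_\<mu>: "sets \<mu> = sets borel" and B: "B \<in> sets borel"
    and inv: "\<And>k i. 1 \<le> k \<Longrightarrow> i \<in> {1..n k} \<Longrightarrow> invertible (T k i)"
    and sv_le: "\<And>k i. 1 \<le> k \<Longrightarrow> i \<in> {1..n k} \<Longrightarrow> singular_value 1 (T k i) \<le> a"
    and a: "0 < a" "a < 1"
    and \<sigma>: "0 \<le> \<sigma>" "\<sigma> < s" "\<sigma> \<le> real CARD('d)"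
    and B_large: "a powr (s - \<sigma>) < measure \<mu> B" and K: "1 \<le> K"
    and small_ball: "\<And>k x z r. x \<in> words_of_length n k \<Longrightarrow> 0 < r \<Longrightarrow>
      emeasure \<mu> {t \<in> B. norm (word_matrix T x *v t + z) \<le> r} \<le> ennreal (K * (r powr \<sigma> / svf \<sigma> (word_matrix T x)))"
begin

abbreviation "\<P> \<equiv> PiM (words n) (\<lambda>_. \<mu>)"

definition "p = measure \<mu> B"

definition "good u = {\<omega> \<in> space \<P>. \<forall>y\<in>prefixes u. \<omega> y \<in> B}"

definition "close r u v = {\<omega> \<in> space \<P>. norm (proj T x0 \<omega> u - proj T x0 \<omega> v) \<le> r}"

lemma prob_space_P: "prob_space \<P>"
  by (intro prob_space_PiM prob_space_\<mu>)

lemma p_bounds: "0 < p" "p \<le> 1" "a powr (s - \<sigma>) < p" "a powr s < p" "a powr s < 1" "0 < a powr s"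
proof -
  show 1: "a powr (s - \<sigma>) < p" using B_large by (simp add: p_def)
  then show "0 < p" by (rule le_less_trans[OF powr_ge_zero])
  show "p \<le> 1" unfolding p_def using prob_space_\<mu> by (simp add: prob_space.prob_le_1)
  have "a powr s \<le> a powr (s - \<sigma>)" using a \<sigma> by (intro powr_mono') auto
  then show "a powr s < p" using 1 by simp
  with \<open>p \<le> 1\<close> show "a powr s < 1" by simp
  show "0 < a powr s" using a by simp
qed

declare p_bounds(1,2) [simp]

lemma p_nonneg [simp]: "0 \<le> p"
  by (rule less_imp_le[OF p_bounds(1)])

lemma p_nonzero [simp]: "p \<noteq> 0"
  by (rule not_sym) (rule less_imp_neq[OF p_bounds(1)])

lemma B_sets_\<mu>: "B \<in> sets \<mu>"
  using B sets_\<mu> by simp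

lemma good_sets [measurable]:
  assumes u: "u \<in> words_of_length n k"
  shows "good u \<in> sets \<P>"
proof -
  have "{\<omega> \<in> space \<P>. \<omega> j \<in> B} \<in> sets \<P>" if "j \<in> words n" for j
    using that B_sets_\<mu> by measurable
  then show ?thesis
    unfolding good_def using prefixes_subset_words[OF u] by (intro sets.sets_Collect_finite_All) auto
qed

lemma close_sets [measurable]:
  assumes u: "u \<in> words_of_length n k" and v: "v \<in> words_of_length n k"
  shows "close r u v \<in> sets \<P>"
proof -
  note [measurable] = borel_measurable_proj[OF sets_\<mu> u] borel_measurable_proj[OF sets_\<mu> v]
  show ?thesis unfolding close_def by measurable
qed

lemma prob_good_Int:
  assumes u: "u \<in> words_of_length n k" and v: "v \<in> words_of_length n k"
  shows "measure \<P> (good u \<inter> good v) = p ^ (2 * k - common_prefix_length u v)"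
proof -
  have "good u \<inter> good v = {\<omega> \<in> space \<P>. \<forall>y\<in>prefixes u \<union> prefixes v. \<omega> y \<in> B}"
    by (auto simp: good_def)
  then show ?thesis
    using measure_PiM_all_in[OF prob_space_\<mu> _ _ B_sets_\<mu>, of "prefixes u \<union> prefixes v" "words n"]
      prefixes_subset_words[OF u] prefixes_subset_words[OF v]
      card_prefixes_Un[OF length_words_of_length[OF u] length_words_of_length[OF v]]
    by (simp add: p_def)
qed

lemma prob_good:
  assumes u: "u \<in> words_of_length n k"
  shows "measure \<P> (good u) = p ^ k"
proof -
  have "common_prefix_length u u = k"
    using common_prefix_length(1)[of u k u] common_prefix_length(2)[of u k u k] length_words_of_length[OF u]
    by simp
  then show ?thesis using prob_good_Int[OF u u] by simp
qed

lemma svf_\<sigma>_pos: "x \<in> words_of_length n j \<Longrightarrow> 0 < svf \<sigma> (word_matrix T x)"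
  by (rule svf_pos[OF invertible_word_matrix[of n T, OF inv] \<sigma>(1)])

lemma svf_word_le:
  assumes x: "x \<in> words_of_length n j" and t: "0 \<le> t" "t \<le> s'" "t \<le> real CARD('d)"
  shows "svf s' (word_matrix T x) \<le> svf t (word_matrix T x) * (a powr (s' - t)) ^ j"
proof -
  have I: "invertible (word_matrix T x)" by (rule invertible_word_matrix[of n T, OF inv x])
  have 1: "1 \<in> {1..CARD('d)}" by (simp add: Suc_leI)
  have "singular_value 1 (word_matrix T x) powr (s' - t) \<le> (a ^ j) powr (s' - t)"
    using singular_value_word_matrix_le[of n T a, OF sv_le less_imp_le[OF a(1)] x 1] singular_value_pos[OF I 1] t
    by (intro powr_mono2) auto
  also have "\<dots> = (a powr (s' - t)) ^ j"
    using a by (simp add: powr_realpow[symmetric] powr_powr mult.commute)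
  finally have "svf t (word_matrix T x) * singular_value 1 (word_matrix T x) powr (s' - t)
      \<le> svf t (word_matrix T x) * (a powr (s' - t)) ^ j"
    using svf_pos[OF I t(1)] by (intro mult_left_mono) auto
  with svf_le_svf_mult[OF I t] show ?thesis by linarith
qed

text \<open>For different u and v with a common prefix of length m, 2 k - m translations have to lie
  in \<open>B\<close>. All of them except the first one after the common prefix on the branch of u
  contribute a factor p, and that one contributes the small ball bound; the normalisation leaves
  p^(-(m+1)). For u = v the distance is 0, and the claim rests on a^k <= r.\<close>

lemma prob_close:
  assumes u: "u \<in> words_of_length n k" and v: "v \<in> words_of_length n k" and r: "a ^ k \<le> r"
  shows "(1 / p) ^ (2 * k) * measure \<P> (good u \<inter> good v \<inter> close r u v)
    \<le> (1 / p) ^ Suc (common_prefix_length u v) * (K * (r powr \<sigma> / svf \<sigma> (word_matrix T (take (common_prefix_length u v) u))))"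
proof -
  interpret Pr: prob_space \<P> by (rule prob_space_P)
  note lu = length_words_of_length[OF u] and lv = length_words_of_length[OF v]
  note p = p_bounds
  have r0: "0 < r" using r a by (meson less_le_trans zero_less_power)
  show ?thesis
  proof (cases "u = v")
    case True
    have cpl: "common_prefix_length u v = k"
      using common_prefix_length(1)[of u k u] common_prefix_length(2)[of u k u k] lu True by simp
    have "(1 / p) ^ (2 * k) * measure \<P> (good u \<inter> good v \<inter> close r u v) \<le> (1 / p) ^ (2 * k) * p ^ k"
      using p u v by (intro mult_left_mono order_trans[OF Pr.finite_measure_mono prob_good[OF u, THEN eq_refl]]) auto
    also have "\<dots> = (1 / p) ^ k"
      by (simp add: mult_2 power_add power_one_over)
    also have "\<dots> \<le> (1 / p) ^ Suc k * (K * (r powr \<sigma> / svf \<sigma> (word_matrix T u)))"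
    proof -
      have pos: "0 < svf \<sigma> (word_matrix T u)" using u by (rule svf_\<sigma>_pos)
      \<comment> \<open>Comparison with exponent 0, where \<open>svf\<close> is 1: the value at
        \<sigma> is at most a^(k \<sigma>), hence at most r^\<sigma>, and the right side of the
        claim is no smaller than the trivial bound.\<close>
      have "svf \<sigma> (word_matrix T u) \<le> svf 0 (word_matrix T u) * (a powr (\<sigma> - 0)) ^ k"
        using \<sigma> by (intro svf_word_le u) auto
      also have "\<dots> = (a ^ k) powr \<sigma>"
        using a by (simp add: svf_def powr_realpow[symmetric] powr_powr mult.commute)
      also have "\<dots> \<le> r powr \<sigma>" using r a \<sigma> by (intro powr_mono2) auto
      finally have 1: "1 \<le> r powr \<sigma> / svf \<sigma> (word_matrix T u)" using pos by simp
      have 2: "1 * 1 \<le> K * (r powr \<sigma> / svf \<sigma> (word_matrix T u))"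
        using 1 K by (intro mult_mono) auto
      have 3: "(1 / p) ^ k \<le> (1 / p) ^ Suc k"
        using p by (intro power_increasing) auto
      have "(1 / p) ^ k * 1 \<le> (1 / p) ^ Suc k * (K * (r powr \<sigma> / svf \<sigma> (word_matrix T u)))"
        using 2 3 p by (intro mult_mono) auto
      then show ?thesis by simp
    qed
    finally show ?thesis using lu by (simp add: cpl)
  next
    case False
    define m where "m = common_prefix_length u v"
    have m: "m < k" unfolding m_def using common_prefix_length_less[OF lu lv False] .
    have eq: "take m u = take m v"
      using common_prefix_length(2)[OF lu lv, of m] m by (simp add: m_def)
    have neq: "take (Suc m) u \<noteq> take (Suc m) v"
      using common_prefix_length(2)[OF lu lv, of "Suc m"] m by (simp add: m_def)
    define y where "y = take (Suc m) u"
    define x where "x = take m u"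
    have x: "x \<in> words_of_length n m" unfolding x_def using u m by (intro take_in_words_of_length) auto
    define F where "F = prefixes u \<union> prefixes v - {y}"
    have yp: "y \<in> prefixes u" using m lu by (auto simp: y_def prefixes_def)
    have sub: "prefixes u \<union> prefixes v \<subseteq> words n"
      using prefixes_subset_words[OF u] prefixes_subset_words[OF v] by blast
    have F: "finite F" "F \<subseteq> words n" "y \<in> words n" "y \<notin> F" "insert y F = prefixes u \<union> prefixes v"
      using sub yp by (auto simp: F_def)
    have "card (prefixes u \<union> prefixes v) = Suc (card F)"
      using F by (metis card_insert_disjoint)
    then have cF: "Suc (card F) = 2 * k - m"
      using card_prefixes_Un[OF lu lv] by (simp add: m_def)
    define \<kappa> where "\<kappa> = K * (r powr \<sigma> / svf \<sigma> (word_matrix T x))"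
    have \<kappa>: "0 \<le> \<kappa>" using K svf_\<sigma>_pos[OF x] by (simp add: \<kappa>_def less_imp_le)
    have "good u \<inter> good v \<inter> close r u v =
      {\<omega> \<in> space \<P>. (\<forall>j\<in>insert y F. \<omega> j \<in> B) \<and> norm (proj T x0 \<omega> u - proj T x0 \<omega> v) \<le> r}"
      unfolding F(5) good_def close_def by blast
    also have "measure \<P> \<dots> \<le> measure \<mu> B ^ card F * \<kappa>"
    proof (rule measure_PiM_resample[OF prob_space_\<mu> F(1-4) B_sets_\<mu> _ _ \<kappa>])
      note [measurable] = borel_measurable_proj[OF sets_\<mu> u] borel_measurable_proj[OF sets_\<mu> v]
      show "(\<lambda>\<omega>. norm (proj T x0 \<omega> u - proj T x0 \<omega> v)) \<in> borel_measurable \<P>" by measurable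
      fix \<omega>
      define z where "z = proj T x0 (fun_upd \<omega> y 0) u - proj T x0 (fun_upd \<omega> y 0) v"
      have "proj T x0 (fun_upd \<omega> y t) u - proj T x0 (fun_upd \<omega> y t) v = word_matrix T x *v t + z" for t
        unfolding z_def x_def y_def by (rule proj_diff_fun_upd[OF lu lv m eq neq])
      then show "emeasure \<mu> {t \<in> B. norm (proj T x0 (fun_upd \<omega> y t) u - proj T x0 (fun_upd \<omega> y t) v) \<le> r} \<le> ennreal \<kappa>"
        unfolding \<kappa>_def by (simp only: small_ball[OF x r0])
    qed
    finally have "(1 / p) ^ (2 * k) * measure \<P> (good u \<inter> good v \<inter> close r u v) \<le> (1 / p) ^ (2 * k) * (p ^ card F * \<kappa>)"
      using p by (intro mult_left_mono) (auto simp: p_def)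
    also have "(1 / p) ^ (2 * k) * (p ^ card F * \<kappa>) = (1 / p) ^ Suc m * \<kappa>"
    proof -
      have "2 * k = Suc m + card F" using cF m by simp
      then have "(1 / p) ^ (2 * k) = (1 / p) ^ Suc m * (1 / p) ^ card F" by (simp only: power_add)
      moreover have "(1 / p) ^ card F * p ^ card F = 1"
        using p by (simp add: power_mult_distrib[symmetric])
      ultimately show ?thesis by (metis mult.assoc mult_1)
    qed
    finally show ?thesis by (simp add: \<kappa>_def m_def x_def)
  qed
qed

end

section \<open>First and second moments at a fixed level\<close>

locale percolation_level = percolation +
  fixes k :: nat and w :: "nat list \<Rightarrow> real"
  assumes w: "\<And>u. 0 \<le> w u"
    and cap: "\<And>j y. j \<le> k \<Longrightarrow> y \<in> words_of_length n j \<Longrightarrow>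
      (\<Sum>u\<in>extensions n k y. w u) \<le> svf s (word_matrix T y)"
begin

definition "C = (\<Sum>u\<in>words_of_length n k. w u)"

definition "\<nu> \<omega> u = w u * (1 / p) ^ k * indicator (good u) \<omega>"

definition "mass \<omega> = (\<Sum>u\<in>words_of_length n k. \<nu> \<omega> u)"

lemma C_nonneg: "0 \<le> C"
  using w by (simp add: C_def sum_nonneg)

lemma \<nu>_nonneg: "0 \<le> \<nu> \<omega> u"
  using w p_bounds(1) by (simp add: \<nu>_def)

lemma integrable_indicator_finite:
  "A \<in> sets \<P> \<Longrightarrow> integrable \<P> (\<lambda>\<omega>. c * indicator A \<omega> :: real)"
proof -
  interpret Pr: prob_space \<P> by (rule prob_space_P)
  show "A \<in> sets \<P> \<Longrightarrow> integrable \<P> (\<lambda>\<omega>. c * indicator A \<omega> :: real)"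
    by (intro integrable_mult_right integrable_real_indicator) (auto simp: Pr.emeasure_eq_measure)
qed

lemma mass_eq: "mass \<omega> = (\<Sum>u\<in>words_of_length n k. (w u * (1 / p) ^ k) * indicator (good u) \<omega>)"
  by (simp add: mass_def \<nu>_def)

lemma mass_square_eq: "(mass \<omega>)\<^sup>2 = (\<Sum>u\<in>words_of_length n k. \<Sum>v\<in>words_of_length n k.
    (w u * w v * (1 / p) ^ (2 * k)) * indicator (good u \<inter> good v) \<omega>)"
proof -
  have "(1 / p) ^ (2 * k) = (1 / p) ^ k * (1 / p) ^ k" by (simp only: mult_2 power_add)
  then show ?thesis
    unfolding mass_def power2_eq_square sum_product
    by (intro sum.cong refl) (simp add: \<nu>_def indicator_inter_arith)
qed

lemma integrable_mass: "integrable \<P> mass"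
proof -
  have "integrable \<P> (\<lambda>\<omega>. \<Sum>u\<in>words_of_length n k. (w u * (1 / p) ^ k) * indicator (good u) \<omega>)"
    by (intro Bochner_Integration.integrable_sum integrable_indicator_finite good_sets)
  then show ?thesis by (simp add: mass_eq[abs_def])
qed

lemma integrable_mass_square: "integrable \<P> (\<lambda>\<omega>. (mass \<omega>)\<^sup>2)"
  unfolding mass_square_eq
  by (intro Bochner_Integration.integrable_sum integrable_indicator_finite sets.Int good_sets)

lemma expectation_mass: "integral\<^sup>L \<P> mass = C"
proof -
  have "integral\<^sup>L \<P> mass = (\<Sum>u\<in>words_of_length n k. (w u * (1 / p) ^ k) * measure \<P> (good u))"
    unfolding mass_eq[abs_def]
    by (subst Bochner_Integration.integral_sum)
      (intro integrable_indicator_finite good_sets, assumption, intro sum.cong refl, simp add: good_sets)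
  also have "\<dots> = C"
    unfolding C_def using p_bounds(1)
    by (intro sum.cong refl) (simp add: prob_good power_one_over)
  finally show ?thesis .
qed

text \<open>After normalisation the survivals of u and v have covariance p^(-m) - 1, with m the
  length of the common prefix. Keeping the -1 in the node weight makes the bound vanish as p tends
  to 1: since \<open>svf s\<close> is at most q^j on words of length j, with q = a^s, level j
  contributes (q / p)^j - q^j.\<close>

lemma variance_mass:
  "integral\<^sup>L \<P> (\<lambda>\<omega>. (mass \<omega> - integral\<^sup>L \<P> mass)\<^sup>2) \<le>
    C * (1 / (1 - a powr s / p) - 1 / (1 - a powr s))"
proof -
  interpret Pr: prob_space \<P> by (rule prob_space_P)
  note p = p_bounds
  let ?W = "words_of_length n k" and ?q = "a powr s"
  have E2: "integral\<^sup>L \<P> (\<lambda>\<omega>. (mass \<omega>)\<^sup>2) =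
    (\<Sum>u\<in>?W. \<Sum>v\<in>?W. w u * w v * (1 / p) ^ (common_prefix_length u v))"
  proof -
    have "integral\<^sup>L \<P> (\<lambda>\<omega>. (mass \<omega>)\<^sup>2) = (\<Sum>u\<in>?W. integral\<^sup>L \<P> (\<lambda>\<omega>. \<Sum>v\<in>?W.
        (w u * w v * (1 / p) ^ (2 * k)) * indicator (good u \<inter> good v) \<omega>))"
      unfolding mass_square_eq
      by (rule Bochner_Integration.integral_sum)
        (intro Bochner_Integration.integrable_sum integrable_indicator_finite sets.Int good_sets)
    also have "\<dots> = (\<Sum>u\<in>?W. \<Sum>v\<in>?W. integral\<^sup>L \<P> (\<lambda>\<omega>.
        (w u * w v * (1 / p) ^ (2 * k)) * indicator (good u \<inter> good v) \<omega>))"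
      by (rule sum.cong[OF refl], rule Bochner_Integration.integral_sum)
        (intro integrable_indicator_finite sets.Int good_sets)
    also have "\<dots> = (\<Sum>u\<in>?W. \<Sum>v\<in>?W. w u * w v * (1 / p) ^ (common_prefix_length u v))"
    proof (intro sum.cong refl)
      fix u v assume uv: "u \<in> ?W" "v \<in> ?W"
      have m: "common_prefix_length u v \<le> k"
        using common_prefix_length(1) uv[THEN length_words_of_length] by blast
      have "2 * k = common_prefix_length u v + (2 * k - common_prefix_length u v)" using m by simp
      then have "(1 / p) ^ (2 * k) =
        (1 / p) ^ (common_prefix_length u v) * (1 / p) ^ (2 * k - common_prefix_length u v)"
        by (metis power_add)
      moreover have "(1 / p) ^ (2 * k - common_prefix_length u v) * p ^ (2 * k - common_prefix_length u v) = 1"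
        using p(1) by (simp add: power_mult_distrib[symmetric])
      ultimately have "(1 / p) ^ (2 * k) * measure \<P> (good u \<inter> good v) = (1 / p) ^ (common_prefix_length u v)"
        using uv by (simp add: prob_good_Int mult.assoc)
      moreover have "integral\<^sup>L \<P> (\<lambda>\<omega>. (w u * w v * (1 / p) ^ (2 * k)) * indicator (good u \<inter> good v) \<omega>) =
        w u * w v * ((1 / p) ^ (2 * k) * measure \<P> (good u \<inter> good v))"
        using uv good_sets by (simp add: mult.assoc)
      ultimately show "integral\<^sup>L \<P> (\<lambda>\<omega>. (w u * w v * (1 / p) ^ (2 * k)) * indicator (good u \<inter> good v) \<omega>) =
        w u * w v * (1 / p) ^ (common_prefix_length u v)" by simp
    qed
    finally show ?thesis .
  qed
  have C2: "C\<^sup>2 = (\<Sum>u\<in>?W. \<Sum>v\<in>?W. w u * w v)"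
    by (simp add: C_def power2_eq_square sum_product)
  have len: "length (take (common_prefix_length u v) u) = common_prefix_length u v"
    if "u \<in> ?W" "v \<in> ?W" for u v
    using common_prefix_length(1)[OF that[THEN length_words_of_length]] length_words_of_length[OF that(1)] by simp
  have "integral\<^sup>L \<P> (\<lambda>\<omega>. (mass \<omega> - integral\<^sup>L \<P> mass)\<^sup>2) = integral\<^sup>L \<P> (\<lambda>\<omega>. (mass \<omega>)\<^sup>2) - C\<^sup>2"
    using Pr.variance_eq[OF integrable_mass integrable_mass_square] by (simp add: expectation_mass)
  \<comment> \<open>The exponent is written as a length so that the weight becomes a function of the
    common prefix, as \<open>pair_sum_le\<close> requires.\<close>
  also have "\<dots> = (\<Sum>u\<in>?W. \<Sum>v\<in>?W. w u * w v * ((1 / p) ^ length (take (common_prefix_length u v) u) - 1))"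
    unfolding E2 C2 sum_subtractf[symmetric] by (intro sum.cong refl) (simp only: len right_diff_distrib mult_1_right)
  also have "\<dots> \<le> C * (\<Sum>j\<le>k. ((?q / p) ^ j - ?q ^ j))"
    unfolding C_def
  proof (rule pair_sum_le[OF w cap])
    fix j y assume y: "j \<le> k" "y \<in> words_of_length n j"
    have ly: "length y = j" using y(2) by (rule length_words_of_length)
    have ge: "1 \<le> (1 / p) ^ j" using p by (intro one_le_power) auto
    then show "0 \<le> (1 / p) ^ length y - 1" by (simp add: ly)
    have "svf s (word_matrix T y) \<le> ?q ^ j"
      using svf_word_le[OF y(2), of 0 s] \<sigma> by (simp add: svf_def)
    then have "((1 / p) ^ length y - 1) * svf s (word_matrix T y) \<le> ((1 / p) ^ j - 1) * ?q ^ j"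
      unfolding ly using ge by (intro mult_left_mono) auto
    then show "((1 / p) ^ length y - 1) * svf s (word_matrix T y) \<le> (?q / p) ^ j - ?q ^ j"
      by (simp add: left_diff_distrib power_divide)
  qed
  also have "\<dots> \<le> C * (1 / (1 - ?q / p) - 1 / (1 - ?q))"
  proof (rule mult_left_mono[OF _ C_nonneg])
    have S: "(\<lambda>j. (?q / p) ^ j - ?q ^ j) sums (1 / (1 - ?q / p) - 1 / (1 - ?q))"
      using p by (intro sums_diff geometric_sums) auto
    have le: "?q \<le> ?q / p" using p by (simp add: field_simps)
    have "(\<Sum>j\<in>{..k}. ((?q / p) ^ j - ?q ^ j)) \<le> suminf (\<lambda>j. (?q / p) ^ j - ?q ^ j)"
      by (rule sum_le_suminf[OF sums_summable[OF S]]) (use le in \<open>simp_all add: power_mono\<close>)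
    then show "(\<Sum>j\<le>k. ((?q / p) ^ j - ?q ^ j)) \<le> 1 / (1 - ?q / p) - 1 / (1 - ?q)"
      by (simp only: sums_unique[OF S])
  qed
  finally show ?thesis .
qed

lemma pair_mass_eq:
  assumes "\<omega> \<in> space \<P>"
  shows "pair_mass n T x0 k (\<nu> \<omega>) r \<omega> = (\<Sum>u\<in>words_of_length n k. \<Sum>v\<in>words_of_length n k.
    (w u * w v * (1 / p) ^ (2 * k)) * indicator (good u \<inter> good v \<inter> close r u v) \<omega>)"
  unfolding pair_mass_def
  by (intro sum.cong refl)
    (use assms in \<open>simp add: \<nu>_def close_def indicator_def mult_2 power_add\<close>)

lemma integrable_pair_mass: "integrable \<P> (\<lambda>\<omega>. pair_mass n T x0 k (\<nu> \<omega>) r \<omega>)"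
proof -
  have "integrable \<P> (\<lambda>\<omega>. \<Sum>u\<in>words_of_length n k. \<Sum>v\<in>words_of_length n k.
    (w u * w v * (1 / p) ^ (2 * k)) * indicator (good u \<inter> good v \<inter> close r u v) \<omega>)"
    by (intro Bochner_Integration.integrable_sum integrable_indicator_finite sets.Int good_sets close_sets)
  then show ?thesis
    by (rule Bochner_Integration.integrable_cong[OF refl, THEN iffD1, rotated]) (simp add: pair_mass_eq)
qed

lemma pair_mass_nonneg: "0 \<le> pair_mass n T x0 k (\<nu> \<omega>) r \<omega>"
  unfolding pair_mass_def using \<nu>_nonneg by (intro sum_nonneg) simp

text \<open>At a node of length j the weight p^(-j-1) K r^\<sigma> / \<open>svf \<sigma>\<close>
  meets the capacity \<open>svf s\<close>. The quotient of the two singular value functions is at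
  most a^((s - \<sigma>) j), so the levels sum to a geometric series with ratio a^(s - \<sigma>) /
  p.\<close>

lemma expectation_pair_mass:
  assumes r: "a ^ k \<le> r"
  shows "integral\<^sup>L \<P> (\<lambda>\<omega>. pair_mass n T x0 k (\<nu> \<omega>) r \<omega>) \<le>
    C * (K / p / (1 - a powr (s - \<sigma>) / p)) * r powr \<sigma>"
proof -
  note p = p_bounds
  let ?W = "words_of_length n k" and ?\<theta> = "a powr (s - \<sigma>)"
  let ?h = "\<lambda>y. (1 / p) ^ Suc (length y) * (K * (r powr \<sigma> / svf \<sigma> (word_matrix T y)))"
  have "integral\<^sup>L \<P> (\<lambda>\<omega>. pair_mass n T x0 k (\<nu> \<omega>) r \<omega>) =
    integral\<^sup>L \<P> (\<lambda>\<omega>. \<Sum>u\<in>?W. \<Sum>v\<in>?W. (w u * w v * (1 / p) ^ (2 * k)) * indicator (good u \<inter> good v \<inter> close r u v) \<omega>)"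
    by (rule Bochner_Integration.integral_cong) (auto simp: pair_mass_eq)
  also have "\<dots> = (\<Sum>u\<in>?W. integral\<^sup>L \<P> (\<lambda>\<omega>. \<Sum>v\<in>?W.
      (w u * w v * (1 / p) ^ (2 * k)) * indicator (good u \<inter> good v \<inter> close r u v) \<omega>))"
    by (rule Bochner_Integration.integral_sum)
      (intro Bochner_Integration.integrable_sum integrable_indicator_finite sets.Int good_sets close_sets)
  also have "\<dots> = (\<Sum>u\<in>?W. \<Sum>v\<in>?W. integral\<^sup>L \<P> (\<lambda>\<omega>.
      (w u * w v * (1 / p) ^ (2 * k)) * indicator (good u \<inter> good v \<inter> close r u v) \<omega>))"
    by (rule sum.cong[OF refl], rule Bochner_Integration.integral_sum)
      (intro integrable_indicator_finite sets.Int good_sets close_sets)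
  also have "\<dots> \<le> (\<Sum>u\<in>?W. \<Sum>v\<in>?W. w u * w v * ?h (take (common_prefix_length u v) u))"
  proof (intro sum_mono)
    fix u v assume uv: "u \<in> ?W" "v \<in> ?W"
    have len: "length (take (common_prefix_length u v) u) = common_prefix_length u v"
      using common_prefix_length(1)[OF uv[THEN length_words_of_length]] length_words_of_length[OF uv(1)] by simp
    have "good u \<inter> good v \<inter> close r u v \<in> sets \<P>"
      using uv by (intro sets.Int good_sets close_sets)
    then have "integral\<^sup>L \<P> (\<lambda>\<omega>. (w u * w v * (1 / p) ^ (2 * k)) * indicator (good u \<inter> good v \<inter> close r u v) \<omega>) =
      w u * w v * ((1 / p) ^ (2 * k) * measure \<P> (good u \<inter> good v \<inter> close r u v))"
      by (simp add: mult.assoc sets.Int_space_eq2)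
    also have "\<dots> \<le> w u * w v * ?h (take (common_prefix_length u v) u)"
      unfolding len using w by (intro mult_left_mono prob_close uv r) auto
    finally show "integral\<^sup>L \<P> (\<lambda>\<omega>. (w u * w v * (1 / p) ^ (2 * k)) * indicator (good u \<inter> good v \<inter> close r u v) \<omega>)
      \<le> w u * w v * ?h (take (common_prefix_length u v) u)" .
  qed
  also have "\<dots> \<le> C * (\<Sum>j\<le>k. (K / p * r powr \<sigma>) * (?\<theta> / p) ^ j)"
    unfolding C_def
  proof (rule pair_sum_le[OF w cap])
    fix j y assume y: "j \<le> k" "y \<in> words_of_length n j"
    have ly: "length y = j" using y(2) by (rule length_words_of_length)
    have pos: "0 < svf \<sigma> (word_matrix T y)" using y(2) by (rule svf_\<sigma>_pos)
    show nn: "0 \<le> ?h y" using pos K p(1) by (auto simp: less_imp_le)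
    have "svf s (word_matrix T y) \<le> svf \<sigma> (word_matrix T y) * ?\<theta> ^ j"
      using \<sigma> by (intro svf_word_le y) auto
    then have "?h y * svf s (word_matrix T y) \<le> ?h y * (svf \<sigma> (word_matrix T y) * ?\<theta> ^ j)"
      using nn by (rule mult_left_mono)
    also have "\<dots> = (K / p * r powr \<sigma>) * (?\<theta> / p) ^ j"
      using pos by (simp add: ly power_divide)
    finally show "?h y * svf s (word_matrix T y) \<le> (K / p * r powr \<sigma>) * (?\<theta> / p) ^ j" .
  qed
  also have "\<dots> = C * ((K / p * r powr \<sigma>) * (\<Sum>j\<le>k. (?\<theta> / p) ^ j))"
    by (simp only: sum_distrib_left)
  also have "\<dots> \<le> C * ((K / p * r powr \<sigma>) * (1 / (1 - ?\<theta> / p)))"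
  proof (intro mult_left_mono C_nonneg)
    have S: "(\<lambda>j. (?\<theta> / p) ^ j) sums (1 / (1 - ?\<theta> / p))"
      using p by (intro geometric_sums) auto
    have "(\<Sum>j\<le>k. (?\<theta> / p) ^ j) \<le> suminf (\<lambda>j. (?\<theta> / p) ^ j)"
      by (rule sum_le_suminf[OF sums_summable[OF S]]) simp_all
    then show "(\<Sum>j\<le>k. (?\<theta> / p) ^ j) \<le> 1 / (1 - ?\<theta> / p)"
      by (simp only: sums_unique[OF S])
    show "0 \<le> K / p * r powr \<sigma>" using K p by simp
  qed
  also have "\<dots> = C * (K / p / (1 - ?\<theta> / p)) * r powr \<sigma>" by simp
  finally show ?thesis .
qed

text \<open>Chebyshev's inequality keeps the mass within C / 2 of its mean C; as the variance bound
  is linear in C, the exceptional probability is of order 1 / C. Markov's inequality bounds the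
  energy. Both losses depend on k only through C, which lies between c and the capacity of the
  root.\<close>

lemma spread_event:
  assumes S: "finite S" "\<And>j. j \<in> S \<Longrightarrow> 0 \<le> b j" "\<And>j. j \<in> S \<Longrightarrow> a ^ k \<le> \<rho> j"
    and K': "(\<Sum>j\<in>S. b j * \<rho> j powr \<sigma>) \<le> K'" and L: "0 < L" and c: "0 < c" "c \<le> C"
  obtains E where "E \<in> sets \<P>" "\<And>\<omega>. \<omega> \<in> E \<Longrightarrow> spread n T x0 k S b \<rho> (c / 2) L \<omega>"
    "1 - 4 / c * (1 / (1 - a powr s / p) - 1 / (1 - a powr s))
      - C * (K / p / (1 - a powr (s - \<sigma>) / p)) * K' / L \<le> measure \<P> E"
proof -
  interpret Pr: prob_space \<P> by (rule prob_space_P)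
  note p = p_bounds
  let ?V = "1 / (1 - a powr s / p) - 1 / (1 - a powr s)"
  let ?K2 = "K / p / (1 - a powr (s - \<sigma>) / p)"
  let ?Q = "\<lambda>\<omega>. \<Sum>j\<in>S. b j * pair_mass n T x0 k (\<nu> \<omega>) (\<rho> j) \<omega>"
  have iQ: "integrable \<P> ?Q"
    by (intro Bochner_Integration.integrable_sum integrable_mult_right integrable_pair_mass)
  have Q_nn: "0 \<le> ?Q \<omega>" for \<omega>
    using S pair_mass_nonneg by (intro sum_nonneg mult_nonneg_nonneg) auto
  have K2: "0 \<le> ?K2" using K p(1,3) by (intro divide_nonneg_nonneg) auto
  have EQ: "integral\<^sup>L \<P> ?Q \<le> C * ?K2 * K'"
  proof -
    have "integral\<^sup>L \<P> ?Q = (\<Sum>j\<in>S. b j * integral\<^sup>L \<P> (\<lambda>\<omega>. pair_mass n T x0 k (\<nu> \<omega>) (\<rho> j) \<omega>))"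
      by (subst Bochner_Integration.integral_sum) (auto intro!: integrable_mult_right integrable_pair_mass)
    also have "\<dots> \<le> (\<Sum>j\<in>S. b j * (C * ?K2 * \<rho> j powr \<sigma>))"
      using S by (intro sum_mono mult_left_mono expectation_pair_mass) auto
    also have "\<dots> = C * ?K2 * (\<Sum>j\<in>S. b j * \<rho> j powr \<sigma>)"
      by (subst sum_distrib_left) (simp only: mult_ac)
    also have "\<dots> \<le> C * ?K2 * K'"
      using C_nonneg K2 K' by (intro mult_left_mono mult_nonneg_nonneg) auto
    finally show ?thesis .
  qed
  define X where "X = {\<omega> \<in> space \<P>. C / 2 \<le> \<bar>mass \<omega> - integral\<^sup>L \<P> mass\<bar>}"
  define Y where "Y = {\<omega> \<in> space \<P>. L \<le> ?Q \<omega>}"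
  note [measurable] = borel_measurable_integrable[OF integrable_mass] borel_measurable_integrable[OF iQ]
  have XY: "X \<in> sets \<P>" "Y \<in> sets \<P>" unfolding X_def Y_def by measurable
  have C0: "0 < C" using c by simp
  have V: "0 \<le> ?V"
  proof -
    have "a powr s \<le> a powr s / p" using p by (simp add: field_simps)
    moreover have "a powr s / p < 1" using p by simp
    ultimately show ?thesis by (simp add: frac_le)
  qed
  have "measure \<P> X \<le> integral\<^sup>L \<P> (\<lambda>\<omega>. (mass \<omega> - integral\<^sup>L \<P> mass)\<^sup>2) / (C / 2)\<^sup>2"
    unfolding X_def using C0 by (intro Pr.Chebyshev_inequality integrable_mass_square) auto
  also have "\<dots> \<le> (C * ?V) / (C / 2)\<^sup>2"
    by (intro divide_right_mono variance_mass) simp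
  also have "\<dots> = 4 / C * ?V"
    using C0 by (simp add: power2_eq_square)
  also have "\<dots> \<le> 4 / c * ?V"
    using V c by (intro mult_right_mono divide_left_mono) auto
  finally have PX: "measure \<P> X \<le> 4 / c * ?V" .
  have "measure \<P> Y \<le> integral\<^sup>L \<P> ?Q / L"
    unfolding Y_def by (rule integral_Markov_inequality_measure[OF iQ sets.top]) (use L Q_nn in auto)
  also have "\<dots> \<le> C * ?K2 * K' / L" using EQ L by (intro divide_right_mono) auto
  finally have PY: "measure \<P> Y \<le> C * ?K2 * K' / L" .
  show thesis
  proof (rule that[of "space \<P> - (X \<union> Y)"])
    show "space \<P> - (X \<union> Y) \<in> sets \<P>" using XY by auto
    have "measure \<P> (space \<P> - (X \<union> Y)) = 1 - measure \<P> (X \<union> Y)"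
      using XY by (intro Pr.prob_compl) auto
    moreover have "measure \<P> (X \<union> Y) \<le> measure \<P> X + measure \<P> Y"
      using XY by (rule measure_Un_le)
    ultimately show "1 - 4 / c * ?V - C * ?K2 * K' / L \<le> measure \<P> (space \<P> - (X \<union> Y))"
      using PX PY by linarith
    fix \<omega> assume "\<omega> \<in> space \<P> - (X \<union> Y)"
    then have \<omega>: "\<bar>mass \<omega> - C\<bar> < C / 2" "?Q \<omega> \<le> L"
      by (auto simp: X_def Y_def expectation_mass)
    then have "c / 2 \<le> mass \<omega>" using c by linarith
    then show "spread n T x0 k S b \<rho> (c / 2) L \<omega>"
      unfolding spread_def using \<omega> \<nu>_nonneg by (intro exI[of _ "\<nu> \<omega>"]) (auto simp: mass_def)
  qed
qed

end

section \<open>Almost sure spreading\<close>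

text \<open>Truncation of the Radon-Nikodym density: the sets where it is at most m, cut to balls,
  increase to a set of full measure because the density is finite almost everywhere. One m serves
  both as density bound and as radius.\<close>

lemma bounded_density_set:
  fixes \<mu> :: "'a::euclidean_space measure"
  assumes \<mu>: "prob_space \<mu>" "sets \<mu> = sets borel" and ac: "absolutely_continuous lborel \<mu>" and p: "p < 1"
  obtains B m where "B \<in> sets borel" "1 \<le> m" "B \<subseteq> cball 0 m" "p < measure \<mu> B"
    "\<And>A. A \<in> sets borel \<Longrightarrow> A \<subseteq> B \<Longrightarrow> emeasure \<mu> A \<le> ennreal m * emeasure lborel A"
proof -
  interpret \<mu>: prob_space \<mu> by (rule \<mu>)
  define f where "f = RN_deriv lborel \<mu>"
  have sets: "sets \<mu> = sets lborel" using \<mu>(2) by simp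
  have dens: "density lborel f = \<mu>"
    unfolding f_def by (rule sigma_finite_measure.density_RN_deriv[OF sigma_finite_lborel ac sets])
  have f [measurable]: "f \<in> borel_measurable borel"
    using borel_measurable_RN_deriv[of lborel \<mu>] by (simp add: f_def)
  have "AE x in lborel. f x \<noteq> \<infinity>"
    unfolding f_def by (rule sigma_finite_measure.RN_deriv_finite[OF sigma_finite_lborel _ ac sets]) (rule \<mu>.sigma_finite_measure)
  then have fin: "AE x in \<mu>. f x \<noteq> \<infinity>"
    by (rule absolutely_continuous_AE[OF sets ac])
  define B where "B = (\<lambda>m. {x. f x \<le> ennreal (real (Suc m))} \<inter> cball 0 (real (Suc m)))"
  have Bs: "B m \<in> sets borel" for m
  proof -
    have "{x \<in> space borel. f x \<le> ennreal (real (Suc m))} \<in> sets borel" by measurable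
    then show ?thesis by (simp add: B_def)
  qed
  have inc: "incseq B"
  proof (rule incseq_SucI)
    fix m
    have "ennreal (real (Suc m)) \<le> ennreal (real (Suc (Suc m)))" by (intro ennreal_leI) simp
    then show "B m \<le> B (Suc m)" unfolding B_def by (auto intro: order_trans)
  qed
  have "AE x in \<mu>. x \<in> (\<Union>m. B m)"
    using fin
  proof eventually_elim
    case (elim x)
    then obtain y where y: "f x = ennreal y" "0 \<le> y" by (cases "f x") auto
    obtain m where m: "max y (norm x) \<le> real m" using real_arch_simple by blast
    have "f x \<le> ennreal (real (Suc m))" unfolding y(1) using m by (intro ennreal_leI) simp
    moreover have "x \<in> cball 0 (real (Suc m))" using m by simp
    ultimately show ?case unfolding B_def by blast
  qed
  then have "measure \<mu> (\<Union>m. B m) = 1"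
    using Bs \<mu>(2) by (subst \<mu>.prob_eq_1) auto
  moreover have "(\<lambda>m. measure \<mu> (B m)) \<longlonglongrightarrow> measure \<mu> (\<Union>m. B m)"
    using Bs \<mu>(2) inc by (intro \<mu>.finite_Lim_measure_incseq) auto
  ultimately have "eventually (\<lambda>m. p < measure \<mu> (B m)) sequentially"
    using p by (auto intro: order_tendstoD)
  then obtain m where m: "p < measure \<mu> (B m)" by (auto simp: eventually_sequentially)
  show thesis
  proof (rule that[of "B m" "real (Suc m)"])
    show "B m \<subseteq> cball 0 (real (Suc m))" by (simp add: B_def)
    fix A assume A: "A \<in> sets borel" "A \<subseteq> B m"
    have "emeasure \<mu> A = (\<integral>\<^sup>+ x. f x * indicator A x \<partial>lborel)"
      using A(1) by (subst dens[symmetric]) (simp add: emeasure_density)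
    also have "\<dots> \<le> (\<integral>\<^sup>+ x. ennreal (real (Suc m)) * indicator A x \<partial>lborel)"
      using A(2) by (intro nn_integral_mono) (auto simp: B_def indicator_def)
    also have "\<dots> = ennreal (real (Suc m)) * emeasure lborel A"
      using A(1) by (simp add: nn_integral_cmult_indicator)
    finally show "emeasure \<mu> A \<le> ennreal (real (Suc m)) * emeasure lborel A" .
  qed (use Bs m in auto)
qed

text \<open>For fixed l the upper limit of the events is a decreasing limit of tail unions, each of
  probability at least 1 - 1 / (l + 1); the union over l is then almost sure. The argument works for
  dependent events, and the levels are dependent because they share translations.\<close>

lemma (in prob_space) AE_frequently:
  fixes E :: "nat \<Rightarrow> nat \<Rightarrow> 'a set"
  assumes E: "\<And>l k. E l k \<in> events" and prob: "\<And>l k. 1 - 1 / real (Suc l) \<le> prob (E l k)"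
  shows "AE \<omega> in M. \<exists>l. \<forall>m. \<exists>k\<ge>m. \<omega> \<in> E l k"
proof -
  define U where "U = (\<lambda>l m. \<Union>k\<in>{m..}. E l k)"
  define G where "G = (\<lambda>l. \<Inter>m. U l m)"
  have U: "U l m \<in> events" for l m unfolding U_def using E by (intro sets.countable_UN'') (auto intro: countableI_type)
  have G: "G l \<in> events" for l unfolding G_def using U by auto
  have "1 - 1 / real (Suc l) \<le> prob (G l)" for l
  proof (rule LIMSEQ_le_const)
    show "(\<lambda>m. prob (U l m)) \<longlonglongrightarrow> prob (G l)"
      unfolding G_def using U by (intro finite_Lim_measure_decseq) (auto simp: decseq_def U_def intro: order_trans)
    have "1 - 1 / real (Suc l) \<le> prob (U l m)" for m
      using prob[of l m] finite_measure_mono[of "E l m" "U l m"] U by (force simp: U_def)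
    then show "\<exists>N. \<forall>m\<ge>N. 1 - 1 / real (Suc l) \<le> prob (U l m)" by blast
  qed
  moreover have "prob (G l) \<le> prob (\<Union>l. G l)" for l
    using G by (intro finite_measure_mono) auto
  ultimately have "1 - 1 / real (Suc l) \<le> prob (\<Union>l. G l)" for l
    by (rule order_trans)
  moreover have "(\<lambda>l. 1 - 1 / real (Suc l)) \<longlonglongrightarrow> 1 - 0"
    by (intro tendsto_diff tendsto_const LIMSEQ_Suc lim_1_over_n)
  ultimately have "1 - 0 \<le> prob (\<Union>l. G l)"
    by (intro LIMSEQ_le_const2) auto
  then have "prob (\<Union>l. G l) = 1" by (intro antisym prob_le_1) simp
  then have "AE \<omega> in M. \<omega> \<in> (\<Union>l. G l)" by (rule AE_prob_1)
  then show ?thesis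
    by eventually_elim (simp add: G_def U_def Bex_def)
qed

lemma variance_bound_tendsto:
  fixes q :: real
  assumes "0 < q" "q < 1"
  shows "((\<lambda>p. c * (1 / (1 - q / p) - 1 / (1 - q))) \<longlongrightarrow> 0) (at 1)"
proof -
  have "((\<lambda>p. c * (1 / (1 - q / p) - 1 / (1 - q))) \<longlongrightarrow> c * (1 / (1 - q / 1) - 1 / (1 - q))) (at 1)"
    using assms by (intro tendsto_intros) auto
  then show ?thesis by simp
qed

text \<open>The order of the choices matters: the admissible failure probability \<delta> = 1 / (l +
  1) fixes how close p must be to 1, this fixes \<open>B\<close> and the constant \<open>K\<close>,
  and then L is chosen for Markov's inequality. None of these depends on k.\<close>

lemma AE_spread:
  fixes n :: "nat \<Rightarrow> nat" and T :: "nat \<Rightarrow> nat \<Rightarrow> real^'d^'d" and \<mu> :: "(real^'d) measure"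
  assumes \<mu>: "prob_space \<mu>" "sets \<mu> = sets borel" and ac: "absolutely_continuous lborel \<mu>"
    and inv: "\<And>k i. 1 \<le> k \<Longrightarrow> i \<in> {1..n k} \<Longrightarrow> invertible (T k i)"
    and sv: "\<And>k i. 1 \<le> k \<Longrightarrow> i \<in> {1..n k} \<Longrightarrow> singular_value 1 (T k i) \<le> a"
    and a: "0 < a" "a < 1"
    and \<sigma>: "0 \<le> \<sigma>" "\<sigma> < s" "\<sigma> \<le> real CARD('d)"
    and pos: "net_measure n T s (infinite_words n) \<noteq> 0"
    and S: "\<And>k. finite (S k)" "\<And>k j. j \<in> S k \<Longrightarrow> 0 \<le> b k j" "\<And>k j. j \<in> S k \<Longrightarrow> a ^ k \<le> \<rho> k j"
    and K': "\<And>k. (\<Sum>j\<in>S k. b k j * \<rho> k j powr \<sigma>) \<le> K'"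
  shows "AE \<omega> in PiM (words n) (\<lambda>_. \<mu>). \<exists>c>0. \<exists>L. \<forall>m. \<exists>k\<ge>m. spread n T x0 k (S k) (b k) (\<rho> k) c L \<omega>"
proof -
  let ?P = "PiM (words n) (\<lambda>_. \<mu>)"
  interpret Pr: prob_space ?P by (intro prob_space_PiM \<mu>)
  obtain c where c: "0 < c" and "\<And>k. \<exists>w. (\<forall>u. 0 \<le> w u) \<and>
    (\<forall>j\<le>k. \<forall>y\<in>words_of_length n j. (\<Sum>u\<in>extensions n k y. w u) \<le> svf s (word_matrix T y)) \<and>
    c \<le> (\<Sum>u\<in>words_of_length n k. w u)"
    using frostman_flow[of n T s, OF inv _ pos] \<sigma> by auto
  then have "\<forall>k. \<exists>w. (\<forall>u. 0 \<le> w u) \<and>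
    (\<forall>j\<le>k. \<forall>y\<in>words_of_length n j. (\<Sum>u\<in>extensions n k y. w u) \<le> svf s (word_matrix T y)) \<and>
    c \<le> (\<Sum>u\<in>words_of_length n k. w u)" by blast
  from choice[OF this] obtain w where Hw: "\<And>k u. 0 \<le> w k u"
    "\<And>k j y. j \<le> k \<Longrightarrow> y \<in> words_of_length n j \<Longrightarrow> (\<Sum>u\<in>extensions n k y. w k u) \<le> svf s (word_matrix T y)"
    "\<And>k. c \<le> (\<Sum>u\<in>words_of_length n k. w k u)"
    by blast
  \<comment> \<open>The empty word has the identity as its matrix. Its capacity bounds the total
    mass, and with it the expected energy, uniformly in k.\<close>
  define c1 where "c1 = svf s (mat 1 :: real^'d^'d)"
  have c1: "(\<Sum>u\<in>words_of_length n k. w k u) \<le> c1" for k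
    using Hw(2)[of 0 k "[]"] by (simp add: extensions_Nil c1_def)
  have c1_pos: "0 < c1" using c Hw(3)[of 0] c1[of 0] by linarith
  have K'0: "0 \<le> K'"
    using K'[of 0] sum_nonneg[of "S 0" "\<lambda>j. b 0 j * \<rho> 0 j powr \<sigma>"] S(2)[of _ 0] by fastforce
  define q where "q = a powr s"
  define \<theta> where "\<theta> = a powr (s - \<sigma>)"
  have q: "0 < q" "q < 1" unfolding q_def using a \<sigma> by (auto simp: powr_def mult_pos_neg)
  have \<theta>: "\<theta> < 1" unfolding \<theta>_def using a \<sigma> by (auto simp: powr_def mult_pos_neg)
  have "\<exists>E L. (\<forall>k. E k \<in> sets ?P) \<and> (\<forall>k. \<forall>\<omega>\<in>E k. spread n T x0 k (S k) (b k) (\<rho> k) (c / 2) L \<omega>) \<and>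
      (\<forall>k. 1 - 1 / real (Suc l) \<le> measure ?P (E k))" for l
  proof -
    define \<delta> where "\<delta> = 1 / real (Suc l)"
    have \<delta>: "0 < \<delta>" by (simp add: \<delta>_def)
    have "eventually (\<lambda>p. 4 / c * (1 / (1 - q / p) - 1 / (1 - q)) < \<delta> / 2) (at 1)"
      using variance_bound_tendsto[OF q, of "4 / c"] \<delta> by (intro order_tendstoD) auto
    then obtain e where e: "0 < e"
      "\<And>p. p \<noteq> 1 \<Longrightarrow> dist p 1 < e \<Longrightarrow> 4 / c * (1 / (1 - q / p) - 1 / (1 - q)) < \<delta> / 2"
      unfolding eventually_at by blast
    \<comment> \<open>For p above 1 - e the variance bound is at most \<delta> / 2; for p above
      \<theta> the energy series converges.\<close>
    have "max (1 - e) \<theta> < 1" using e(1) \<theta> by simp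
    then obtain B m where HB: "B \<in> sets borel" "1 \<le> m" "B \<subseteq> cball 0 m" "max (1 - e) \<theta> < measure \<mu> B"
      "\<And>A. A \<in> sets borel \<Longrightarrow> A \<subseteq> B \<Longrightarrow> emeasure \<mu> A \<le> ennreal m * emeasure lborel A"
      by (rule bounded_density_set[OF \<mu> ac]) blast
    \<comment> \<open>m bounds the density and is also the radius R in
      \<open>emeasure_matrix_preimage_cball\<close>; 1 <= \<open>K\<close> is used for words paired
      with themselves.\<close>
    define K where "K = max 1 (m * (8 * m * real CARD('d)) ^ CARD('d))"
    interpret percolation n T \<mu> x0 B a K s \<sigma>
    proof (rule percolation.intro)
      show "1 \<le> K" by (simp add: K_def)
      fix k x z and r :: real assume x: "x \<in> words_of_length n k" and r: "0 < r"
      let ?W = "word_matrix T x"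
      have I: "invertible ?W" by (rule invertible_word_matrix[of n T, OF inv x])
      let ?A = "{t \<in> B. norm (?W *v t + z) \<le> r}"
      have "closed ((\<lambda>t. norm (?W *v t + z)) -` {..r})"
        by (intro closed_vimage closed_atMost continuous_intros linear_continuous_on
            linear_conv_bounded_linear[THEN iffD1]) auto
      moreover have "?A = B \<inter> (\<lambda>t. norm (?W *v t + z)) -` {..r}" by auto
      ultimately have A: "?A \<in> sets borel" using HB(1) by auto
      have nn: "0 \<le> r powr \<sigma> / svf \<sigma> ?W" using svf_pos[OF I \<sigma>(1)] by simp
      have "emeasure \<mu> ?A \<le> ennreal m * emeasure lborel ?A"
        by (rule HB(5)[OF A]) blast
      also have "\<dots> \<le> ennreal m * emeasure lborel {t. norm t \<le> m \<and> norm (?W *v t + z) \<le> r}"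
      proof (intro mult_left_mono emeasure_mono)
        have "closed {t. norm t \<le> m \<and> norm (?W *v t + z) \<le> r}"
          by (intro closed_Collect_conj closed_Collect_le continuous_intros linear_continuous_on
              linear_conv_bounded_linear[THEN iffD1]) auto
        then show "{t. norm t \<le> m \<and> norm (?W *v t + z) \<le> r} \<in> sets lborel" by simp
      qed (use HB(3) in auto)
      also have "\<dots> \<le> ennreal m * ennreal ((8 * m * real CARD('d)) ^ CARD('d) * (r powr \<sigma> / svf \<sigma> ?W))"
        by (intro mult_left_mono emeasure_matrix_preimage_cball I \<sigma> r HB(2)) simp
      also have "\<dots> = ennreal (m * (8 * m * real CARD('d)) ^ CARD('d) * (r powr \<sigma> / svf \<sigma> ?W))"
        using HB(2) by (subst ennreal_mult'[symmetric]) (auto simp only: mult.assoc)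
      also have "\<dots> \<le> ennreal (K * (r powr \<sigma> / svf \<sigma> ?W))"
        using nn by (intro ennreal_leI mult_right_mono) (auto simp: K_def)
      finally show "emeasure \<mu> ?A \<le> ennreal (K * (r powr \<sigma> / svf \<sigma> ?W))" .
    next
      show "prob_space \<mu>" "sets \<mu> = sets borel" "B \<in> sets borel"
        by (rule \<mu>, rule \<mu>, rule HB)
      show "invertible (T k i)" "singular_value 1 (T k i) \<le> a" if "1 \<le> k" "i \<in> {1..n k}" for k i
        by (rule inv[OF that], rule sv[OF that])
      show "0 < a" "a < 1" "0 \<le> \<sigma>" "\<sigma> < s" "\<sigma> \<le> real CARD('d)"
        by (rule a, rule a, rule \<sigma>, rule \<sigma>, rule \<sigma>)
      show "a powr (s - \<sigma>) < measure \<mu> B" using HB(4) by (simp add: \<theta>_def)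
    qed
    \<comment> \<open>The limit at 1 says nothing about p = 1 itself, where the bound is 0.\<close>
    have V: "4 / c * (1 / (1 - q / p) - 1 / (1 - q)) \<le> \<delta> / 2"
    proof (cases "p = 1")
      case True
      then show ?thesis using \<delta> by simp
    next
      case False
      have "dist p 1 < e" using HB(4) p_bounds(2) by (simp add: p_def dist_real_def)
      then show ?thesis using e(2)[OF False] by simp
    qed
    define K2 where "K2 = K / p / (1 - \<theta> / p)"
    have K2: "0 \<le> K2"
      unfolding K2_def \<theta>_def using p_bounds(3) by (intro divide_nonneg_nonneg) (auto simp: K_def)
    \<comment> \<open>Makes the Markov term at most \<delta> / 2; the summand 1 keeps L positive
      when the numerator vanishes.\<close>
    define L where "L = 2 * (c1 * K2 * K') / \<delta> + 1"
    have nn: "0 \<le> c1 * K2 * K'" using c1_pos K2 K'0 by (intro mult_nonneg_nonneg) auto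
    then have L: "0 < L" unfolding L_def using \<delta> by (intro add_nonneg_pos divide_nonneg_pos) auto
    have "\<exists>E. E \<in> sets ?P \<and> (\<forall>\<omega>\<in>E. spread n T x0 k (S k) (b k) (\<rho> k) (c / 2) L \<omega>) \<and> 1 - \<delta> \<le> measure ?P E" for k
    proof -
      interpret percolation_level n T \<mu> x0 B a K s \<sigma> k "w k"
        by unfold_locales (use Hw in auto)
      obtain E where E: "E \<in> sets ?P" "\<And>\<omega>. \<omega> \<in> E \<Longrightarrow> spread n T x0 k (S k) (b k) (\<rho> k) (c / 2) L \<omega>"
        "1 - 4 / c * (1 / (1 - a powr s / p) - 1 / (1 - a powr s))
        - C * (K / p / (1 - a powr (s - \<sigma>) / p)) * K' / L \<le> measure ?P E"
        by (rule spread_event[OF S(1)[of k] S(2)[of _ k] S(3)[of _ k] K'[of k] L c])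
          (use Hw(3)[of k] in \<open>auto simp: C_def\<close>)
      have "C * K2 * K' / L \<le> c1 * K2 * K' / L"
        using c1[of k] K2 K'0 L by (intro divide_right_mono mult_right_mono) (auto simp: C_def)
      also have "\<dots> \<le> \<delta> / 2"
      proof -
        have "c1 * K2 * K' \<le> \<delta> / 2 * L"
          unfolding L_def using \<delta> by (simp add: field_simps)
        then show ?thesis using L by (simp add: field_simps)
      qed
      finally have "1 - \<delta> \<le> measure ?P E"
        using E(3) V unfolding q_def[symmetric] \<theta>_def[symmetric] K2_def[symmetric] by linarith
      with E(1,2) show ?thesis by blast
    qed
    then have "\<forall>k. \<exists>E. E \<in> sets ?P \<and> (\<forall>\<omega>\<in>E. spread n T x0 k (S k) (b k) (\<rho> k) (c / 2) L \<omega>) \<and> 1 - \<delta> \<le> measure ?P E"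
      by blast
    from choice[OF this] show ?thesis unfolding \<delta>_def by blast
  qed
  then have "\<forall>l. \<exists>E L. (\<forall>k. E k \<in> sets ?P) \<and> (\<forall>k. \<forall>\<omega>\<in>E k. spread n T x0 k (S k) (b k) (\<rho> k) (c / 2) L \<omega>) \<and>
      (\<forall>k. 1 - 1 / real (Suc l) \<le> measure ?P (E k))" by blast
  from choice[OF this] obtain E where E: "\<forall>l. \<exists>L. (\<forall>k. E l k \<in> sets ?P) \<and>
    (\<forall>k. \<forall>\<omega>\<in>E l k. spread n T x0 k (S k) (b k) (\<rho> k) (c / 2) L \<omega>) \<and>
    (\<forall>k. 1 - 1 / real (Suc l) \<le> measure ?P (E l k))" ..
  from choice[OF this] obtain L where EL: "\<forall>l. (\<forall>k. E l k \<in> sets ?P) \<and>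
    (\<forall>k. \<forall>\<omega>\<in>E l k. spread n T x0 k (S k) (b k) (\<rho> k) (c / 2) (L l) \<omega>) \<and>
    (\<forall>k. 1 - 1 / real (Suc l) \<le> measure ?P (E l k))" ..
  have "AE \<omega> in ?P. \<exists>l. \<forall>m. \<exists>k\<ge>m. \<omega> \<in> E l k"
    using EL by (intro Pr.AE_frequently) auto
  then show ?thesis
  proof eventually_elim
    case (elim \<omega>)
    then obtain l where l: "\<forall>m. \<exists>k\<ge>m. \<omega> \<in> E l k" ..
    have "\<forall>m. \<exists>k\<ge>m. spread n T x0 k (S k) (b k) (\<rho> k) (c / 2) (L l) \<omega>"
      using l EL by meson
    moreover have "0 < c / 2" using c by simp
    ultimately show ?case by blast
  qed
qed

section \<open>Lower bound for the Hausdorff measure\<close>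

definition level ::
  "(nat \<Rightarrow> nat) \<Rightarrow> (nat \<Rightarrow> nat \<Rightarrow> real^'d^'d) \<Rightarrow> (real^'d) set \<Rightarrow> (nat list \<Rightarrow> real^'d) \<Rightarrow> nat \<Rightarrow> (real^'d) set" where
  "level n T J \<omega> k = (\<Union>u\<in>words_of_length n k. basic_set T J \<omega> u)"

lemma affine_set_eq: "affine_set n T J \<omega> = (\<Inter>k\<in>{1..}. level n T J \<omega> k)"
  by (simp add: affine_set_def level_def)

lemma compact_level:
  assumes "compact J"
  shows "compact (level n T J \<omega> k)"
proof -
  have "compact (basic_set T J \<omega> u)" for u
    unfolding basic_set_eq proj_def
    by (intro compact_continuous_image continuous_intros linear_continuous_on
        linear_conv_bounded_linear[THEN iffD1] assms) auto
  then show ?thesis unfolding level_def by (intro compact_UN) auto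
qed

lemma nonautonomous_structure_snoc:
  assumes "nonautonomous_structure n T J \<omega>" "u @ [i] \<in> words_of_length n (Suc k)"
  shows "basic_set T J \<omega> (u @ [i]) \<subseteq> basic_set T J \<omega> u"
proof -
  have "u \<in> words_of_length n (Suc k - 1)" "i \<in> {1..n (Suc k)}"
    using assms(2) by (auto simp: snoc_in_words_of_length_iff)
  then show ?thesis using assms(1) unfolding nonautonomous_structure_def by (metis le_add1 plus_1_eq_Suc)
qed

lemma basic_set_take_subset:
  assumes ns: "nonautonomous_structure n T J \<omega>"
  shows "u \<in> words_of_length n k \<Longrightarrow> basic_set T J \<omega> u \<subseteq> basic_set T J \<omega> (take j u)"
proof (induction u arbitrary: k rule: rev_induct)
  case (snoc i u)
  then obtain l where k: "k = Suc l" by (cases k) (auto simp: words_of_length_def)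
  have u: "u \<in> words_of_length n l" using snoc.prems by (simp add: k snoc_in_words_of_length_iff)
  have 1: "basic_set T J \<omega> (u @ [i]) \<subseteq> basic_set T J \<omega> u"
    using nonautonomous_structure_snoc[OF ns] snoc.prems k by blast
  show ?case
  proof (cases "j \<le> length u")
    case True
    then show ?thesis using 1 snoc.IH[OF u] by simp
  next
    case False
    then show ?thesis by simp
  qed
qed simp

lemma level_antimono:
  assumes ns: "nonautonomous_structure n T J \<omega>" and jk: "j \<le> k"
  shows "level n T J \<omega> k \<subseteq> level n T J \<omega> j"
proof
  fix x assume "x \<in> level n T J \<omega> k"
  then obtain u where u: "u \<in> words_of_length n k" "x \<in> basic_set T J \<omega> u" by (auto simp: level_def)
  then have "x \<in> basic_set T J \<omega> (take j u)" using basic_set_take_subset[OF ns] by blast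
  then show "x \<in> level n T J \<omega> j"
    using take_in_words_of_length[OF u(1) jk] by (auto simp: level_def)
qed

text \<open>The parts of the levels outside U are decreasing compact sets with empty intersection,
  so one of them is empty. In this way open sets around the limit set catch the masses of all late
  levels.\<close>

lemma level_subset_open:
  assumes J: "compact J" and ns: "nonautonomous_structure n T J \<omega>"
    and U: "open U" "affine_set n T J \<omega> \<subseteq> U"
  obtains m where "\<And>k. m \<le> k \<Longrightarrow> level n T J \<omega> k \<subseteq> U"
proof -
  have "\<exists>m. level n T J \<omega> (Suc m) \<subseteq> U"
  proof (rule ccontr)
    assume H: "\<nexists>m. level n T J \<omega> (Suc m) \<subseteq> U"
    have "\<Inter>(range (\<lambda>m. level n T J \<omega> (Suc m) - U)) \<noteq> {}"
    proof (rule compact_nest)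
      show "compact (level n T J \<omega> (Suc m) - U)" for m
        by (intro compact_diff compact_level J U)
      show "level n T J \<omega> (Suc m) - U \<noteq> {}" for m using H by blast
      show "level n T J \<omega> (Suc m) - U \<subseteq> level n T J \<omega> (Suc j) - U" if "j \<le> m" for j m
        using level_antimono[OF ns, of "Suc j" "Suc m"] that by auto
    qed
    then obtain x where x: "\<And>m. x \<in> level n T J \<omega> (Suc m)" "x \<notin> U" by blast
    have "x \<in> level n T J \<omega> k" if "k \<in> {1..}" for k
      using x(1)[of "k - 1"] that by simp
    then have "x \<in> affine_set n T J \<omega>" by (simp add: affine_set_eq)
    then show False using U x(2) by blast
  qed
  then obtain m where "level n T J \<omega> (Suc m) \<subseteq> U" ..
  then show thesis
    using that[of "Suc m"] level_antimono[OF ns] by (meson subset_trans)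
qed

lemma proj_in_level:
  "x0 \<in> J \<Longrightarrow> u \<in> words_of_length n k \<Longrightarrow> proj T x0 \<omega> u \<in> level n T J \<omega> k"
  by (auto simp: level_def basic_set_eq)

lemma compact_affine_set: "compact J \<Longrightarrow> compact (affine_set n T J \<omega>)"
  unfolding affine_set_eq by (rule compact_Inter) (auto intro: compact_level)

text \<open>A cell \<open>i\<close> has dyadic scale \<open>s i\<close>; its pairs are counted by \<open>pair_mass\<close> at that scale.\<close>

lemma mass_square_le_energy:
  fixes w :: "'u \<Rightarrow> real" and x :: "'u \<Rightarrow> 'a::real_normed_vector" and s :: "'i \<Rightarrow> nat"
  assumes W: "finite W" and w: "\<And>u. 0 \<le> w u" and I: "finite I" and S: "finite S"
    and b: "\<And>j. 0 < b j" and \<iota>: "\<And>u. u \<in> W \<Longrightarrow> \<iota> u \<in> I" and sI: "\<And>i. i \<in> I \<Longrightarrow> s i \<in> S"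
    and near: "\<And>u v. u \<in> W \<Longrightarrow> v \<in> W \<Longrightarrow> \<iota> u = \<iota> v \<Longrightarrow> norm (x u - x v) \<le> \<rho> (s (\<iota> u))"
    and L: "(\<Sum>j\<in>S. b j * (\<Sum>u\<in>W. \<Sum>v\<in>W. w u * w v * (if norm (x u - x v) \<le> \<rho> j then 1 else 0))) \<le> L"
  shows "(\<Sum>u\<in>W. w u)\<^sup>2 \<le> L * (\<Sum>i\<in>I. 1 / b (s i))"
proof -
  let ?e = "\<lambda>u i. if \<iota> u = i then 1 else 0 :: real"
  define M where "M = (\<lambda>i. \<Sum>u\<in>W. w u * ?e u i)"
  have "(\<Sum>i\<in>I. M i) = (\<Sum>u\<in>W. w u * (\<Sum>i\<in>I. ?e u i))"
    unfolding M_def by (subst sum.swap) (simp add: sum_distrib_left)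
  also have "\<dots> = (\<Sum>u\<in>W. w u)"
    using \<iota> I by (intro sum.cong) (auto simp: sum.delta)
  finally have sumM: "(\<Sum>i\<in>I. M i) = (\<Sum>u\<in>W. w u)" .
  have "(M i)\<^sup>2 = (\<Sum>u\<in>W. \<Sum>v\<in>W. (w u * ?e u i) * (w v * ?e v i))" for i
    by (simp only: M_def power2_eq_square sum_product)
  then have "(\<Sum>i\<in>I. b (s i) * (M i)\<^sup>2) = (\<Sum>i\<in>I. \<Sum>u\<in>W. \<Sum>v\<in>W. b (s i) * ((w u * ?e u i) * (w v * ?e v i)))"
    by (simp only: sum_distrib_left)
  also have "\<dots> = (\<Sum>i\<in>I. \<Sum>u\<in>W. \<Sum>v\<in>W. w u * w v * (b (s i) * ?e u i * ?e v i))"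
    by (simp only: mult_ac)
  also have "\<dots> = (\<Sum>u\<in>W. \<Sum>v\<in>W. \<Sum>i\<in>I. w u * w v * (b (s i) * ?e u i * ?e v i))"
    by (subst sum.swap, rule sum.cong[OF refl], rule sum.swap)
  \<comment> \<open>A pair in one cell contributes b at the scale of that cell, and by
    \<open>near\<close> it is counted on the right at this scale; a pair in different cells
    contributes 0.\<close>
  also have "\<dots> \<le> (\<Sum>u\<in>W. \<Sum>v\<in>W. \<Sum>j\<in>S. w u * w v * (b j * (if norm (x u - x v) \<le> \<rho> j then 1 else 0)))"
  proof (intro sum_mono)
    fix u v assume uv: "u \<in> W" "v \<in> W"
    have ww: "0 \<le> w u * w v" using w by simp
    let ?g = "\<lambda>j. w u * w v * (b j * (if norm (x u - x v) \<le> \<rho> j then 1 else 0))"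
    have g: "0 \<le> ?g j" for j using ww b[of j] by simp
    show "(\<Sum>i\<in>I. w u * w v * (b (s i) * ?e u i * ?e v i)) \<le> (\<Sum>j\<in>S. ?g j)"
    proof (cases "\<iota> u = \<iota> v")
      case True
      have "(\<Sum>i\<in>I. w u * w v * (b (s i) * ?e u i * ?e v i)) =
          (\<Sum>i\<in>I. if \<iota> u = i then w u * w v * b (s i) else 0)"
        using True by (intro sum.cong) auto
      also have "\<dots> = w u * w v * b (s (\<iota> u))"
        using I \<iota>[OF uv(1)] by (simp add: sum.delta')
      also have "\<dots> = ?g (s (\<iota> u))" using near[OF uv True] by simp
      also have "\<dots> \<le> (\<Sum>j\<in>S. ?g j)"
        using S sI[OF \<iota>[OF uv(1)]] g by (intro member_le_sum) auto
      finally show ?thesis .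
    next
      case False
      have "(\<Sum>i\<in>I. w u * w v * (b (s i) * ?e u i * ?e v i)) = 0"
        using False by (intro sum.neutral) auto
      then show ?thesis using g by (simp add: sum_nonneg)
    qed
  qed
  also have "\<dots> = (\<Sum>u\<in>W. \<Sum>j\<in>S. \<Sum>v\<in>W. w u * w v * (b j * (if norm (x u - x v) \<le> \<rho> j then 1 else 0)))"
    by (rule sum.cong[OF refl], rule sum.swap)
  also have "\<dots> = (\<Sum>j\<in>S. \<Sum>u\<in>W. \<Sum>v\<in>W. w u * w v * (b j * (if norm (x u - x v) \<le> \<rho> j then 1 else 0)))"
    by (rule sum.swap)
  also have "\<dots> = (\<Sum>j\<in>S. b j * (\<Sum>u\<in>W. \<Sum>v\<in>W. w u * w v * (if norm (x u - x v) \<le> \<rho> j then 1 else 0)))"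
    by (simp only: sum_distrib_left mult_ac)
  finally have E: "(\<Sum>i\<in>I. b (s i) * (M i)\<^sup>2) \<le> L" using L by linarith
  \<comment> \<open>Cauchy-Schwarz over the cells, with the weights sqrt b and 1 / sqrt b.\<close>
  have bs: "0 < sqrt (b (s i))" for i using b by simp
  have "(\<Sum>i\<in>I. M i) = (\<Sum>i\<in>I. (sqrt (b (s i)) * M i) * (1 / sqrt (b (s i))))"
    using bs by (intro sum.cong) (auto simp: less_le)
  then have "(\<Sum>i\<in>I. M i)\<^sup>2 \<le> (\<Sum>i\<in>I. (sqrt (b (s i)) * M i)\<^sup>2) * (\<Sum>i\<in>I. (1 / sqrt (b (s i)))\<^sup>2)"
    by (simp only: Cauchy_Schwarz_ineq_sum)
  also have "\<dots> = (\<Sum>i\<in>I. b (s i) * (M i)\<^sup>2) * (\<Sum>i\<in>I. 1 / b (s i))"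
    using b by (simp add: power_mult_distrib power_divide less_imp_le)
  also have "\<dots> \<le> L * (\<Sum>i\<in>I. 1 / b (s i))"
    using E b by (intro mult_right_mono sum_nonneg) (auto simp: less_imp_le)
  finally show ?thesis by (simp add: sumM)
qed

lemma dyadic_scale:
  fixes e :: real
  assumes "0 < e" "e \<le> 1"
  obtains j :: nat where "e \<le> (1/2) ^ j" "(1/2) ^ j \<le> 2 * e"
proof -
  have "\<exists>j. (1/2 :: real) ^ Suc j < e"
  proof -
    obtain m where "(1/2 :: real) ^ m < e" using real_arch_pow_inv[of e "1/2"] assms by auto
    moreover have "(1/2 :: real) ^ Suc m \<le> (1/2) ^ m" by (rule power_decreasing) auto
    ultimately have "(1/2 :: real) ^ Suc m < e" by linarith
    then show ?thesis ..
  qed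
  define j where "j = (LEAST j. (1/2 :: real) ^ Suc j < e)"
  have 1: "(1/2 :: real) ^ Suc j < e" unfolding j_def by (rule LeastI_ex) fact
  have 2: "e \<le> (1/2) ^ j"
  proof (cases j)
    case (Suc l)
    then have "\<not> (1/2 :: real) ^ Suc l < e" using not_less_Least[of l "\<lambda>j. (1/2 :: real) ^ Suc j < e"] by (simp add: j_def)
    then show ?thesis by (simp add: Suc)
  qed (use assms in simp)
  show thesis using that[of j] 1 2 by simp
qed

lemma finite_dyadic_scales: "0 < r \<Longrightarrow> finite {j :: nat. r \<le> (1/2 :: real) ^ j}"
proof -
  assume "0 < r"
  then obtain m where m: "(1/2 :: real) ^ m < r" using real_arch_pow_inv[of r "1/2"] by auto
  have "j \<le> m" if "r \<le> (1/2 :: real) ^ j" for j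
  proof (rule ccontr)
    assume "\<not> j \<le> m"
    then have "(1/2 :: real) ^ j \<le> (1/2) ^ m" by (intro power_decreasing) auto
    then show False using that m by linarith
  qed
  then have "{j :: nat. r \<le> (1/2 :: real) ^ j} \<subseteq> {..m}" by auto
  then show ?thesis by (rule finite_subset) simp
qed

text \<open>For diameters at most 1 a smaller exponent gives a larger power; the case t' = 0 relies
  on the value 1 that \<open>diam_power\<close> gives to nonempty sets.\<close>

lemma diameter_powr_le_diam_power:
  assumes "bounded U" "diameter U \<le> 1" "0 \<le> t'" "t' \<le> t" "0 < t"
  shows "diameter U powr t \<le> diam_power t' U"
proof -
  have d: "0 \<le> diameter U" using assms(1) by (rule diameter_ge_0)
  show ?thesis
  proof (cases "t' = 0")
    case True
    then show ?thesis using assms d by (auto simp: diam_power_def intro!: powr_le1)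
  next
    case False
    then show ?thesis using assms d
      by (cases "diameter U = 0") (auto simp: diam_power_def intro!: powr_mono')
  qed
qed

lemma hausdorff_measure_eq_0_cover:
  assumes "hausdorff_measure t' A = 0" "0 < \<delta>" "0 < \<eta>"
  obtains U where "\<And>i::nat. bounded (U i)" "\<And>i. diameter (U i) \<le> \<delta>" "A \<subseteq> (\<Union>i. U i)"
    "(\<Sum>i. ennreal (diam_power t' (U i))) < ennreal \<eta>"
proof -
  have "hausdorff_premeasure t' \<delta> A \<le> hausdorff_measure t' A"
    unfolding hausdorff_measure_def using assms by (intro SUP_upper) auto
  then have "hausdorff_premeasure t' \<delta> A < ennreal \<eta>" using assms by simp
  then show thesis
    unfolding hausdorff_premeasure_def INF_less_iff using that by blast
qed

text \<open>The energy form of the mass distribution principle, by contradiction. A cheap cover of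
  the limit set is fattened to an open one, a finite part of which contains all late levels. Each
  projected word is assigned to one of its sets, and the energy bound forces the total mass below c.
  Treating all t' up to t at once replaces monotonicity of the Hausdorff measure in the
  exponent.\<close>

lemma hausdorff_measure_nonzero:
  fixes a c L t t' :: real
  assumes J: "compact J" "x0 \<in> J" and ns: "nonautonomous_structure n T J \<omega>"
    and a: "0 < a" "a < 1" and t: "0 \<le> t'" "t' \<le> t" "0 < t"
    and sp: "0 < c" "\<And>m. \<exists>k\<ge>m. spread n T x0 k {j. a ^ k \<le> (1/2) ^ j} (\<lambda>j. ((1/2) ^ j) powr - t) (\<lambda>j. (1/2) ^ j) c L \<omega>"
  shows "hausdorff_measure t' (affine_set n T J \<omega>) \<noteq> 0"
proof
  assume H0: "hausdorff_measure t' (affine_set n T J \<omega>) = 0"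
  define L' where "L' = max L 1"
  have L': "0 < L'" by (simp add: L'_def)
  \<comment> \<open>8^t accounts for the fattening (factor 4) and the rounding to dyadic scales
    (factor 2); the sum over the fattened sets is at most 3 \<eta>, and the remaining factor 2
    yields the contradiction.\<close>
  define \<eta> where "\<eta> = c\<^sup>2 / (L' * 8 powr t * 6)"
  have \<eta>: "0 < \<eta>" using sp(1) L' by (simp add: \<eta>_def)
  \<comment> \<open>Diameters at most 1/4 keep 4 * e i at most 1, the range of the dyadic
    scales.\<close>
  obtain U where U: "\<And>i::nat. bounded (U i)" "\<And>i. diameter (U i) \<le> 1/4" "affine_set n T J \<omega> \<subseteq> (\<Union>i. U i)"
    "(\<Sum>i. ennreal (diam_power t' (U i))) < ennreal \<eta>"
    by (rule hausdorff_measure_eq_0_cover[OF H0 _ \<eta>, of "1/4"]) auto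
  \<comment> \<open>A positive lower bound for the radii, needed for sets of diameter 0; its powers
    add at most 2 \<eta> to the sum.\<close>
  define \<epsilon> where "\<epsilon> = (\<lambda>i::nat. min (1/4) ((\<eta> * (1/2) ^ i) powr (1 / t)))"
  have \<epsilon>: "0 < \<epsilon> i" "\<epsilon> i \<le> 1/4" for i using \<eta> by (auto simp: \<epsilon>_def)
  have \<epsilon>t: "\<epsilon> i powr t \<le> \<eta> * (1/2) ^ i" for i
  proof -
    have "\<epsilon> i powr t \<le> ((\<eta> * (1/2) ^ i) powr (1 / t)) powr t"
      using \<epsilon>(1)[of i] t by (intro powr_mono2) (auto simp: \<epsilon>_def)
    also have "\<dots> = \<eta> * (1/2) ^ i" using t \<eta> by (simp add: powr_powr)
    finally show ?thesis .
  qed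
  define e where "e = (\<lambda>i. max (diameter (U i)) (\<epsilon> i))"
  have e: "0 < e i" "e i \<le> 1/4" "diameter (U i) \<le> e i" for i
    using \<epsilon>[of i] U(2)[of i] by (auto simp: e_def)
  have et: "e i powr t \<le> diam_power t' (U i) + \<eta> * (1/2) ^ i" for i
  proof -
    have 1: "diameter (U i) powr t \<le> diam_power t' (U i)"
      using U(1,2)[of i] t by (intro diameter_powr_le_diam_power) auto
    have 2: "0 \<le> \<eta> * (1/2) ^ i" "0 \<le> diam_power t' (U i)" using \<eta> by (auto simp: diam_power_def)
    show ?thesis unfolding e_def max_def using 1 2 \<epsilon>t[of i] by auto
  qed
  define V where "V = (\<lambda>i. \<Union>x\<in>U i. ball x (e i))"
  have V: "open (V i)" "U i \<subseteq> V i" for i using e by (auto simp: V_def)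
  have Vd: "norm (x - y) \<le> 4 * e i" if xy: "x \<in> V i" "y \<in> V i" for x y i
  proof -
    obtain x' y' where x': "x' \<in> U i" "dist x' x < e i" and y': "y' \<in> U i" "dist y' y < e i"
      using xy by (auto simp: V_def)
    have "dist x' y' \<le> e i"
      using diameter_bounded_bound[OF U(1) x'(1) y'(1)] e(3)[of i] by linarith
    moreover have "dist x y \<le> dist x' x + dist x' y' + dist y' y"
      using dist_triangle[of x y x'] dist_triangle[of x' y y'] by (simp add: dist_commute)
    ultimately show ?thesis using x' y' e(1)[of i] by (simp add: dist_norm[symmetric])
  qed
  have "\<forall>i. \<exists>j::nat. 4 * e i \<le> (1/2) ^ j \<and> (1/2) ^ j \<le> 2 * (4 * e i)"
  proof
    fix i
    have "0 < 4 * e i" "4 * e i \<le> 1" using e(1,2)[of i] by auto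
    then show "\<exists>j::nat. 4 * e i \<le> (1/2) ^ j \<and> (1/2) ^ j \<le> 2 * (4 * e i)"
      by (rule dyadic_scale) blast
  qed
  from choice[OF this] obtain s where s: "\<And>i. 4 * e i \<le> (1/2) ^ (s i)" "\<And>i. (1/2) ^ (s i) \<le> 8 * e i"
    by auto
  have "(\<Union>i. U i) \<subseteq> (\<Union>i. V i)" using V(2) by (intro UN_mono) auto
  with U(3) have "affine_set n T J \<omega> \<subseteq> (\<Union>i\<in>UNIV. V i)" by (rule subset_trans)
  from compactE_image[OF compact_affine_set[OF J(1)] V(1) this]
  obtain I where I: "finite I" "affine_set n T J \<omega> \<subseteq> (\<Union>i\<in>I. V i)" by metis
  have oV: "open (\<Union>i\<in>I. V i)" using V(1) by blast
  obtain m1 where m1: "\<And>k. m1 \<le> k \<Longrightarrow> level n T J \<omega> k \<subseteq> (\<Union>i\<in>I. V i)"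
    by (rule level_subset_open[OF J(1) ns oV I(2)]) blast
  \<comment> \<open>The finitely many scales in use must be at least a^k in order to occur in the
    sum of \<open>spread\<close>.\<close>
  have "\<exists>m2. \<forall>k\<ge>m2. \<forall>i\<in>I. a ^ k \<le> (1/2) ^ (s i)"
  proof -
    have "\<forall>i\<in>I. eventually (\<lambda>k. a ^ k \<le> (1/2) ^ (s i)) sequentially"
    proof
      fix i
      have "(\<lambda>k. a ^ k) \<longlonglongrightarrow> 0" using a by (intro LIMSEQ_power_zero) simp
      then have "eventually (\<lambda>k. a ^ k < (1/2) ^ (s i)) sequentially" by (rule order_tendstoD) simp
      then show "eventually (\<lambda>k. a ^ k \<le> (1/2) ^ (s i)) sequentially"
        by (rule eventually_mono) simp
    qed
    then have "eventually (\<lambda>k. \<forall>i\<in>I. a ^ k \<le> (1/2) ^ (s i)) sequentially"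
      using I(1) by (simp add: eventually_ball_finite)
    then show ?thesis by (simp add: eventually_sequentially)
  qed
  then obtain m2 where m2: "\<And>k i. m2 \<le> k \<Longrightarrow> i \<in> I \<Longrightarrow> a ^ k \<le> (1/2) ^ (s i)" by blast
  let ?S = "\<lambda>k. {j. a ^ k \<le> (1/2 :: real) ^ j}"
  obtain k where k: "max m1 m2 \<le> k"
    "spread n T x0 k (?S k) (\<lambda>j. ((1/2) ^ j) powr - t) (\<lambda>j. (1/2) ^ j) c L \<omega>"
    using sp(2) by blast
  from k(2) obtain \<nu> where \<nu>: "\<And>u. 0 \<le> \<nu> u" "c \<le> (\<Sum>u\<in>words_of_length n k. \<nu> u)"
    "(\<Sum>j\<in>?S k. ((1/2) ^ j) powr - t * pair_mass n T x0 k \<nu> ((1/2) ^ j) \<omega>) \<le> L"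
    unfolding spread_def by blast
  have "\<forall>u\<in>words_of_length n k. \<exists>i. i \<in> I \<and> proj T x0 \<omega> u \<in> V i"
  proof
    fix u assume "u \<in> words_of_length n k"
    then have "proj T x0 \<omega> u \<in> level n T J \<omega> k" by (rule proj_in_level[OF J(2)])
    moreover have "level n T J \<omega> k \<subseteq> (\<Union>i\<in>I. V i)" using m1 k(1) by simp
    ultimately have "proj T x0 \<omega> u \<in> (\<Union>i\<in>I. V i)" by (rule subsetD[rotated])
    then show "\<exists>i. i \<in> I \<and> proj T x0 \<omega> u \<in> V i" by (simp add: Bex_def)
  qed
  from bchoice[OF this] obtain \<iota> where \<iota>: "\<And>u. u \<in> words_of_length n k \<Longrightarrow> \<iota> u \<in> I"
    "\<And>u. u \<in> words_of_length n k \<Longrightarrow> proj T x0 \<omega> u \<in> V (\<iota> u)" by blast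
  have "(\<Sum>u\<in>words_of_length n k. \<nu> u)\<^sup>2 \<le> L * (\<Sum>i\<in>I. 1 / ((1/2) ^ (s i)) powr - t)"
  proof (rule mass_square_le_energy)
    show "finite (?S k)" using a by (intro finite_dyadic_scales) simp
    show "0 < ((1/2 :: real) ^ j) powr - t" for j :: nat by simp
    show "s i \<in> ?S k" if "i \<in> I" for i using m2[of k i] k(1) that by simp
    show "norm (proj T x0 \<omega> u - proj T x0 \<omega> v) \<le> (1/2) ^ s (\<iota> u)"
      if "u \<in> words_of_length n k" "v \<in> words_of_length n k" "\<iota> u = \<iota> v" for u v
    proof -
      have "norm (proj T x0 \<omega> u - proj T x0 \<omega> v) \<le> 4 * e (\<iota> u)"
        using Vd[OF \<iota>(2)[OF that(1)]] \<iota>(2)[OF that(2)] that(3) by simp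
      then show ?thesis using s(1)[of "\<iota> u"] by linarith
    qed
    show "(\<Sum>j\<in>?S k. ((1/2) ^ j) powr - t * (\<Sum>u\<in>words_of_length n k. \<Sum>v\<in>words_of_length n k.
      \<nu> u * \<nu> v * (if norm (proj T x0 \<omega> u - proj T x0 \<omega> v) \<le> (1/2) ^ j then 1 else 0))) \<le> L"
      using \<nu>(3) unfolding pair_mass_def .
  qed (use I \<nu> \<iota> in auto)
  also have "\<dots> \<le> L' * (\<Sum>i\<in>I. 8 powr t * e i powr t)"
  proof (rule mult_mono)
    show "(\<Sum>i\<in>I. 1 / ((1/2) ^ (s i)) powr - t) \<le> (\<Sum>i\<in>I. 8 powr t * e i powr t)"
    proof (rule sum_mono)
      fix i
      have "1 / ((1/2 :: real) ^ (s i)) powr - t = ((1/2) ^ (s i)) powr t"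
        by (simp add: powr_minus_divide)
      also have "\<dots> \<le> (8 * e i) powr t" using s(2)[of i] t by (intro powr_mono2) auto
      also have "\<dots> = 8 powr t * e i powr t" using e(1)[of i] by (simp add: powr_mult)
      finally show "1 / ((1/2) ^ (s i)) powr - t \<le> 8 powr t * e i powr t" .
    qed
  qed (auto simp: L'_def intro!: sum_nonneg)
  also have "\<dots> = L' * 8 powr t * (\<Sum>i\<in>I. e i powr t)" by (simp add: sum_distrib_left mult.assoc)
  also have "\<dots> \<le> L' * 8 powr t * (3 * \<eta>)"
  proof (intro mult_left_mono)
    have dn: "0 \<le> diam_power t' (U i)" for i by (simp add: diam_power_def)
    have fin: "(\<Sum>i. ennreal (diam_power t' (U i))) < \<infinity>"
      using U(4) by (rule less_trans) simp
    have "ennreal (\<Sum>i\<in>I. diam_power t' (U i)) = (\<Sum>i\<in>I. ennreal (diam_power t' (U i)))"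
      using dn by (simp add: sum_ennreal)
    also have "\<dots> \<le> (\<Sum>i. ennreal (diam_power t' (U i)))"
      by (rule sum_le_suminf) (auto simp: I(1))
    also have "\<dots> < ennreal \<eta>" by (rule U(4))
    finally have 1: "(\<Sum>i\<in>I. diam_power t' (U i)) \<le> \<eta>"
      using dn \<eta> by (simp add: ennreal_less_iff sum_nonneg)
    have geo: "(\<lambda>i. (1/2 :: real) ^ i) sums 2" using geometric_sums[of "1/2 :: real"] by simp
    have "(\<Sum>i\<in>I. (1/2 :: real) ^ i) \<le> suminf (\<lambda>i. (1/2) ^ i)"
      by (rule sum_le_suminf[OF sums_summable[OF geo] I(1)]) simp
    then have 2: "(\<Sum>i\<in>I. (1/2 :: real) ^ i) \<le> 2" using sums_unique[OF geo] by linarith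
    have "(\<Sum>i\<in>I. e i powr t) \<le> (\<Sum>i\<in>I. diam_power t' (U i) + \<eta> * (1/2) ^ i)"
      by (intro sum_mono et)
    also have "\<dots> = (\<Sum>i\<in>I. diam_power t' (U i)) + \<eta> * (\<Sum>i\<in>I. (1/2) ^ i)"
      by (simp only: sum.distrib sum_distrib_left)
    also have "\<dots> \<le> \<eta> + \<eta> * 2" using 1 2 \<eta> by (intro add_mono mult_left_mono) auto
    finally show "(\<Sum>i\<in>I. e i powr t) \<le> 3 * \<eta>" by simp
  qed (use L' in simp)
  also have "\<dots> = c\<^sup>2 / 2" using L' by (simp add: \<eta>_def)
  finally have "(\<Sum>u\<in>words_of_length n k. \<nu> u)\<^sup>2 \<le> c\<^sup>2 / 2" .
  moreover have "c\<^sup>2 \<le> (\<Sum>u\<in>words_of_length n k. \<nu> u)\<^sup>2"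
    using \<nu>(2) sp(1) by (intro power_mono) auto
  moreover have "0 < c\<^sup>2" using sp(1) by simp
  ultimately show False by linarith
qed

section \<open>Positive Lebesgue measure\<close>

text \<open>Cauchy-Schwarz for the sum \<open>f\<close> of the weighted indicators of the balls, in the form
  \<open>f \<le> (\<lambda>/2) f\<^sup>2 + 1\<^sub>O / (2 \<lambda>)\<close>.\<close>

lemma measure_lower_bound_of_pair_mass:
  fixes x :: "'u \<Rightarrow> 'a::euclidean_space" and w :: "'u \<Rightarrow> real"
  assumes W: "finite W" and w: "\<And>u. 0 \<le> w u" and r: "0 < r" and c: "0 < c" "c \<le> (\<Sum>u\<in>W. w u)"
    and L: "0 < L"
    "(\<Sum>u\<in>W. \<Sum>v\<in>W. w u * w v * (if norm (x u - x v) \<le> 2 * r then 1 else 0)) \<le> L * r ^ DIM('a)"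
    and U: "U \<in> sets borel" "emeasure lborel U < \<infinity>" "\<And>u. u \<in> W \<Longrightarrow> cball (x u) r \<subseteq> U"
  shows "c\<^sup>2 * unit_ball_vol (DIM('a)) / L \<le> measure lborel U"
proof -
  define f :: "'a \<Rightarrow> real" where "f = (\<lambda>y. \<Sum>u\<in>W. w u * indicator (cball (x u) r) y)"
  define V where "V = unit_ball_vol (DIM('a)) * r ^ DIM('a)"
  have V: "0 < V" using r by (simp add: V_def)
  \<comment> \<open>Chosen so that the quadratic term is half of c * V, the lower bound for the
    integral of f.\<close>
  define l where "l = c / (L * r ^ DIM('a))"
  have l: "0 < l" using c L r by (simp add: l_def)
  have mb: "measure lborel (cball y r) = V" for y :: 'a
    using r by (simp add: measure_def emeasure_cball V_def)
  have fin: "integrable lborel (\<lambda>y. k * indicator A y :: real)"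
    if "A \<in> sets borel" "emeasure lborel A < \<infinity>" for A :: "'a set" and k
    using that by (intro integrable_mult_right integrable_real_indicator) auto
  have fcb: "emeasure lborel (cball y r \<inter> A) < \<infinity>" if "A \<in> sets borel" for y :: 'a and A
    by (rule le_less_trans[OF emeasure_mono[of _ "cball y r"]]) (use r that in \<open>auto simp: emeasure_cball\<close>)
  have if1: "integrable lborel f"
    unfolding f_def using fcb[of UNIV] by (intro Bochner_Integration.integrable_sum fin) auto
  have f2: "(f y)\<^sup>2 = (\<Sum>u\<in>W. \<Sum>v\<in>W. (w u * w v) * indicator (cball (x u) r \<inter> cball (x v) r) y)" for y
    unfolding f_def power2_eq_square sum_product
    by (intro sum.cong refl) (simp add: indicator_inter_arith)
  have if2: "integrable lborel (\<lambda>y. (f y)\<^sup>2)"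
    unfolding f2 by (intro Bochner_Integration.integrable_sum fin fcb) auto
  have I1: "integral\<^sup>L lborel f = (\<Sum>u\<in>W. w u) * V"
  proof -
    have "integral\<^sup>L lborel f = (\<Sum>u\<in>W. integral\<^sup>L lborel (\<lambda>y. w u * indicator (cball (x u) r) y))"
      unfolding f_def using fcb[of UNIV] by (intro Bochner_Integration.integral_sum fin) auto
    also have "\<dots> = (\<Sum>u\<in>W. w u * V)" by (intro sum.cong refl) (simp add: mb)
    finally show ?thesis by (simp add: sum_distrib_right)
  qed
  have I2: "integral\<^sup>L lborel (\<lambda>y. (f y)\<^sup>2) \<le> V * (L * r ^ DIM('a))"
  proof -
    have "integral\<^sup>L lborel (\<lambda>y. (f y)\<^sup>2) = (\<Sum>u\<in>W.
        integral\<^sup>L lborel (\<lambda>y. \<Sum>v\<in>W. (w u * w v) * indicator (cball (x u) r \<inter> cball (x v) r) y))"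
      unfolding f2
      by (rule Bochner_Integration.integral_sum, intro Bochner_Integration.integrable_sum fin fcb) auto
    also have "\<dots> = (\<Sum>u\<in>W. \<Sum>v\<in>W.
        integral\<^sup>L lborel (\<lambda>y. (w u * w v) * indicator (cball (x u) r \<inter> cball (x v) r) y))"
      by (rule sum.cong[OF refl], rule Bochner_Integration.integral_sum, intro fin fcb) auto
    also have "\<dots> \<le> (\<Sum>u\<in>W. \<Sum>v\<in>W. V * (w u * w v * (if norm (x u - x v) \<le> 2 * r then 1 else 0)))"
    proof (intro sum_mono)
      fix u v
      \<comment> \<open>Balls of radius r meet only if their centres are within 2 r, which is why
        the pairs are counted at that scale.\<close>
      have "measure lborel (cball (x u) r \<inter> cball (x v) r) \<le> V * (if norm (x u - x v) \<le> 2 * r then 1 else 0)"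
      proof (cases "norm (x u - x v) \<le> 2 * r")
        case True
        have "measure lborel (cball (x u) r \<inter> cball (x v) r) \<le> measure lborel (cball (x u) r)"
          using fcb[of UNIV "x u"] by (intro measure_mono_fmeasurable) (auto simp: fmeasurable_def)
        then show ?thesis using True by (simp add: mb)
      next
        case False
        have "cball (x u) r \<inter> cball (x v) r = {}"
        proof (rule equals0I)
          fix y assume "y \<in> cball (x u) r \<inter> cball (x v) r"
          then have "dist (x u) (x v) \<le> 2 * r"
            using dist_triangle2[of "x u" "x v" y] by (simp add: dist_commute)
          then show False using False by (simp add: dist_norm)
        qed
        then show ?thesis using False by simp
      qed
      then have "w u * w v * measure lborel (cball (x u) r \<inter> cball (x v) r) \<le>
          w u * w v * (V * (if norm (x u - x v) \<le> 2 * r then 1 else 0))"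
        using w by (intro mult_left_mono) auto
      then show "integral\<^sup>L lborel (\<lambda>y. (w u * w v) * indicator (cball (x u) r \<inter> cball (x v) r) y)
          \<le> V * (w u * w v * (if norm (x u - x v) \<le> 2 * r then 1 else 0))"
        by (simp add: mult_ac)
    qed
    also have "\<dots> = V * (\<Sum>u\<in>W. \<Sum>v\<in>W. w u * w v * (if norm (x u - x v) \<le> 2 * r then 1 else 0))"
      by (simp only: sum_distrib_left)
    also have "\<dots> \<le> V * (L * r ^ DIM('a))"
      using L(2) V by (intro mult_left_mono) auto
    finally show ?thesis .
  qed
  have pw: "f y \<le> l / 2 * (f y)\<^sup>2 + 1 / (2 * l) * indicator U y" for y
  proof (cases "y \<in> U")
    case True
    have "0 \<le> (l * f y - 1)\<^sup>2" by simp
    then have "2 * l * f y \<le> l\<^sup>2 * (f y)\<^sup>2 + 1" by (simp add: power2_eq_square algebra_simps)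
    then have "f y \<le> (l\<^sup>2 * (f y)\<^sup>2 + 1) / (2 * l)" using l by (simp add: pos_le_divide_eq mult.commute)
    also have "\<dots> = l / 2 * (f y)\<^sup>2 + 1 / (2 * l)" using l by (simp add: add_divide_distrib power2_eq_square)
    finally show ?thesis using True by simp
  next
    case False
    then have "y \<notin> cball (x u) r" if "u \<in> W" for u using U(3)[OF that] by blast
    then have "f y = 0" unfolding f_def by (intro sum.neutral) simp
    then show ?thesis using False by simp
  qed
  have iU: "integrable lborel (\<lambda>y. 1 / (2 * l) * indicator U y :: real)" using U by (intro fin)
  have "c * V \<le> integral\<^sup>L lborel f" unfolding I1 using c V by (intro mult_right_mono) auto
  also have "\<dots> \<le> integral\<^sup>L lborel (\<lambda>y. l / 2 * (f y)\<^sup>2 + 1 / (2 * l) * indicator U y)"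
    using pw by (intro integral_mono if1 Bochner_Integration.integrable_add integrable_mult_right if2 iU)
  also have "\<dots> = l / 2 * integral\<^sup>L lborel (\<lambda>y. (f y)\<^sup>2) + 1 / (2 * l) * measure lborel U"
    by (subst Bochner_Integration.integral_add[OF integrable_mult_right[OF if2] iU]) simp
  also have "\<dots> \<le> l / 2 * (V * (L * r ^ DIM('a))) + 1 / (2 * l) * measure lborel U"
    using I2 l by (intro add_right_mono mult_left_mono) auto
  also have "l / 2 * (V * (L * r ^ DIM('a))) = c * V / 2"
    using L(1) r by (simp add: l_def)
  finally have "c * V / 2 \<le> 1 / (2 * l) * measure lborel U" by simp
  then have "c * V * l \<le> measure lborel U" using l by (simp add: field_simps)
  also have "c * V * l = c\<^sup>2 * unit_ball_vol (DIM('a)) / L"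
    using L(1) r by (simp add: l_def V_def power2_eq_square)
  finally show ?thesis .
qed

text \<open>If the compact limit set were null, an open U around it would have measure below the
  bound of \<open>measure_lower_bound_of_pair_mass\<close>, which does not depend on the radius. For
  large k, U contains the balls of radius a^k around the level-k points, so that bound applies to
  U.\<close>

lemma lebesgue_measure_pos:
  fixes a c L :: real and J :: "(real^'d) set"
  assumes J: "compact J" "x0 \<in> J" and ns: "nonautonomous_structure n T J \<omega>"
    and a: "0 < a" "a < 1"
    and sp: "0 < c" "\<And>m. \<exists>k\<ge>m. spread n T x0 k {0} (\<lambda>_. 1 / (a ^ k) ^ CARD('d)) (\<lambda>_. 2 * a ^ k) c L \<omega>"
  shows "0 < emeasure lebesgue (affine_set n T J \<omega>)"
proof (rule ccontr)
  let ?E = "affine_set n T J \<omega>"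
  assume "\<not> 0 < emeasure lebesgue ?E"
  have cE: "compact ?E" using J(1) by (rule compact_affine_set)
  then have bE: "?E \<in> sets borel" by (intro borel_closed compact_imp_closed)
  with \<open>\<not> 0 < emeasure lebesgue ?E\<close> have E0: "emeasure lborel ?E = 0"
    by (simp add: zero_less_iff_neq_zero)
  define L' where "L' = max L 1"
  have L': "0 < L'" by (simp add: L'_def)
  define \<eta> where "\<eta> = c\<^sup>2 * unit_ball_vol (CARD('d)) / L'"
  have \<eta>: "0 < \<eta>" using sp(1) L' by (simp add: \<eta>_def)
  obtain U where U: "open U" "?E \<subseteq> U" "emeasure lborel (U - ?E) < ennreal \<eta>"
    by (rule outer_regular_lborel[OF bE \<eta>])
  have "emeasure lborel U \<le> emeasure lborel (U - ?E) + emeasure lborel ?E"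
  proof -
    have "U = (U - ?E) \<union> ?E" using U(2) by blast
    then show ?thesis using bE U(1) emeasure_subadditive[of "U - ?E" lborel ?E] by auto
  qed
  then have Um: "emeasure lborel U < ennreal \<eta>" using U(3) E0 by simp
  have "\<exists>d>0. \<forall>x\<in>?E. \<forall>y\<in>- U. d \<le> dist x y"
    using U by (intro separate_compact_closed cE) auto
  then obtain d where d: "0 < d" "\<And>x y. x \<in> ?E \<Longrightarrow> y \<notin> U \<Longrightarrow> d \<le> dist x y" by blast
  have "open (\<Union>e\<in>?E. ball e (d / 2))" "?E \<subseteq> (\<Union>e\<in>?E. ball e (d / 2))" using d(1) by auto
  from level_subset_open[OF J(1) ns this]
  obtain m1 where m1: "\<And>k. m1 \<le> k \<Longrightarrow> level n T J \<omega> k \<subseteq> (\<Union>e\<in>?E. ball e (d / 2))" by blast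
  obtain m2 where m2: "\<And>k. m2 \<le> k \<Longrightarrow> a ^ k < d / 2"
  proof -
    have "(\<lambda>k. a ^ k) \<longlonglongrightarrow> 0" using a by (intro LIMSEQ_power_zero) simp
    then have "eventually (\<lambda>k. a ^ k < d / 2) sequentially" by (rule order_tendstoD) (use d(1) in simp)
    then show ?thesis using that by (auto simp: eventually_sequentially)
  qed
  obtain k where k: "max m1 m2 \<le> k"
    "spread n T x0 k {0} (\<lambda>_. 1 / (a ^ k) ^ CARD('d)) (\<lambda>_. 2 * a ^ k) c L \<omega>"
    using sp(2) by blast
  from k(2) obtain \<nu> where \<nu>: "\<And>u. 0 \<le> \<nu> u" "c \<le> (\<Sum>u\<in>words_of_length n k. \<nu> u)"
    "1 / (a ^ k) ^ CARD('d) * pair_mass n T x0 k \<nu> (2 * a ^ k) \<omega> \<le> L"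
    unfolding spread_def by auto
  have ak: "0 < a ^ k" using a by simp
  have "c\<^sup>2 * unit_ball_vol (DIM(real^'d)) / L' \<le> measure lborel U"
  proof (rule measure_lower_bound_of_pair_mass[where W = "words_of_length n k" and w = \<nu> and r = "a ^ k"
        and x = "\<lambda>u. proj T x0 \<omega> u"])
    have "pair_mass n T x0 k \<nu> (2 * a ^ k) \<omega> \<le> L * (a ^ k) ^ CARD('d)"
      using \<nu>(3) ak by (simp add: pos_divide_le_eq)
    also have "\<dots> \<le> L' * (a ^ k) ^ CARD('d)" using ak by (intro mult_right_mono) (auto simp: L'_def)
    finally show "(\<Sum>u\<in>words_of_length n k. \<Sum>v\<in>words_of_length n k.
      \<nu> u * \<nu> v * (if norm (proj T x0 \<omega> u - proj T x0 \<omega> v) \<le> 2 * a ^ k then 1 else 0)) \<le> L' * (a ^ k) ^ DIM(real^'d)"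
      by (simp add: pair_mass_def)
    show "emeasure lborel U < \<infinity>" using Um by (rule less_trans) simp
    show "cball (proj T x0 \<omega> u) (a ^ k) \<subseteq> U" if u: "u \<in> words_of_length n k" for u
    proof
      fix y assume y: "y \<in> cball (proj T x0 \<omega> u) (a ^ k)"
      have "proj T x0 \<omega> u \<in> level n T J \<omega> k" using J(2) u by (rule proj_in_level)
      moreover have "level n T J \<omega> k \<subseteq> (\<Union>e\<in>?E. ball e (d / 2))" using m1 k(1) by simp
      ultimately have "proj T x0 \<omega> u \<in> (\<Union>e\<in>?E. ball e (d / 2))" by (rule subsetD[rotated])
      then obtain e where e: "e \<in> ?E" "dist e (proj T x0 \<omega> u) < d / 2" by auto
      have "a ^ k < d / 2" using m2[of k] k(1) by simp
      then have "dist e y < d"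
        using dist_triangle[of e y "proj T x0 \<omega> u"] e(2) y by simp
      then show "y \<in> U" using d(2)[OF e(1), of y] by (cases "y \<in> U") auto
    qed
  qed (use \<nu> sp(1) ak L' U(1) in auto)
  then have "\<eta> \<le> measure lborel U" by (simp add: \<eta>_def)
  moreover have "measure lborel U < \<eta>"
  proof -
    have "emeasure lborel U \<noteq> \<top>" using Um by (metis ennreal_less_top less_trans less_irrefl)
    then have "ennreal (measure lborel U) < ennreal \<eta>"
      using Um emeasure_eq_ennreal_measure[of lborel U] by simp
    then show ?thesis using \<eta> by (simp add: ennreal_less_iff)
  qed
  ultimately show False by simp
qed

text \<open>Koenig's lemma.\<close>

lemma affine_set_infinite_word:
  assumes ns: "nonautonomous_structure n T J \<omega>" and x: "x \<in> affine_set n T J \<omega>"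
  obtains z where "z \<in> infinite_words n" "\<And>k. x \<in> basic_set T J \<omega> (map z [0..<k])"
proof -
  \<comment> \<open>Viable words: at every greater length some extension has a cell containing x. By
    nesting, one of the finitely many children of a viable word is viable.\<close>
  define G where "G = (\<lambda>u. \<forall>k\<ge>length u. \<exists>v\<in>extensions n k u. x \<in> basic_set T J \<omega> v)"
  have lev: "\<exists>v\<in>words_of_length n k. x \<in> basic_set T J \<omega> v" for k
  proof -
    have "x \<in> level n T J \<omega> (Suc k)" using x by (simp add: affine_set_eq)
    then have "x \<in> level n T J \<omega> k" using level_antimono[OF ns, of k "Suc k"] by auto
    then show ?thesis by (auto simp: level_def)
  qed
  have G0: "G []" using lev by (simp add: G_def extensions_Nil)
  have step: "\<exists>i\<in>{1..n (Suc (length u))}. G (u @ [i])" if Gu: "G u" for u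
  proof (rule ccontr)
    assume "\<not> (\<exists>i\<in>{1..n (Suc (length u))}. G (u @ [i]))"
    then have "\<forall>i\<in>{1..n (Suc (length u))}. \<exists>k\<ge>Suc (length u). \<forall>v\<in>extensions n k (u @ [i]). x \<notin> basic_set T J \<omega> v"
      by (auto simp: G_def)
    from bchoice[OF this] obtain h where h: "\<forall>i\<in>{1..n (Suc (length u))}.
      Suc (length u) \<le> h i \<and> (\<forall>v\<in>extensions n (h i) (u @ [i]). x \<notin> basic_set T J \<omega> v)" ..
    \<comment> \<open>Not smaller than any length at which a child fails: an extension of u of
      length K, cut at the failing length of its child, gives the contradiction. The inserted
      element makes K exceed the length of u.\<close>
    define K where "K = Max (insert (Suc (length u)) (h ` {1..n (Suc (length u))}))"
    have K: "Suc (length u) \<le> K" "\<And>i. i \<in> {1..n (Suc (length u))} \<Longrightarrow> h i \<le> K"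
      unfolding K_def by (intro Max_ge; simp)+
    obtain v where v: "v \<in> extensions n K u" "x \<in> basic_set T J \<omega> v"
      using Gu Suc_leD[OF K(1)] unfolding G_def by blast
    let ?i = "v ! length u"
    have vK: "v \<in> words_of_length n K" "take (length u) v = u" using v(1) by (auto simp: extensions_def)
    then have lv: "length v = K" by (simp add: length_words_of_length)
    have i: "?i \<in> {1..n (Suc (length u))}" using vK(1) K(1) by (auto simp: words_of_length_def)
    have tv: "take (Suc (length u)) v = u @ [?i]" using K(1) lv vK(2) by (simp add: take_Suc_conv_app_nth)
    have hK: "h ?i \<le> K" "Suc (length u) \<le> h ?i" using K(2)[OF i] h i by auto
    have "take (h ?i) v \<in> extensions n (h ?i) (u @ [?i])"
      using take_in_words_of_length[OF vK(1) hK(1)] hK tv by (simp add: extensions_def min_absorb1)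
    moreover have "x \<in> basic_set T J \<omega> (take (h ?i) v)"
      using basic_set_take_subset[OF ns vK(1)] v(2) by blast
    ultimately show False using h i by blast
  qed
  define nxt where "nxt = (\<lambda>u. SOME i. i \<in> {1..n (Suc (length u))} \<and> G (u @ [i]))"
  have nxt: "nxt u \<in> {1..n (Suc (length u))}" "G (u @ [nxt u])" if "G u" for u
    using someI_ex[of "\<lambda>i. i \<in> {1..n (Suc (length u))} \<and> G (u @ [i])"] step[OF that]
    by (auto simp: nxt_def Bex_def)
  define p where "p = rec_nat [] (\<lambda>_ u. u @ [nxt u])"
  have p0: "p 0 = []" and pS: "p (Suc k) = p k @ [nxt (p k)]" for k by (simp_all add: p_def)
  have p: "G (p k) \<and> length (p k) = k" for k
    by (induction k) (auto simp: p0 pS G0 nxt)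
  define z where "z = (\<lambda>k. nxt (p k))"
  have pz: "p k = map z [0..<k]" for k
    by (induction k) (auto simp: p0 pS z_def)
  show thesis
  proof (rule that)
    show zi: "z \<in> infinite_words n"
    proof -
      have "z j \<in> {1..n (Suc j)}" for j using nxt(1)[of "p j"] p[of j] by (simp add: z_def)
      then show ?thesis by (simp add: infinite_words_def)
    qed
    fix k
    have "map z [0..<k] \<in> words_of_length n k" using zi by (rule prefix_in_words_of_length)
    then have "extensions n k (map z [0..<k]) = {map z [0..<k]}" by (rule extensions_self)
    moreover have "G (map z [0..<k])" using p[of k] by (simp add: pz)
    ultimately show "x \<in> basic_set T J \<omega> (map z [0..<k])" unfolding G_def by force
  qed
qed

section \<open>Upper bound for the Hausdorff measure\<close>

text \<open>Asks for one cover of cost at most c, not for an infimum, so that countably many covers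
  can be joined without splitting an \<epsilon>.\<close>

definition hausdorff_cover :: "real \<Rightarrow> real \<Rightarrow> 'a::metric_space set \<Rightarrow> ennreal \<Rightarrow> bool" where
  "hausdorff_cover s \<delta> X c \<longleftrightarrow> (\<exists>Q :: nat \<Rightarrow> 'a set. (\<forall>j. bounded (Q j) \<and> diameter (Q j) \<le> \<delta>) \<and>
     X \<subseteq> (\<Union>j. Q j) \<and> (\<Sum>j. ennreal (diam_power s (Q j))) \<le> c)"

lemma hausdorff_premeasure_le_cover:
  fixes X :: "'a::metric_space set"
  assumes "hausdorff_cover s \<delta> X c"
  shows "hausdorff_premeasure s \<delta> X \<le> c"
proof -
  obtain Q :: "nat \<Rightarrow> 'a set" where Q: "\<forall>j. bounded (Q j) \<and> diameter (Q j) \<le> \<delta>" "X \<subseteq> (\<Union>j. Q j)"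
    "(\<Sum>j. ennreal (diam_power s (Q j))) \<le> c"
    using assms unfolding hausdorff_cover_def by blast
  then have "hausdorff_premeasure s \<delta> X \<le> (\<Sum>j. ennreal (diam_power s (Q j)))"
    unfolding hausdorff_premeasure_def by (intro INF_lower) simp
  then show ?thesis using Q(3) by (rule order_trans)
qed

lemma hausdorff_cover_mono:
  "hausdorff_cover s \<delta> X c \<Longrightarrow> c \<le> c' \<Longrightarrow> hausdorff_cover s \<delta> X c'"
  unfolding hausdorff_cover_def by (meson order_trans)

lemma hausdorff_cover_finite:
  assumes F: "finite F" "X \<subseteq> \<Union>F" "\<And>P. P \<in> F \<Longrightarrow> bounded P" "\<And>P. P \<in> F \<Longrightarrow> diameter P \<le> d"
    and d: "0 \<le> d" "d \<le> \<delta>" and s: "0 < s"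
  shows "hausdorff_cover s \<delta> X (ennreal (real (card F) * d powr s))"
proof -
  obtain h where h: "bij_betw h {0..<card F} F" using ex_bij_betw_nat_finite[OF F(1)] by blast
  define Q where "Q = (\<lambda>j. if j < card F then h j else {})"
  have hF: "h j \<in> F" if "j < card F" for j using h that by (auto simp: bij_betw_def)
  have Q: "bounded (Q j) \<and> diameter (Q j) \<le> \<delta>" for j
    using F(3,4)[OF hF, of j] d by (auto simp: Q_def)
  have "X \<subseteq> (\<Union>j. Q j)"
  proof
    fix x assume "x \<in> X"
    then obtain P where P: "P \<in> F" "x \<in> P" using F(2) by blast
    then have "P \<in> h ` {0..<card F}" using h by (simp add: bij_betw_def)
    then obtain j where "j < card F" "h j = P" by auto
    then have "x \<in> Q j" using P(2) by (simp add: Q_def)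
    then show "x \<in> (\<Union>j. Q j)" by blast
  qed
  moreover have "(\<Sum>j. ennreal (diam_power s (Q j))) \<le> ennreal (real (card F) * d powr s)"
  proof -
    have "(\<Sum>j. ennreal (diam_power s (Q j))) = (\<Sum>j<card F. ennreal (diam_power s (Q j)))"
      by (rule suminf_finite) (auto simp: Q_def diam_power_def)
    also have "\<dots> \<le> (\<Sum>j<card F. ennreal (d powr s))"
    proof (intro sum_mono ennreal_leI)
      fix j assume "j \<in> {..<card F}"
      then have j: "j < card F" by simp
      have "diam_power s (h j) \<le> diameter (h j) powr s" using s by (simp add: diam_power_def)
      also have "\<dots> \<le> d powr s"
        using F(3,4)[OF hF[OF j]] s diameter_ge_0 by (intro powr_mono2) auto
      finally show "diam_power s (Q j) \<le> d powr s" using j by (simp add: Q_def)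
    qed
    also have "\<dots> = ennreal (real (card F) * d powr s)"
      by (simp add: ennreal_mult ennreal_of_nat_eq_real_of_nat)
    finally show ?thesis .
  qed
  ultimately show ?thesis unfolding hausdorff_cover_def using Q by blast
qed

lemma suminf_from_nat_into_le_infsum:
  fixes g :: "'a \<Rightarrow> ennreal"
  assumes A: "countable A"
  shows "(\<Sum>i. if i \<in> to_nat_on A ` A then g (from_nat_into A i) else 0) \<le> infsum g A"
proof -
  let ?f = "\<lambda>i. if i \<in> to_nat_on A ` A then g (from_nat_into A i) else 0"
  have "sum ?f {..<N} \<le> infsum g A" for N
  proof -
    let ?N = "{..<N} \<inter> to_nat_on A ` A"
    have inj: "inj_on (from_nat_into A) ?N"
      using A by (intro inj_onI) (auto dest: arg_cong[of _ _ "to_nat_on A"])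
    have "sum ?f {..<N} = sum (\<lambda>i. g (from_nat_into A i)) ?N"
      by (rule sum.inter_restrict[symmetric]) simp
    also have "\<dots> = sum g (from_nat_into A ` ?N)"
      using inj by (simp add: sum.reindex)
    also have "\<dots> \<le> (SUP F\<in>{F. finite F \<and> F \<subseteq> A}. sum g F)"
      using A by (intro SUP_upper) auto
    also have "\<dots> = infsum g A"
      by (rule nonneg_infsum_complete[symmetric]) simp
    finally show ?thesis .
  qed
  then show ?thesis by (simp add: suminf_eq_SUP SUP_least)
qed

lemma hausdorff_cover_countable:
  fixes X :: "'u \<Rightarrow> 'a::metric_space set"
  assumes A: "countable A" and X: "E \<subseteq> (\<Union>u\<in>A. X u)" and \<delta>: "0 \<le> \<delta>"
    and cov: "\<And>u. u \<in> A \<Longrightarrow> hausdorff_cover s \<delta> (X u) (g u)"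
  shows "hausdorff_cover s \<delta> E (infsum g A)"
proof -
  have "\<forall>u\<in>A. \<exists>Q :: nat \<Rightarrow> 'a set. (\<forall>j. bounded (Q j) \<and> diameter (Q j) \<le> \<delta>) \<and>
     X u \<subseteq> (\<Union>j. Q j) \<and> (\<Sum>j. ennreal (diam_power s (Q j))) \<le> g u"
    using cov by (simp add: hausdorff_cover_def)
  from bchoice[OF this] obtain Q where Q: "\<forall>u\<in>A. (\<forall>j. bounded (Q u j) \<and> diameter (Q u j) \<le> \<delta>) \<and>
     X u \<subseteq> (\<Union>j. Q u j) \<and> (\<Sum>j. ennreal (diam_power s (Q u j))) \<le> g u" ..
  let ?A = "to_nat_on A ` A"
  define R where "R = (\<lambda>(i, j). if i \<in> ?A then Q (from_nat_into A i) j else {})"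
  have inA: "from_nat_into A i \<in> A" if "i \<in> ?A" for i using A that by auto
  have R: "bounded (R x) \<and> diameter (R x) \<le> \<delta>" for x
    using Q inA \<delta> by (cases x) (auto simp: R_def)
  have "E \<subseteq> (\<Union>m. R (prod_decode m))"
  proof
    fix x assume "x \<in> E"
    then obtain u where u: "u \<in> A" "x \<in> X u" using X by blast
    then obtain j where j: "x \<in> Q u j" using Q by blast
    have "x \<in> R (prod_decode (prod_encode (to_nat_on A u, j)))"
      using u j A by (simp add: R_def)
    then show "x \<in> (\<Union>m. R (prod_decode m))" by blast
  qed
  moreover have "(\<Sum>m. ennreal (diam_power s (R (prod_decode m)))) \<le> infsum g A"
  proof -
    have "(\<Sum>m. ennreal (diam_power s (R (prod_decode m)))) = (\<Sum>i. \<Sum>j. ennreal (diam_power s (R (i, j))))"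
      using suminf_ennreal_2dimen[of "\<lambda>i. \<Sum>j. ennreal (diam_power s (R (i, j)))" "\<lambda>x. ennreal (diam_power s (R x))"]
      by (simp add: comp_def)
    also have "\<dots> \<le> (\<Sum>i. if i \<in> ?A then g (from_nat_into A i) else 0)"
    proof (rule suminf_le)
      fix i
      show "(\<Sum>j. ennreal (diam_power s (R (i, j)))) \<le> (if i \<in> ?A then g (from_nat_into A i) else 0)"
      proof (cases "i \<in> ?A")
        case True
        then show ?thesis using Q inA[OF True] by (simp add: R_def)
      next
        case False
        then show ?thesis by (simp add: R_def diam_power_def)
      qed
    qed auto
    also have "\<dots> \<le> infsum g A" by (rule suminf_from_nat_into_le_infsum[OF A])
    finally show ?thesis .
  qed
  ultimately show ?thesis
    unfolding hausdorff_cover_def using R by (intro exI[of _ "\<lambda>m. R (prod_decode m)"]) simp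
qed

lemma hausdorff_measure_eq_0I:
  assumes "\<And>\<delta> \<epsilon>. 0 < \<delta> \<Longrightarrow> 0 < \<epsilon> \<Longrightarrow> hausdorff_cover s \<delta> X (ennreal \<epsilon>)"
  shows "hausdorff_measure s X = 0"
proof -
  have "hausdorff_premeasure s \<delta> X \<le> 0" if "0 < \<delta>" for \<delta>
  proof (rule ennreal_le_epsilon)
    fix \<epsilon> :: real assume "0 < \<epsilon>"
    then show "hausdorff_premeasure s \<delta> X \<le> 0 + ennreal \<epsilon>"
      using hausdorff_premeasure_le_cover[OF assms[OF that]] by simp
  qed
  then have "hausdorff_measure s X \<le> 0" unfolding hausdorff_measure_def by (intro SUP_least) simp
  then show ?thesis by simp
qed

text \<open>A grid of mesh \<rho> has about \<rho>^(-d) pieces of cost about \<rho>^s. This serves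
  the case that the critical value equals d: then exponents s > d are needed, for which
  \<open>svf\<close> is not the cost of cutting an ellipsoid.\<close>

lemma hausdorff_measure_above_dim:
  fixes X :: "(real^'d) set"
  assumes X: "bounded X" and s: "real CARD('d) < s"
  shows "hausdorff_measure s X = 0"
proof (rule hausdorff_measure_eq_0I)
  fix \<delta> \<epsilon> :: real assume \<delta>: "0 < \<delta>" and \<epsilon>: "0 < \<epsilon>"
  let ?d = "real CARD('d)"
  obtain R where R: "0 < R" "X \<subseteq> cball 0 R"
    using X unfolding bounded_pos by (auto simp: subset_iff)
  define C where "C = (2 * R + 1) ^ CARD('d) * ?d powr s"
  have "((\<lambda>\<rho>. C * \<rho> powr (s - ?d)) \<longlongrightarrow> C * 0) (at_right 0)"
    using s by (intro tendsto_mult tendsto_const tendsto_zero_powrI[where b = "s - ?d"])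
      (auto simp: eventually_at_filter)
  then have "eventually (\<lambda>\<rho>. C * \<rho> powr (s - ?d) < \<epsilon>) (at_right 0)"
    using \<epsilon> by (intro order_tendstoD) auto
  moreover have "eventually (\<lambda>\<rho>. \<rho> < min 1 (\<delta> / ?d)) (at_right (0::real))"
    using \<delta> by (intro eventually_at_right_real[THEN eventually_mono, of 0 "min 1 (\<delta> / ?d)"]) auto
  moreover have "eventually (\<lambda>\<rho>. 0 < \<rho>) (at_right (0::real))"
    by (simp add: eventually_at_filter)
  ultimately have "eventually (\<lambda>\<rho>. C * \<rho> powr (s - ?d) < \<epsilon> \<and> \<rho> < min 1 (\<delta> / ?d) \<and> 0 < \<rho>) (at_right 0)"
    by eventually_elim simp
  from eventually_happens'[OF trivial_limit_at_right_real this]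
  obtain \<rho> where "C * \<rho> powr (s - ?d) < \<epsilon> \<and> \<rho> < min 1 (\<delta> / ?d) \<and> 0 < \<rho>" ..
  then have \<rho>: "C * \<rho> powr (s - ?d) < \<epsilon>" "\<rho> < 1" "\<rho> < \<delta> / ?d" "0 < \<rho>" by auto
  obtain F where F: "finite F" "real (card F) \<le> (\<Prod>i\<in>(UNIV :: 'd set). 2 * R / \<rho> + 1)" "cball 0 R \<subseteq> (\<Union>F :: (real^'d) set)"
    "\<And>P x y i. P \<in> F \<Longrightarrow> x \<in> P \<Longrightarrow> y \<in> P \<Longrightarrow> \<bar>axis i 1 \<bullet> x - axis i 1 \<bullet> y\<bar> \<le> \<rho>"
    by (rule cball_orthonormal_pieces[of "\<lambda>i::'d. axis i 1" "\<lambda>_. \<rho>" R, OF norm_axis_1 \<rho>(4) less_imp_le[OF R(1)]],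
        rule that, assumption+)
  have dist: "dist x y \<le> ?d * \<rho>" if "P \<in> F" "x \<in> P" "y \<in> P" for P x y
  proof -
    have "dist x y \<le> (\<Sum>i\<in>UNIV. \<bar>(x - y) $ i\<bar>)" unfolding dist_norm by (rule norm_le_l1_cart)
    also have "\<dots> \<le> (\<Sum>i\<in>(UNIV :: 'd set). \<rho>)"
      using F(4)[OF that] by (intro sum_mono) (simp add: inner_axis')
    finally show ?thesis by simp
  qed
  have d\<rho>: "0 \<le> ?d * \<rho>" "?d * \<rho> \<le> \<delta>" using \<rho> by (auto simp: field_simps less_imp_le)
  have "hausdorff_cover s \<delta> X (ennreal (real (card F) * (?d * \<rho>) powr s))"
  proof (rule hausdorff_cover_finite[OF F(1) _ _ _ d\<rho>])
    show "X \<subseteq> \<Union>F" using R(2) F(3) by (rule subset_trans)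
    show "bounded P" if "P \<in> F" for P unfolding bounded_two_points using dist[OF that] by blast
    show "diameter P \<le> ?d * \<rho>" if "P \<in> F" for P
      using dist[OF that] d\<rho>(1) by (intro diameter_le) (auto simp: dist_norm)
    show "0 < s" using s by (rule le_less_trans[rotated]) simp
  qed
  moreover have "real (card F) * (?d * \<rho>) powr s \<le> \<epsilon>"
  proof -
    have "2 * R / \<rho> + 1 \<le> (2 * R + 1) / \<rho>" using \<rho> by (simp add: field_simps)
    then have "(2 * R / \<rho> + 1) ^ CARD('d) \<le> ((2 * R + 1) / \<rho>) ^ CARD('d)"
      using R \<rho> by (intro power_mono) auto
    then have "real (card F) \<le> ((2 * R + 1) / \<rho>) ^ CARD('d)"
      using F(2) by simp
    then have "real (card F) * (?d * \<rho>) powr s \<le> ((2 * R + 1) / \<rho>) ^ CARD('d) * (?d * \<rho>) powr s"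
      by (intro mult_right_mono) auto
    also have "\<dots> = C * (\<rho> powr s / \<rho> powr ?d)"
      using \<rho>(4) by (simp add: C_def power_divide powr_mult powr_realpow)
    also have "\<dots> = C * \<rho> powr (s - ?d)" by (simp add: powr_diff)
    finally show ?thesis using \<rho>(1) by linarith
  qed
  ultimately show "hausdorff_cover s \<delta> X (ennreal \<epsilon>)"
    using hausdorff_cover_mono ennreal_leI by blast
qed

text \<open>The premeasures increase with k because longer words leave fewer covers. Hence the limit
  in \<open>net_measure\<close> exists as a supremum and dominates every one of them.\<close>

lemma net_measure_eq_0D:
  assumes "net_measure n T s G = 0"
  shows "net_premeasure n T s k G = 0"
proof -
  have inc: "incseq (\<lambda>k. net_premeasure n T s k G)"
    unfolding net_premeasure_def by (intro incseq_SucI INF_superset_mono) auto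
  then have "(\<lambda>k. net_premeasure n T s k G) \<longlonglongrightarrow> (SUP k. net_premeasure n T s k G)"
    by (rule LIMSEQ_SUP)
  then have "net_measure n T s G = (SUP k. net_premeasure n T s k G)"
    unfolding net_measure_def by (rule limI)
  then have "net_premeasure n T s k G \<le> net_measure n T s G" by (simp only:) (rule SUP_upper, simp)
  then show ?thesis using assms by simp
qed

lemma net_measure_eq_0_cover:
  assumes "net_measure n T s G = 0" "0 < \<epsilon>"
  obtains A where "A \<subseteq> {u \<in> words n. k \<le> length u}" "G \<subseteq> (\<Union>u\<in>A. cylinder n u)"
    "(\<Sum>\<^sub>\<infinity>u\<in>A. ennreal (svf s (word_matrix T u))) < ennreal \<epsilon>"
proof -
  have "net_premeasure n T s k G < ennreal \<epsilon>" using net_measure_eq_0D[OF assms(1)] assms(2) by simp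
  then show thesis unfolding net_premeasure_def INF_less_iff using that by blast
qed

text \<open>\<open>svf 0\<close> is 1, so a cover of a nonempty set costs at least 1. This rules out
  s = 0 in the upper bound, as the cutting of ellipsoids requires 0 < s.\<close>

lemma net_measure_0_nonzero:
  assumes "G \<noteq> {}"
  shows "net_measure n T 0 G \<noteq> 0"
proof
  assume "net_measure n T 0 G = 0"
  then obtain A where A: "G \<subseteq> (\<Union>u\<in>A. cylinder n u)"
    "(\<Sum>\<^sub>\<infinity>u\<in>A. ennreal (svf 0 (word_matrix T u))) < ennreal 1"
    by (rule net_measure_eq_0_cover[of n T 0 G 1]) auto
  obtain u where u: "u \<in> A" using A(1) assms by blast
  have "ennreal 1 = sum (\<lambda>u. ennreal (svf 0 (word_matrix T u))) {u}" by (simp add: svf_def)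
  also have "\<dots> \<le> (SUP F\<in>{F. finite F \<and> F \<subseteq> A}. sum (\<lambda>u. ennreal (svf 0 (word_matrix T u))) F)"
    using u by (intro SUP_upper) auto
  also have "\<dots> = (\<Sum>\<^sub>\<infinity>u\<in>A. ennreal (svf 0 (word_matrix T u)))"
    by (rule nonneg_infsum_complete[symmetric]) simp
  finally show False using A(2) by simp
qed

lemma hausdorff_measure_zero:
  fixes J :: "(real^'d) set"
  assumes inv: "\<And>k i. 1 \<le> k \<Longrightarrow> i \<in> {1..n k} \<Longrightarrow> invertible (T k i)"
    and sv: "\<And>k i. 1 \<le> k \<Longrightarrow> i \<in> {1..n k} \<Longrightarrow> singular_value 1 (T k i) \<le> a" and a: "0 < a" "a < 1"
    and J: "compact J" and ns: "nonautonomous_structure n T J \<omega>"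
    and s: "0 < s" "s \<le> real CARD('d)" and net: "net_measure n T s (infinite_words n) = 0"
  shows "hausdorff_measure s (affine_set n T J \<omega>) = 0"
proof (rule hausdorff_measure_eq_0I)
  fix \<delta> \<epsilon> :: real assume \<delta>: "0 < \<delta>" and \<epsilon>: "0 < \<epsilon>"
  let ?d = "real CARD('d)"
  obtain R0 where R0: "0 < R0" "\<And>x. x \<in> J \<Longrightarrow> norm x \<le> R0"
    using compact_imp_bounded[OF J] unfolding bounded_pos by blast
  define R where "R = max 1 R0"
  have R: "1 \<le> R" "J \<subseteq> cball 0 R" using R0 by (auto simp: R_def le_max_iff_disj)
  \<comment> \<open>Constants of \<open>matrix_image_cball_cover\<close>: the pieces of a cell have
    diameter at most D * \<alpha>_m, with m the ceiling of s, and together cost at most K times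
    \<open>svf\<close>.\<close>
  define D where "D = 2 * R * ?d"
  have D: "0 < D" using R by (simp add: D_def)
  define K where "K = D powr s * (2 * R + 1) ^ CARD('d)"
  have K: "0 < K" using D R by (simp add: K_def)
  \<comment> \<open>As \<alpha>_m is at most a^k on words of length k, depth k0 of the symbolic
    cover makes all pieces smaller than \<delta>.\<close>
  obtain k0 where k0: "\<And>k. k0 \<le> k \<Longrightarrow> a ^ k < \<delta> / D"
  proof -
    have "(\<lambda>k. a ^ k) \<longlonglongrightarrow> 0" using a by (intro LIMSEQ_power_zero) simp
    then have "eventually (\<lambda>k. a ^ k < \<delta> / D) sequentially" by (rule order_tendstoD) (use \<delta> D in simp)
    then show ?thesis using that by (auto simp: eventually_sequentially)
  qed
  obtain A where A: "A \<subseteq> {u \<in> words n. k0 \<le> length u}" "infinite_words n \<subseteq> (\<Union>u\<in>A. cylinder n u)"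
    "(\<Sum>\<^sub>\<infinity>u\<in>A. ennreal (svf s (word_matrix T u))) < ennreal (\<epsilon> / K)"
    by (rule net_measure_eq_0_cover[OF net, of "\<epsilon> / K" k0]) (use \<epsilon> K in auto)
  have cA: "countable A" by (rule countable_subset[OF _ countable_words]) (use A(1) in auto)
  have cover: "hausdorff_cover s \<delta> (basic_set T J \<omega> u) (ennreal K * ennreal (svf s (word_matrix T u)))"
    if u: "u \<in> A" for u
  proof -
    obtain k where k: "u \<in> words_of_length n k" "k0 \<le> k"
      using A(1) u by (auto simp: words_def length_words_of_length)
    let ?T = "word_matrix T u"
    have I: "invertible ?T" by (rule invertible_word_matrix[of n T, OF inv k(1)])
    define m where "m = nat \<lceil>s\<rceil>"
    have m: "m \<in> {1..CARD('d)}" using s unfolding m_def by (auto simp: Suc_le_eq)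
    let ?\<alpha> = "singular_value m ?T"
    have \<alpha>: "0 < ?\<alpha>" "?\<alpha> \<le> a ^ k"
      using singular_value_pos[OF I m] singular_value_word_matrix_le[of n T a, OF sv less_imp_le[OF a(1)] k(1) m] by auto
    obtain F where F: "finite F" "(*v) ?T ` cball 0 R \<subseteq> \<Union>F"
      "\<And>P. P \<in> F \<Longrightarrow> bounded P \<and> diameter P \<le> 2 * R * ?d * ?\<alpha>"
      "real (card F) * ?\<alpha> powr s \<le> (2 * R + 1) ^ CARD('d) * svf s ?T"
      by (rule matrix_image_cball_cover[OF I s R(1), folded m_def], rule that, assumption+)
    define v where "v = proj T 0 \<omega> u"
    define F' where "F' = (\<lambda>P. (\<lambda>x. v + x) ` P) ` F"
    have D\<alpha>: "0 \<le> D * ?\<alpha>" "D * ?\<alpha> \<le> \<delta>"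
    proof -
      have "D * ?\<alpha> \<le> D * (\<delta> / D)" using \<alpha>(2) k0[OF k(2)] D by (intro mult_left_mono) auto
      then show "D * ?\<alpha> \<le> \<delta>" using D by simp
      show "0 \<le> D * ?\<alpha>" using D \<alpha> by simp
    qed
    have diam: "bounded ((\<lambda>x. v + x) ` P)" "diameter ((\<lambda>x. v + x) ` P) \<le> D * ?\<alpha>" if P: "P \<in> F" for P
    proof -
      have b: "bounded P" and dP: "diameter P \<le> D * ?\<alpha>" using F(3)[OF P] by (auto simp: D_def)
      show "bounded ((\<lambda>x. v + x) ` P)" using b by (rule bounded_translation)
      show "diameter ((\<lambda>x. v + x) ` P) \<le> D * ?\<alpha>"
      proof (rule diameter_le)
        fix x y assume "x \<in> (\<lambda>x. v + x) ` P" "y \<in> (\<lambda>x. v + x) ` P"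
        then obtain x' y' where "x' \<in> P" "x = v + x'" "y' \<in> P" "y = v + y'" by blast
        then show "norm (x - y) \<le> D * ?\<alpha>"
          using diameter_bounded_bound[OF b, of x' y'] dP by (simp add: dist_norm)
      qed (use D\<alpha> in simp)
    qed
    have "hausdorff_cover s \<delta> (basic_set T J \<omega> u) (ennreal (real (card F') * (D * ?\<alpha>) powr s))"
    proof (rule hausdorff_cover_finite[OF _ _ _ _ D\<alpha> s(1)])
      show "finite F'" using F(1) by (simp add: F'_def)
      show "basic_set T J \<omega> u \<subseteq> \<Union>F'"
      proof
        fix y assume "y \<in> basic_set T J \<omega> u"
        then obtain x where x: "x \<in> J" "y = proj T x \<omega> u" by (auto simp: basic_set_eq)
        have "proj T x \<omega> u - v = ?T *v (x - 0)" unfolding v_def by (rule proj_diff)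
        then have y: "y = v + ?T *v x" by (simp add: x algebra_simps)
        have "?T *v x \<in> \<Union>F" using F(2) R(2) x(1) by blast
        then obtain P where "P \<in> F" "?T *v x \<in> P" by blast
        then show "y \<in> \<Union>F'" unfolding y F'_def by blast
      qed
    qed (use diam in \<open>auto simp: F'_def\<close>)
    moreover have "real (card F') * (D * ?\<alpha>) powr s \<le> K * svf s ?T"
    proof -
      have "real (card F') \<le> real (card F)" unfolding F'_def using F(1) by (simp add: card_image_le)
      then have "real (card F') * (D * ?\<alpha>) powr s \<le> real (card F) * (D * ?\<alpha>) powr s"
        by (rule mult_right_mono) simp
      also have "\<dots> = D powr s * (real (card F) * ?\<alpha> powr s)"
        using D \<alpha> by (simp add: powr_mult)
      also have "\<dots> \<le> D powr s * ((2 * R + 1) ^ CARD('d) * svf s ?T)"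
        using F(4) by (rule mult_left_mono) simp
      finally show ?thesis by (simp add: K_def mult.assoc)
    qed
    moreover have "ennreal K * ennreal (svf s ?T) = ennreal (K * svf s ?T)"
      using K by (simp add: ennreal_mult'[symmetric])
    ultimately show ?thesis
      using hausdorff_cover_mono[OF _ ennreal_leI] by simp
  qed
  \<comment> \<open>A point of the limit set lies in all cells along one infinite word, not merely
    in one cell per level. The cylinder of the cover that contains this word therefore names a cell
    containing the point.\<close>
  have "affine_set n T J \<omega> \<subseteq> (\<Union>u\<in>A. basic_set T J \<omega> u)"
  proof
    fix x assume x: "x \<in> affine_set n T J \<omega>"
    obtain z where z: "z \<in> infinite_words n" "\<And>k. x \<in> basic_set T J \<omega> (map z [0..<k])"
      by (rule affine_set_infinite_word[OF ns x]) blast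
    then obtain u where u: "u \<in> A" "z \<in> cylinder n u" using A(2) by blast
    then have "map z [0..<length u] = u" by (simp add: cylinder_def)
    then show "x \<in> (\<Union>u\<in>A. basic_set T J \<omega> u)" using z(2)[of "length u"] u(1) by auto
  qed
  from hausdorff_cover_countable[OF cA this less_imp_le[OF \<delta>] cover]
  have "hausdorff_cover s \<delta> (affine_set n T J \<omega>) (\<Sum>\<^sub>\<infinity>u\<in>A. ennreal K * ennreal (svf s (word_matrix T u)))" .
  moreover have "(\<Sum>\<^sub>\<infinity>u\<in>A. ennreal K * ennreal (svf s (word_matrix T u))) \<le> ennreal \<epsilon>"
  proof -
    let ?g = "\<lambda>u. ennreal (svf s (word_matrix T u))"
    have "(\<Sum>\<^sub>\<infinity>u\<in>A. ennreal K * ?g u) = (SUP F\<in>{F. finite F \<and> F \<subseteq> A}. \<Sum>u\<in>F. ennreal K * ?g u)"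
      by (rule nonneg_infsum_complete) simp
    also have "\<dots> \<le> ennreal K * infsum ?g A"
    proof (rule SUP_least)
      fix F assume F: "F \<in> {F. finite F \<and> F \<subseteq> A}"
      have "sum ?g F \<le> (SUP F\<in>{F. finite F \<and> F \<subseteq> A}. sum ?g F)" using F by (rule SUP_upper)
      also have "\<dots> = infsum ?g A" by (rule nonneg_infsum_complete[symmetric]) simp
      finally show "(\<Sum>u\<in>F. ennreal K * ?g u) \<le> ennreal K * infsum ?g A"
        unfolding sum_distrib_left[symmetric] by (rule mult_left_mono) simp
    qed
    also have "\<dots> \<le> ennreal K * ennreal (\<epsilon> / K)" using A(3) by (intro mult_left_mono) auto
    also have "\<dots> = ennreal \<epsilon>" using K \<epsilon> by (simp add: ennreal_mult'[symmetric])
    finally show ?thesis .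
  qed
  ultimately show "hausdorff_cover s \<delta> (affine_set n T J \<omega>) (ennreal \<epsilon>)"
    by (rule hausdorff_cover_mono)
qed

section \<open>Almost sure dimension\<close>

lemma net_measure_below_s_A:
  assumes "0 \<le> s" "ereal s < s_A n T"
  shows "net_measure n T s (infinite_words n) \<noteq> 0"
proof
  assume "net_measure n T s (infinite_words n) = 0"
  then have "s_A n T \<le> ereal s" unfolding s_A_def using assms(1) by (intro Inf_lower) auto
  then show False using assms(2) by simp
qed

text \<open>The exceptional set depends on t and not on t', so one almost sure statement treats all
  exponents up to t, and rational t suffice later.\<close>

lemma AE_hausdorff_measure_nonzero:
  fixes n :: "nat \<Rightarrow> nat" and T :: "nat \<Rightarrow> nat \<Rightarrow> real^'d^'d" and \<mu> :: "(real^'d) measure"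
  assumes \<mu>: "prob_space \<mu>" "sets \<mu> = sets borel" and ac: "absolutely_continuous lborel \<mu>"
    and inv: "\<And>k i. 1 \<le> k \<Longrightarrow> i \<in> {1..n k} \<Longrightarrow> invertible (T k i)"
    and sv: "\<And>k i. 1 \<le> k \<Longrightarrow> i \<in> {1..n k} \<Longrightarrow> singular_value 1 (T k i) \<le> a"
    and a: "0 < a" "a < 1" and J: "compact J" "x0 \<in> J"
    and t: "0 < t" "t < real CARD('d)" "ereal t < s_A n T"
  shows "AE \<omega> in PiM (words n) (\<lambda>_. \<mu>). nonautonomous_structure n T J \<omega> \<longrightarrow>
    (\<forall>t'. 0 \<le> t' \<longrightarrow> t' \<le> t \<longrightarrow> hausdorff_measure t' (affine_set n T J \<omega>) \<noteq> 0)"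
proof -
  have "ereal t < min (s_A n T) (ereal (real CARD('d)))" using t by simp
  then obtain s where s: "ereal t < ereal s" "ereal s < min (s_A n T) (ereal (real CARD('d)))"
    by (rule ereal_dense2[THEN exE]) blast
  then have s: "t < s" "ereal s < s_A n T" "s < real CARD('d)" by auto
  define \<sigma> where "\<sigma> = (t + s) / 2"
  have \<sigma>: "t < \<sigma>" "\<sigma> < s" using s(1) by (auto simp: \<sigma>_def)
  define \<theta> where "\<theta> = (1/2 :: real) powr (\<sigma> - t)"
  have \<theta>: "0 < \<theta>" "\<theta> < 1" using \<sigma> by (auto simp: \<theta>_def powr_def mult_pos_neg)
  let ?S = "\<lambda>k. {j. a ^ k \<le> (1/2 :: real) ^ j}"
  have fS: "finite (?S k)" for k using a by (intro finite_dyadic_scales) simp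
  have "AE \<omega> in PiM (words n) (\<lambda>_. \<mu>). \<exists>c>0. \<exists>L. \<forall>m. \<exists>k\<ge>m.
      spread n T x0 k (?S k) (\<lambda>j. ((1/2) ^ j) powr - t) (\<lambda>j. (1/2) ^ j) c L \<omega>"
  proof (rule AE_spread[OF \<mu> ac inv sv a])
    show "0 \<le> \<sigma>" "\<sigma> < s" "\<sigma> \<le> real CARD('d)" using \<sigma> t s by auto
    show "net_measure n T s (infinite_words n) \<noteq> 0" using s t by (intro net_measure_below_s_A) auto
    show "(\<Sum>j\<in>?S k. ((1/2 :: real) ^ j) powr - t * ((1/2) ^ j) powr \<sigma>) \<le> 1 / (1 - \<theta>)" for k
    proof -
      have "((1/2 :: real) ^ j) powr - t * ((1/2) ^ j) powr \<sigma> = \<theta> ^ j" for j :: nat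
        by (simp add: \<theta>_def powr_add[symmetric] powr_realpow[symmetric] powr_powr mult.commute right_diff_distrib)
      then have "(\<Sum>j\<in>?S k. ((1/2 :: real) ^ j) powr - t * ((1/2) ^ j) powr \<sigma>) = (\<Sum>j\<in>?S k. \<theta> ^ j)"
        by (intro sum.cong) auto
      also have "\<dots> \<le> suminf (\<lambda>j. \<theta> ^ j)"
        using \<theta> by (intro sum_le_suminf fS summable_geometric) auto
      also have "\<dots> = 1 / (1 - \<theta>)" using \<theta> by (intro suminf_geometric) auto
      finally show ?thesis .
    qed
  qed (use fS in auto)
  then show ?thesis
  proof eventually_elim
    case (elim \<omega>)
    then obtain c L where c: "0 < c" and L: "\<And>m. \<exists>k\<ge>m.
      spread n T x0 k (?S k) (\<lambda>j. ((1/2) ^ j) powr - t) (\<lambda>j. (1/2) ^ j) c L \<omega>" by blast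
    show ?case
    proof (intro impI allI)
      fix t' assume "nonautonomous_structure n T J \<omega>" "0 \<le> t'" "t' \<le> t"
      then show "hausdorff_measure t' (affine_set n T J \<omega>) \<noteq> 0"
        by (intro hausdorff_measure_nonzero[OF J _ a _ _ t(1) c L])
    qed
  qed
qed

lemma AE_lebesgue_measure_pos:
  fixes n :: "nat \<Rightarrow> nat" and T :: "nat \<Rightarrow> nat \<Rightarrow> real^'d^'d" and \<mu> :: "(real^'d) measure"
  assumes \<mu>: "prob_space \<mu>" "sets \<mu> = sets borel" and ac: "absolutely_continuous lborel \<mu>"
    and inv: "\<And>k i. 1 \<le> k \<Longrightarrow> i \<in> {1..n k} \<Longrightarrow> invertible (T k i)"
    and sv: "\<And>k i. 1 \<le> k \<Longrightarrow> i \<in> {1..n k} \<Longrightarrow> singular_value 1 (T k i) \<le> a"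
    and a: "0 < a" "a < 1" and J: "compact J" "x0 \<in> J"
    and sA: "ereal (real CARD('d)) < s_A n T"
  shows "AE \<omega> in PiM (words n) (\<lambda>_. \<mu>). nonautonomous_structure n T J \<omega> \<longrightarrow>
    0 < emeasure lebesgue (affine_set n T J \<omega>)"
proof -
  obtain s where s: "ereal (real CARD('d)) < ereal s" "ereal s < s_A n T"
    by (rule ereal_dense2[OF sA, THEN exE]) blast
  have "AE \<omega> in PiM (words n) (\<lambda>_. \<mu>). \<exists>c>0. \<exists>L. \<forall>m. \<exists>k\<ge>m.
      spread n T x0 k {0} (\<lambda>_. 1 / (a ^ k) ^ CARD('d)) (\<lambda>_. 2 * a ^ k) c L \<omega>"
  proof (rule AE_spread[OF \<mu> ac inv sv a])
    show "0 \<le> real CARD('d)" "real CARD('d) < s" "real CARD('d) \<le> real CARD('d)" using s by auto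
    then show "net_measure n T s (infinite_words n) \<noteq> 0" using s by (intro net_measure_below_s_A) auto
    \<comment> \<open>A single scale, indexed by 0; with \<sigma> = d the weight a^(-k d) times (2
      a^k)^d is 2^d at every level.\<close>
    show "(\<Sum>j\<in>{0::nat}. 1 / (a ^ k) ^ CARD('d) * (2 * a ^ k) powr real CARD('d)) \<le> 2 ^ CARD('d)" for k
    proof -
      have "0 < 2 * a ^ k" using a by simp
      then have "(2 * a ^ k) powr real CARD('d) = (2 * a ^ k) ^ CARD('d)" by (rule powr_realpow)
      then show ?thesis using a by (simp add: power_mult_distrib)
    qed
  qed (use a in auto)
  then show ?thesis
  proof eventually_elim
    case (elim \<omega>)
    then obtain c L where c: "0 < c" and L: "\<And>m. \<exists>k\<ge>m.
      spread n T x0 k {0} (\<lambda>_. 1 / (a ^ k) ^ CARD('d)) (\<lambda>_. 2 * a ^ k) c L \<omega>" by blast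
    show ?case by (intro impI lebesgue_measure_pos[OF J _ a c L])
  qed
qed

lemma hausdorff_dim_le:
  assumes "0 \<le> s" "hausdorff_measure s X = 0"
  shows "hausdorff_dim X \<le> ereal s"
  unfolding hausdorff_dim_def using assms by (intro Inf_lower) auto

text \<open>If the critical value is below d, exponents just above it are handled by symbolic
  covers; if it equals d, any s > d is handled by the grid.\<close>

lemma hausdorff_dim_affine_set_le:
  fixes T :: "nat \<Rightarrow> nat \<Rightarrow> real^'d^'d"
  assumes n: "\<And>k. 1 \<le> k \<Longrightarrow> 1 \<le> n k"
    and inv: "\<And>k i. 1 \<le> k \<Longrightarrow> i \<in> {1..n k} \<Longrightarrow> invertible (T k i)"
    and sv: "\<And>k i. 1 \<le> k \<Longrightarrow> i \<in> {1..n k} \<Longrightarrow> singular_value 1 (T k i) \<le> a" and a: "0 < a" "a < 1"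
    and J: "compact J" and ns: "nonautonomous_structure n T J \<omega>"
    and sA: "s_A n T \<le> ereal (real CARD('d))"
  shows "hausdorff_dim (affine_set n T J \<omega>) \<le> s_A n T"
proof (rule dense_ge)
  fix x assume x: "s_A n T < x"
  show "hausdorff_dim (affine_set n T J \<omega>) \<le> x"
  proof (cases "s_A n T = ereal (real CARD('d))")
    case True
    obtain s where s: "ereal (real CARD('d)) < ereal s" "ereal s < x"
      using ereal_dense2[OF x[unfolded True]] by blast
    have "bounded (affine_set n T J \<omega>)" by (rule compact_imp_bounded[OF compact_affine_set[OF J]])
    then have "hausdorff_measure s (affine_set n T J \<omega>) = 0"
      using s(1) by (intro hausdorff_measure_above_dim) auto
    then have "hausdorff_dim (affine_set n T J \<omega>) \<le> ereal s"
      using s(1) by (intro hausdorff_dim_le) (simp_all add: less_imp_le le_less_trans[OF of_nat_0_le_iff])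
    then show ?thesis using s(2) by simp
  next
    case False
    then have "s_A n T < min x (ereal (real CARD('d)))" using sA x by simp
    then obtain s where s: "0 \<le> s" "net_measure n T s (infinite_words n) = 0"
      "ereal s < min x (ereal (real CARD('d)))"
      unfolding s_A_def Inf_less_iff by blast
    have "s \<noteq> 0"
      using s(2) net_measure_0_nonzero[OF infinite_words_nonempty[of n, OF n]] by blast
    with s(1) have "0 < s" by simp
    then have "hausdorff_measure s (affine_set n T J \<omega>) = 0"
      using s(2,3) by (intro hausdorff_measure_zero[OF inv sv a J ns]) auto
    with s(1) have "hausdorff_dim (affine_set n T J \<omega>) \<le> ereal s" by (rule hausdorff_dim_le)
    also have "\<dots> \<le> x" using s(3) by (simp add: less_imp_le)
    finally show ?thesis .
  qed
qed

text \<open>Between an exponent with vanishing measure and x there is a rational. Asking for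
  rational q only allows the hypothesis to be met by countably many almost sure events.\<close>

lemma le_hausdorff_dim:
  fixes x :: ereal
  assumes H: "\<And>q t. q \<in> \<rat> \<Longrightarrow> 0 < q \<Longrightarrow> ereal q < x \<Longrightarrow> 0 \<le> t \<Longrightarrow> t \<le> q \<Longrightarrow> hausdorff_measure t X \<noteq> 0"
  shows "x \<le> hausdorff_dim X"
  unfolding hausdorff_dim_def
proof (rule Inf_greatest)
  fix y assume "y \<in> ereal ` {s. 0 \<le> s \<and> hausdorff_measure s X = 0}"
  then obtain t where t: "y = ereal t" "0 \<le> t" "hausdorff_measure t X = 0" by blast
  show "x \<le> y"
  proof (rule ccontr)
    assume "\<not> x \<le> y"
    then have "ereal t < x" by (simp add: t)
    then obtain r where r: "ereal t < ereal r" "ereal r < x" using ereal_dense2 by blast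
    then obtain q where q: "q \<in> \<rat>" "t < q" "q < r" using Rats_dense_in_real[of t r] by auto
    have "ereal q < x" using q(3) r(2) by (metis ereal_less(2) less_ereal.simps(1) less_trans)
    then show False using H[of q t] q t by simp
  qed
qed

theorem theorem2p8:
  fixes n :: "nat \<Rightarrow> nat"
    and T :: "nat \<Rightarrow> nat \<Rightarrow> real^'d^'d"
    and J D :: "(real^'d) set"
    and \<mu> :: "(real^'d) measure"
  assumes "\<And>k. 1 \<le> k \<Longrightarrow> 2 \<le> n k"
    and "standing_assumption n T"
    and "compact J" and "interior J \<noteq> {}"
    and "prob_space \<mu>" and "sets \<mu> = sets borel"
    and "absolutely_continuous lborel \<mu>"
    and "bounded D" and "AE x in \<mu>. x \<in> D"
    and "AE \<omega> in translation_law n \<mu>. nonautonomous_structure n T J \<omega>"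
  shows "AE \<omega> in translation_law n \<mu>.
           (s_A n T \<le> ereal (real CARD('d)) \<longrightarrow> hausdorff_dim (affine_set n T J \<omega>) = s_A n T) \<and>
           (s_A n T > ereal (real CARD('d)) \<longrightarrow> emeasure lebesgue (affine_set n T J \<omega>) > 0)"
proof -
  let ?P = "PiM (words n) (\<lambda>_. \<mu>)"
  note inv = standing_assumptionD(1)[OF assms(2)]
  obtain a where a: "0 < a" "a < 1"
    and sv: "\<And>k i. 1 \<le> k \<Longrightarrow> i \<in> {1..n k} \<Longrightarrow> singular_value 1 (T k i) \<le> a"
    using standing_assumptionD(2)[OF assms(2)] by blast
  have n: "1 \<le> n k" if "1 \<le> k" for k using assms(1)[OF that] by simp
  obtain x0 where x0: "x0 \<in> J" using assms(4) interior_subset by blast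
  have ns: "AE \<omega> in ?P. nonautonomous_structure n T J \<omega>"
    using assms(10) unfolding translation_law_def .
  show ?thesis
  proof (cases "s_A n T \<le> ereal (real CARD('d))")
    case True
    \<comment> \<open>Empty when \<open>s_A n T\<close> is 0; the lower bound is then the
      nonnegativity of the dimension.\<close>
    let ?Q = "{q \<in> \<rat>. 0 < q \<and> ereal q < s_A n T}"
    have cQ: "countable ?Q" by (rule countable_subset[OF _ countable_rat]) auto
    have "AE \<omega> in ?P. \<forall>q\<in>?Q. nonautonomous_structure n T J \<omega> \<longrightarrow>
      (\<forall>t. 0 \<le> t \<longrightarrow> t \<le> q \<longrightarrow> hausdorff_measure t (affine_set n T J \<omega>) \<noteq> 0)"
    proof (subst AE_ball_countable[OF cQ], rule ballI)
      fix q assume q: "q \<in> ?Q"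
      then have "ereal q < s_A n T" by simp
      from less_le_trans[OF this True] show "AE \<omega> in ?P. nonautonomous_structure n T J \<omega> \<longrightarrow>
        (\<forall>t. 0 \<le> t \<longrightarrow> t \<le> q \<longrightarrow> hausdorff_measure t (affine_set n T J \<omega>) \<noteq> 0)"
        using q by (intro AE_hausdorff_measure_nonzero[OF assms(5,6,7) inv sv a assms(3) x0]) auto
    qed
    with ns have "AE \<omega> in ?P. hausdorff_dim (affine_set n T J \<omega>) = s_A n T"
    proof eventually_elim
      case (elim \<omega>)
      show ?case
      proof (rule antisym)
        show "hausdorff_dim (affine_set n T J \<omega>) \<le> s_A n T"
          by (rule hausdorff_dim_affine_set_le[OF n inv sv a assms(3) elim(1) True]) auto
        show "s_A n T \<le> hausdorff_dim (affine_set n T J \<omega>)"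
          by (rule le_hausdorff_dim) (use elim in blast)
      qed
    qed
    then show ?thesis
      unfolding translation_law_def by eventually_elim (use True in auto)
  next
    case False
    then have "ereal (real CARD('d)) < s_A n T" by simp
    then have "AE \<omega> in ?P. nonautonomous_structure n T J \<omega> \<longrightarrow>
        0 < emeasure lebesgue (affine_set n T J \<omega>)"
      by (intro AE_lebesgue_measure_pos[OF assms(5,6,7) inv sv a assms(3) x0]) auto
    with ns have "AE \<omega> in ?P. 0 < emeasure lebesgue (affine_set n T J \<omega>)" by eventually_elim simp
    then show ?thesis
      unfolding translation_law_def by eventually_elim (use False in auto)
  qed
qed

end
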